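(* Let $(X,\mathsf d,\ll,\leq,\ell)$ be a strongly causal and regular Lorentzian pre-length space and let $K\in\mathbb R$. Let $\gamma\colon[a,b]\to X$ be a timelike curve inside a $(\le K)$-comparison neighbourhood $U$ such that $\ell(\gamma(a),\gamma(b))<D_K$. If $\mathrm{TC}(\gamma)<+\infty$, then $\gamma$ is rectifiable, i.e. $L(\gamma|_{[t_1,t_2]})>0$ for all $a\le t_1<t_2\le b$.
   Context: **Lorentzian pre-length space.** A quintuple $(X,\mathsf d,\ll,\leq,\ell)$ where $(X,\mathsf d)$ is a metric space, $\leq$ is a reflexive and transitive relation, $\ll$ is a transitive relation contained in $\leq$, and $\ell\colon X\times X\to[0,+\infty]$ (the time separation) satisfies $\ell(x,z)\ge\ell(x,y)+\ell(y,z)$ whenever $x\le y\le z$, and $\ell(x,y)>0\iff x\ll y$. **Curves, length.** A (continuous) curve $\gamma\colon[a,b]\to X$ is (future-directed) causal if $\gamma(s)\le\gamma(t)$ whenever $s<t$, and timelike if $\gamma(s)\ll\gamma(t)$ whenever $s<t$; past-directed curves are defined analogously; curves are future-directed unless stated otherwise. The $\ell$-length is $L(\gamma)=\inf\sum_{i=0}^{N-1}\ell(\gamma(t_i),\gamma(t_{i+1}))$ over all partitions $a=t_0<\dots<t_N=b$. A maximising geodesic (segment) from $x$ to $y$, denoted $[x,y]$, is a causal curve from $x$ to $y$ with $L=\ell(x,y)$. **Causal properties.** $X$ is strongly causal if the timelike diamonds $\{z: x\ll z\ll y\}$ form a subbasis of the topology. $X$ is regular if whenever $\ell(x,y)>0$,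 every maximising geodesic between $x$ and $y$ is timelike (contains no null segment). **Model spaces.** $\mathbb L^2(K)$ is the (simply connected) two-dimensional Lorentzian model space of constant curvature $K$, with metric signature $(+,-)$ (Minkowski plane for $K=0$, of anti-de Sitter type for $K>0$, of de Sitter type for $K<0$). $D_K=\pi/\sqrt K$ for $K>0$ and $D_K=+\infty$ for $K\le0$. A timelike triangle $\Delta(x,y,z)$ consists of $x\ll y\ll z$ together with maximising geodesics between each pair; it satisfies size bounds if $\ell(x,z)<D_K$ (assumed throughout), and then it has a comparison triangle $\Delta(\bar x,\bar y,\bar z)$ in $\mathbb L^2(K)$ with the same side lengths, unique up to isometry. Comparison points lie on corresponding sides at the same time separations from the endpoints. **$(\le K)$-comparison neighbourhood.** An open set $U\subset X$ such that: (i) $\ell$ is continuous on $(U\times U)\cap\ell^{-1}([0,D_K))$, and this set is open; (ii) any $x\ll y$ in $U$ with $\ell(x,y)<D_K$ are joined by a maximising geodesic inside $U$; (iii) for every timelike triangle $\Delta(x,y,z)$ in $U$, points $p,q$ on its sides, and corresponding comparison points $\bar p,\bar q$ on a comparison triangle in $\mathbb L^2(K)$, one has $\ell(p,q)\ge\ell(\bar p,\bar q)$. **Angles.** For two timelike curves $\alpha,\beta\colon[0,\varepsilon)\to X$ (each future- or past-directed) with $\alpha(0)=\beta(0)=x$, the angle is $\measuredangle_x(\alpha,\beta)=\limsup_{s,t\to0}\tilde\measuredangle_x^K(\alpha(s),\beta(t))$, over those $(s,t)$ for which $\alpha(s),\beta(t)$ are timelike related and the triangle formed by $x,\alpha(s),\beta(t)$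 satisfies size bounds; here $\tilde\measuredangle^K_x$ is the hyperbolic angle at the vertex corresponding to $x$ in the comparison triangle in $\mathbb L^2(K)$, where the hyperbolic angle between timelike vectors $v,w$ is $\operatorname{arcosh}\big(|g(v,w)|/(\|v\|\|w\|)\big)$. The value is independent of $K$. $\measuredangle_y(x,z)$ denotes the angle at $y$ between the geodesics joining $y$ to $x$ and $y$ to $z$. **Total rotation and total curvature.** A timelike poly-segment is a timelike curve $\sigma\colon[a,b]\to X$ with a partition $a=t_0<\dots<t_n=b$ such that each $\sigma|_{[t_{i-1},t_i]}$ is a nonconstant maximising geodesic from $p_{i-1}$ to $p_i$, $p_i:=\sigma(t_i)$. Its total rotation is $\kappa^*(\sigma)=\sum_{i=1}^{n-1}\measuredangle_{p_i}(p_{i-1},p_{i+1})$. $\sigma$ is inscribed in a timelike curve $\gamma\colon[a,b]\to X$ if, for some partition $a=t_0<\dots<t_n=b$ and parametrisation of $\sigma$ on $[a,b]$ (with these break-points), $\sigma(t_i)=\gamma(t_i)$ for all $i$; its mesh-size is $|\sigma|=\max_i(t_{i+1}-t_i)$. The (synthetic) total curvature is $\mathrm{TC}(\gamma)=\lim_{\varepsilon\to0^+}\sup\{\kappa^*(\sigma):\sigma\text{ inscribed in }\gamma,\ |\sigma|<\varepsilon\}$. *)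

theory Defs
  imports "HOL-Analysis.Analysis"
begin

section \<open>Lorentzian pre-length spaces\<close>

locale lorentzian_pre_length_space =
  fixes ll le :: "'a::metric_space \<Rightarrow> 'a \<Rightarrow> bool"
    and ell :: "'a \<Rightarrow> 'a \<Rightarrow> ennreal"
  assumes le_refl: "le x x"
    and le_trans: "le x y \<Longrightarrow> le y z \<Longrightarrow> le x z"
    and ll_trans: "ll x y \<Longrightarrow> ll y z \<Longrightarrow> ll x z"
    and ll_imp_le: "ll x y \<Longrightarrow> le x y"
    and reverse_triangle: "le x y \<Longrightarrow> le y z \<Longrightarrow> ell x z \<ge> ell x y + ell y z"
    and ell_pos_iff: "ell x y > 0 \<longleftrightarrow> ll x y"

subsection \<open>Curves and length\<close>

definition causal_curve ::
  "('a::topological_space \<Rightarrow> 'a \<Rightarrow> bool) \<Rightarrow> (real \<Rightarrow> 'a) \<Rightarrow> real \<Rightarrow> real \<Rightarrow> bool" where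
  "causal_curve le \<gamma> a b \<longleftrightarrow> a < b \<and> continuous_on {a..b} \<gamma> \<and>
     (\<forall>s\<in>{a..b}. \<forall>t\<in>{a..b}. s < t \<longrightarrow> le (\<gamma> s) (\<gamma> t))"

definition timelike_curve ::
  "('a::topological_space \<Rightarrow> 'a \<Rightarrow> bool) \<Rightarrow> (real \<Rightarrow> 'a) \<Rightarrow> real \<Rightarrow> real \<Rightarrow> bool" where
  "timelike_curve ll \<gamma> a b \<longleftrightarrow> a < b \<and> continuous_on {a..b} \<gamma> \<and>
     (\<forall>s\<in>{a..b}. \<forall>t\<in>{a..b}. s < t \<longrightarrow> ll (\<gamma> s) (\<gamma> t))"

definition interval_partition :: "real \<Rightarrow> real \<Rightarrow> nat \<Rightarrow> (nat \<Rightarrow> real) \<Rightarrow> bool" where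
  "interval_partition a b n t \<longleftrightarrow> t 0 = a \<and> t n = b \<and> (\<forall>i<n. t i < t (Suc i))"

definition ell_length ::
  "('a \<Rightarrow> 'a \<Rightarrow> ennreal) \<Rightarrow> (real \<Rightarrow> 'a) \<Rightarrow> real \<Rightarrow> real \<Rightarrow> ennreal" where
  "ell_length ell \<gamma> a b =
     Inf {\<Sum>i<n. ell (\<gamma> (t i)) (\<gamma> (t (Suc i))) | n t. interval_partition a b n t}"

definition maximising_geodesic ::
  "('a::topological_space \<Rightarrow> 'a \<Rightarrow> bool) \<Rightarrow> ('a \<Rightarrow> 'a \<Rightarrow> ennreal) \<Rightarrow>
    (real \<Rightarrow> 'a) \<Rightarrow> real \<Rightarrow> real \<Rightarrow> 'a \<Rightarrow> 'a \<Rightarrow> bool" where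
  "maximising_geodesic le ell \<gamma> a b x y \<longleftrightarrow>
     causal_curve le \<gamma> a b \<and> \<gamma> a = x \<and> \<gamma> b = y \<and> ell_length ell \<gamma> a b = ell x y"

text \<open>The segment \<open>[x, y]\<close> as a point set.\<close>

definition maximising_segment ::
  "('a::topological_space \<Rightarrow> 'a \<Rightarrow> bool) \<Rightarrow> ('a \<Rightarrow> 'a \<Rightarrow> ennreal) \<Rightarrow> 'a \<Rightarrow> 'a \<Rightarrow> 'a set \<Rightarrow> bool" where
  "maximising_segment le ell x y S \<longleftrightarrow>
     (\<exists>\<gamma> a b. maximising_geodesic le ell \<gamma> a b x y \<and> S = \<gamma> ` {a..b})"

subsection \<open>Causal properties\<close>

definition strongly_causal :: "('a::topological_space \<Rightarrow> 'a \<Rightarrow> bool) \<Rightarrow> bool" where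
  "strongly_causal ll \<longleftrightarrow>
     (\<forall>U. open U \<longleftrightarrow> generate_topology {{z. ll x z \<and> ll z y} | x y. True} U)"

text \<open>
  Causal curves may pause, i.e. be constant on a subinterval, since \<open>\<le>\<close> is reflexive, and a pausing
  curve is never literally timelike. Hence regularity is expressed as the absence of null segments:
  any two distinct points on the geodesic are timelike related. For curves that do not pause this
  is the same as being timelike.
\<close>

definition regular_lorentzian ::
  "('a::topological_space \<Rightarrow> 'a \<Rightarrow> bool) \<Rightarrow> ('a \<Rightarrow> 'a \<Rightarrow> bool) \<Rightarrow> ('a \<Rightarrow> 'a \<Rightarrow> ennreal) \<Rightarrow> bool" where
  "regular_lorentzian ll le ell \<longleftrightarrow>
     (\<forall>x y \<gamma> a b. ell x y > 0 \<and> maximising_geodesic le ell \<gamma> a b x y \<longrightarrow>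
        (\<forall>s\<in>{a..b}. \<forall>t\<in>{a..b}. s < t \<and> \<gamma> s \<noteq> \<gamma> t \<longrightarrow> ll (\<gamma> s) (\<gamma> t)))"

section \<open>The model spaces\<close>

text \<open>
  The model space of curvature \<open>K\<close> is the plane with global coordinates \<open>(t, x)\<close>, time-oriented by
  \<open>t\<close>, and the Lorentzian metric of signature \<open>(+,-)\<close>
    \<^item> \<open>cosh\<^sup>2 (\<surd>K x) dt\<^sup>2 - dx\<^sup>2\<close> for \<open>K > 0\<close> (the universal cover of anti-de Sitter space),
    \<^item> \<open>dt\<^sup>2 - dx\<^sup>2\<close> for \<open>K = 0\<close>,
    \<^item> \<open>dt\<^sup>2 - cosh\<^sup>2 (\<surd>(-K) t) dx\<^sup>2\<close> for \<open>K < 0\<close> (the universal cover of de Sitter space).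
\<close>

definition model_metric :: "real \<Rightarrow> real \<times> real \<Rightarrow> real \<times> real \<Rightarrow> real \<times> real \<Rightarrow> real" where
  "model_metric K p v w =
     (if K > 0 then (cosh (sqrt K * snd p))\<^sup>2 * (fst v * fst w) - snd v * snd w
      else if K < 0 then fst v * fst w - (cosh (sqrt (- K) * fst p))\<^sup>2 * (snd v * snd w)
      else fst v * fst w - snd v * snd w)"

text \<open>
  Piecewise \<open>C\<^sup>1\<close> future-directed causal curves on the unit interval. One-sided limits of the
  derivative at the exceptional points are not required, which does not affect the suprema below.
\<close>

definition model_causal_curve :: "real \<Rightarrow> (real \<Rightarrow> real \<times> real) \<Rightarrow> bool" where
  "model_causal_curve K c \<longleftrightarrow> continuous_on {0..1} c \<and>
     (\<exists>S. finite S \<and> c C1_differentiable_on ({0..1} - S) \<and>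
       (\<forall>s\<in>{0..1} - S. let v = vector_derivative c (at s) in
          model_metric K (c s) v v \<ge> 0 \<and> fst v > 0))"

definition model_curve_length :: "real \<Rightarrow> (real \<Rightarrow> real \<times> real) \<Rightarrow> ennreal" where
  "model_curve_length K c =
     (\<integral>\<^sup>+ s\<in>{0..1}. ennreal (let v = vector_derivative c (at s) in
        sqrt (model_metric K (c s) v v)) \<partial>lborel)"

definition model_le :: "real \<Rightarrow> real \<times> real \<Rightarrow> real \<times> real \<Rightarrow> bool" where
  "model_le K p q \<longleftrightarrow> p = q \<or> (\<exists>c. model_causal_curve K c \<and> c 0 = p \<and> c 1 = q)"

text \<open>The supremum of the empty set is \<open>0\<close> in \<^typ>\<open>ennreal\<close>.\<close>

definition model_ell :: "real \<Rightarrow> real \<times> real \<Rightarrow> real \<times> real \<Rightarrow> ennreal" where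
  "model_ell K p q =
     (SUP c\<in>{c. model_causal_curve K c \<and> c 0 = p \<and> c 1 = q}. model_curve_length K c)"

definition model_diameter :: "real \<Rightarrow> ennreal" where
  "model_diameter K = (if K > 0 then ennreal (pi / sqrt K) else \<infinity>)"

section \<open>Comparison\<close>

text \<open>
  Size bounds and equality of side lengths are stated for all pairs of vertices, so that they apply
  whatever the chronological order of the three vertices is.
\<close>

definition size_bounds :: "real \<Rightarrow> ('a \<Rightarrow> 'a \<Rightarrow> ennreal) \<Rightarrow> 'a \<Rightarrow> 'a \<Rightarrow> 'a \<Rightarrow> bool" where
  "size_bounds K ell x y z \<longleftrightarrow> (\<forall>u\<in>{x, y, z}. \<forall>v\<in>{x, y, z}. ell u v < model_diameter K)"

definition comparison_vertices ::
  "real \<Rightarrow> ('a \<Rightarrow> 'a \<Rightarrow> ennreal) \<Rightarrow> 'a \<Rightarrow> 'a \<Rightarrow> 'a \<Rightarrow>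
    real \<times> real \<Rightarrow> real \<times> real \<Rightarrow> real \<times> real \<Rightarrow> bool" where
  "comparison_vertices K ell x y z x' y' z' \<longleftrightarrow>
     (\<forall>(u, u')\<in>{(x, x'), (y, y'), (z, z')}. \<forall>(v, v')\<in>{(x, x'), (y, y'), (z, z')}.
        model_ell K u' v' = ell u v)"

definition timelike_triangle ::
  "real \<Rightarrow> ('a::topological_space \<Rightarrow> 'a \<Rightarrow> bool) \<Rightarrow> ('a \<Rightarrow> 'a \<Rightarrow> bool) \<Rightarrow> ('a \<Rightarrow> 'a \<Rightarrow> ennreal) \<Rightarrow>
    'a \<Rightarrow> 'a \<Rightarrow> 'a \<Rightarrow> 'a set \<Rightarrow> 'a set \<Rightarrow> 'a set \<Rightarrow> bool" where
  "timelike_triangle K ll le ell x y z Sxy Syz Sxz \<longleftrightarrow>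
     ll x y \<and> ll y z \<and> size_bounds K ell x y z \<and>
     maximising_segment le ell x y Sxy \<and> maximising_segment le ell y z Syz \<and>
     maximising_segment le ell x z Sxz"

definition comparison_triangle ::
  "real \<Rightarrow> ('a \<Rightarrow> 'a \<Rightarrow> ennreal) \<Rightarrow> 'a \<Rightarrow> 'a \<Rightarrow> 'a \<Rightarrow>
    real \<times> real \<Rightarrow> real \<times> real \<Rightarrow> real \<times> real \<Rightarrow>
    (real \<times> real) set \<Rightarrow> (real \<times> real) set \<Rightarrow> (real \<times> real) set \<Rightarrow> bool" where
  "comparison_triangle K ell x y z x' y' z' Txy Tyz Txz \<longleftrightarrow>
     comparison_vertices K ell x y z x' y' z' \<and>
     maximising_segment (model_le K) (model_ell K) x' y' Txy \<and>
     maximising_segment (model_le K) (model_ell K) y' z' Tyz \<and>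
     maximising_segment (model_le K) (model_ell K) x' z' Txz"

text \<open>\<open>p'\<close> on the side \<open>T\<close> from \<open>u'\<close> to \<open>v'\<close> corresponds to \<open>p\<close> on the side \<open>S\<close> from \<open>u\<close> to \<open>v\<close>.\<close>

definition comparison_point ::
  "real \<Rightarrow> ('a \<Rightarrow> 'a \<Rightarrow> ennreal) \<Rightarrow> 'a \<Rightarrow> 'a \<Rightarrow> 'a set \<Rightarrow>
    real \<times> real \<Rightarrow> real \<times> real \<Rightarrow> (real \<times> real) set \<Rightarrow> 'a \<Rightarrow> real \<times> real \<Rightarrow> bool" where
  "comparison_point K ell u v S u' v' T p p' \<longleftrightarrow>
     p \<in> S \<and> p' \<in> T \<and> model_ell K u' p' = ell u p \<and> model_ell K p' v' = ell p v"

definition le_comparison_neighbourhood ::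
  "real \<Rightarrow> ('a::metric_space \<Rightarrow> 'a \<Rightarrow> bool) \<Rightarrow> ('a \<Rightarrow> 'a \<Rightarrow> bool) \<Rightarrow> ('a \<Rightarrow> 'a \<Rightarrow> ennreal) \<Rightarrow>
    'a set \<Rightarrow> bool" where
  "le_comparison_neighbourhood K ll le ell U \<longleftrightarrow>
     open U \<and>
     (let D = {(x, y) \<in> U \<times> U. ell x y < model_diameter K}
      in open D \<and> continuous_on D (\<lambda>(x, y). ell x y)) \<and>
     (\<forall>x\<in>U. \<forall>y\<in>U. ll x y \<and> ell x y < model_diameter K \<longrightarrow>
        (\<exists>S. maximising_segment le ell x y S \<and> S \<subseteq> U)) \<and>
     (\<forall>x y z Sxy Syz Sxz x' y' z' Txy Tyz Txz.
        timelike_triangle K ll le ell x y z Sxy Syz Sxz \<and> Sxy \<union> Syz \<union> Sxz \<subseteq> U \<and>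
        comparison_triangle K ell x y z x' y' z' Txy Tyz Txz \<longrightarrow>
        (let corresponding = (\<lambda>p p'.
               comparison_point K ell x y Sxy x' y' Txy p p' \<or>
               comparison_point K ell y z Syz y' z' Tyz p p' \<or>
               comparison_point K ell x z Sxz x' z' Txz p p')
         in \<forall>p q p' q'. corresponding p p' \<and> corresponding q q' \<longrightarrow>
              ell p q \<ge> model_ell K p' q'))"

section \<open>Angles\<close>

definition hyperbolic_angle ::
  "real \<Rightarrow> real \<times> real \<Rightarrow> real \<times> real \<Rightarrow> real \<times> real \<Rightarrow> real" where
  "hyperbolic_angle K p v w =
     arcosh (\<bar>model_metric K p v w\<bar> /
       (sqrt (model_metric K p v v) * sqrt (model_metric K p w w)))"

text \<open>
  \<open>v\<close> is a tangent vector at \<open>p\<close> of the side joining \<open>p\<close> and \<open>q\<close>, where \<open>q\<close> may lie in the future or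
  in the past of \<open>p\<close>; it is determined up to a positive factor.
\<close>

definition model_direction :: "real \<Rightarrow> real \<times> real \<Rightarrow> real \<times> real \<Rightarrow> real \<times> real \<Rightarrow> bool" where
  "model_direction K p q v \<longleftrightarrow> v \<noteq> 0 \<and>
     (\<exists>\<sigma>. \<sigma> 0 = p \<and> (\<sigma> has_vector_derivative v) (at 0 within {0..1}) \<and>
        (maximising_geodesic (model_le K) (model_ell K) \<sigma> 0 1 p q \<or>
         maximising_geodesic (model_le K) (model_ell K) (\<lambda>s. \<sigma> (1 - s)) 0 1 q p))"

text \<open>The angle at the vertex corresponding to \<open>x\<close>.\<close>

definition comparison_angle ::
  "real \<Rightarrow> ('a \<Rightarrow> 'a \<Rightarrow> ennreal) \<Rightarrow> 'a \<Rightarrow> 'a \<Rightarrow> 'a \<Rightarrow> real" where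
  "comparison_angle K ell x y z =
     (THE \<omega>. \<exists>x' y' z' v w. comparison_vertices K ell x y z x' y' z' \<and>
        model_direction K x' y' v \<and> model_direction K x' z' w \<and> \<omega> = hyperbolic_angle K x' v w)"

text \<open>
  The angle between \<open>\<alpha>\<close> and \<open>\<beta>\<close> at their common starting point \<open>\<alpha> 0 = \<beta> 0\<close>, measured by comparison
  in curvature \<open>K\<close>; its value does not depend on \<open>K\<close>. The upper limit is over \<open>s, t > 0\<close>. If there
  are no admissible pairs \<open>(s, t)\<close> near \<open>(0, 0)\<close>, its value is \<open>0\<close>.
\<close>

definition angle ::
  "real \<Rightarrow> ('a \<Rightarrow> 'a \<Rightarrow> bool) \<Rightarrow> ('a \<Rightarrow> 'a \<Rightarrow> ennreal) \<Rightarrow> (real \<Rightarrow> 'a) \<Rightarrow> (real \<Rightarrow> 'a) \<Rightarrow> ennreal" where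
  "angle K ll ell \<alpha> \<beta> =
     Limsup (inf (at_right 0 \<times>\<^sub>F at_right 0)
         (principal {(s, t). (ll (\<alpha> s) (\<beta> t) \<or> ll (\<beta> t) (\<alpha> s)) \<and>
            size_bounds K ell (\<alpha> 0) (\<alpha> s) (\<beta> t)}))
       (\<lambda>(s, t). ennreal (comparison_angle K ell (\<alpha> 0) (\<alpha> s) (\<beta> t)))"

section \<open>Total rotation and total curvature\<close>

definition timelike_poly_segment ::
  "('a::topological_space \<Rightarrow> 'a \<Rightarrow> bool) \<Rightarrow> ('a \<Rightarrow> 'a \<Rightarrow> bool) \<Rightarrow> ('a \<Rightarrow> 'a \<Rightarrow> ennreal) \<Rightarrow>
    (real \<Rightarrow> 'a) \<Rightarrow> real \<Rightarrow> real \<Rightarrow> nat \<Rightarrow> (nat \<Rightarrow> real) \<Rightarrow> bool" where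
  "timelike_poly_segment ll le ell \<sigma> a b n t \<longleftrightarrow>
     timelike_curve ll \<sigma> a b \<and> interval_partition a b n t \<and>
     (\<forall>i<n. maximising_geodesic le ell \<sigma> (t i) (t (Suc i)) (\<sigma> (t i)) (\<sigma> (t (Suc i))) \<and>
            \<not> \<sigma> constant_on {t i..t (Suc i)})"

text \<open>
  The angle at a break point is the one between the two adjacent geodesic pieces, the first of which
  is run backwards.
\<close>

definition total_rotation ::
  "real \<Rightarrow> ('a \<Rightarrow> 'a \<Rightarrow> bool) \<Rightarrow> ('a \<Rightarrow> 'a \<Rightarrow> ennreal) \<Rightarrow> (real \<Rightarrow> 'a) \<Rightarrow> nat \<Rightarrow> (nat \<Rightarrow> real) \<Rightarrow> ennreal" where
  "total_rotation K ll ell \<sigma> n t =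
     (\<Sum>i=1..<n. angle K ll ell (\<lambda>s. \<sigma> (t i - s)) (\<lambda>s. \<sigma> (t i + s)))"

definition inscribed :: "(real \<Rightarrow> 'a) \<Rightarrow> nat \<Rightarrow> (nat \<Rightarrow> real) \<Rightarrow> (real \<Rightarrow> 'a) \<Rightarrow> bool" where
  "inscribed \<sigma> n t \<gamma> \<longleftrightarrow> (\<forall>i\<le>n. \<sigma> (t i) = \<gamma> (t i))"

definition mesh_size :: "nat \<Rightarrow> (nat \<Rightarrow> real) \<Rightarrow> real" where
  "mesh_size n t = Max ((\<lambda>i. t (Suc i) - t i) ` {..<n})"

text \<open>The supremum is monotone in \<open>\<epsilon>\<close>, so the limit exists.\<close>

definition total_curvature ::
  "real \<Rightarrow> ('a::topological_space \<Rightarrow> 'a \<Rightarrow> bool) \<Rightarrow> ('a \<Rightarrow> 'a \<Rightarrow> bool) \<Rightarrow> ('a \<Rightarrow> 'a \<Rightarrow> ennreal) \<Rightarrow>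
    (real \<Rightarrow> 'a) \<Rightarrow> real \<Rightarrow> real \<Rightarrow> ennreal" where
  "total_curvature K ll le ell \<gamma> a b =
     Lim (at_right 0) (\<lambda>\<epsilon>. Sup {total_rotation K ll ell \<sigma> n t | \<sigma> n t.
       timelike_poly_segment ll le ell \<sigma> a b n t \<and> inscribed \<sigma> n t \<gamma> \<and> mesh_size n t < \<epsilon>})"

end

theory Submission
  imports Defs
begin

text \<open>
  A curve of finite total curvature is rectifiable because angles control the defect in the reverse
  triangle inequality. If \<open>x, y, z\<close> are successive points of the curve, close together, and the two
  geodesics meeting at \<open>y\<close> enclose an angle \<open>\<theta> \<le> 1\<close>, then
    \<open>ell x z \<le> ell x y + ell y z + 4 \<theta> * ell x z\<close>.
  Indeed the upper curvature bound makes the angle at least the comparison angle (lemmas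
  \<open>comparison_angle_ge\<close> and \<open>angle_ge\<close>), and the law of cosines in the model space bounds the defect of a
  triangle with a small angle (\<open>hinge_law_bounds\<close>); \<open>almost_additive\<close> combines the two.

  Let \<open>R s t\<close> be the supremum of the total rotations of all polygons inscribed in the curve between the
  parameters \<open>s\<close> and \<open>t\<close>. Finiteness of the total curvature makes \<open>R\<close> finite on short intervals
  (\<open>rotation_bounded\<close>). As \<open>R\<close> is superadditive, bisection finds, inside any given interval, a
  subinterval with \<open>R \<le> 1 / 32\<close> (\<open>rotation_small_interval\<close>). There the almost additivity is summed over
  an arbitrary partition. Summing naively would lose a factor for every break point. Cutting at half of
  the total separation instead (\<open>halving_bound\<close>), the errors form a geometric series, and every partition
  sum is at least \<open>(1 - 16 R) * ell\<close>, hence at least half of the separation of the end points. This bounds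
  the length from below by a positive number.

  The model spaces are defined by metrics on the plane and their time separation by a supremum over causal
  curves, so their trigonometry has to be derived. The three cases are treated uniformly. Around each point
  there are null coordinates \<open>u, v\<close> in which the metric of curvature \<open>4 \<kappa>\<close> is
  \<open>du dv / (1 + \<kappa> u v)\<^sup>2\<close>, and a change of centre is a Moebius transformation of each coordinate (locale
  \<open>model_null_charts\<close>). In such a chart the separation from the centre is a function of \<open>u v\<close> alone
  (\<open>curve_length_le\<close>, \<open>seg_curve\<close>), points at separation below the diameter lie in the chart (\<open>timelike_pairI\<close>),
  maximising geodesics through the centre are straight rays (\<open>collinear\<close>), and the law of cosines is a
  rational identity (\<open>hinge\<close>). Charts are given explicitly for the flat plane and for anti-de Sitter space,
  and those of de Sitter space arise from the latter by exchanging time and space (\<open>null_charts_swap\<close>).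
\<close>

section \<open>Radial length in constant curvature\<close>

lemma pos_of_le:
  fixes k :: real
  assumes "0 \<le> m" "m \<le> n" "0 < 1 + k * n"
  shows "0 < 1 + k * m"
proof (cases "k \<ge> 0")
  case True
  then have "0 \<le> k * m" using assms by simp
  then show ?thesis by linarith
next
  case False
  then have "k * n \<le> k * m" using assms by (intro mult_left_mono_neg) auto
  then show ?thesis using assms by linarith
qed

text \<open>
  The integral of \<open>1 / (1 + k x\<^sup>2)\<close> over \<open>[0, r]\<close>. In the metric \<open>du dv / (1 + k u v)\<^sup>2\<close>, which
  has curvature \<open>4 k\<close>, it is the time separation between the origin and a point with \<open>u, v \<ge> 0\<close>
  and \<open>u v = r\<^sup>2\<close>. For \<open>k > 0\<close> the range \<open>r < \<infinity>\<close> corresponds exactly to separations below the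
  diameter \<open>pi / sqrt (4 k)\<close>.
\<close>

definition radial_length :: "real \<Rightarrow> real \<Rightarrow> real" where
  "radial_length k r = (if k > 0 then arctan (sqrt k * r) / sqrt k
     else if k < 0 then artanh (sqrt (- k) * r) / sqrt (- k) else r)"

lemma radial_length_0 [simp]: "radial_length k 0 = 0"
  by (simp add: radial_length_def)

lemma radial_length_deriv:
  assumes "0 < 1 + k * r\<^sup>2"
  shows "(radial_length k has_real_derivative 1 / (1 + k * r\<^sup>2)) (at r within T)"
proof -
  consider "k > 0" | "k < 0" | "k = 0" by linarith
  then show ?thesis
  proof cases
    case 1
    then have eq: "radial_length k = (\<lambda>r. arctan (sqrt k * r) / sqrt k)"
      by (auto simp: radial_length_def)
    have "k + k * (k * r\<^sup>2) \<noteq> 0"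
      using mult_pos_pos [OF 1 assms] by (simp add: distrib_left)
    then show ?thesis unfolding eq
      using 1 assms by (auto intro!: derivative_eq_intros simp: power_mult_distrib field_simps)
  next
    case 2
    then have eq: "radial_length k = (\<lambda>r. artanh (sqrt (- k) * r) / sqrt (- k))"
      by (auto simp: radial_length_def)
    have "(sqrt (- k) * r)\<^sup>2 < 1" using 2 assms by (simp add: power_mult_distrib)
    then have "\<bar>sqrt (- k) * r\<bar> < 1" by (simp add: abs_square_less_1)
    then have "((\<lambda>r. artanh (sqrt (- k) * r)) has_real_derivative
        1 / (1 - (sqrt (- k) * r)\<^sup>2) * sqrt (- k)) (at r within T)"
      by (intro DERIV_chain2 [of artanh] artanh_real_has_field_derivative) (auto intro!: derivative_eq_intros)
    then have "((\<lambda>r. artanh (sqrt (- k) * r) / sqrt (- k)) has_real_derivative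
        1 / (1 - (sqrt (- k) * r)\<^sup>2) * sqrt (- k) / sqrt (- k)) (at r within T)"
      by (rule DERIV_cdivide)
    then show ?thesis unfolding eq using 2 by (simp add: power_mult_distrib)
  next
    case 3
    then have eq: "radial_length k = (\<lambda>r. r)"
      by (auto simp: radial_length_def)
    show ?thesis unfolding eq using 3 by (auto intro!: derivative_eq_intros)
  qed
qed

lemma radial_length_strict_mono:
  assumes "0 \<le> x" "x < y" "0 < 1 + k * y\<^sup>2"
  shows "radial_length k x < radial_length k y"
proof (rule DERIV_pos_imp_increasing [OF assms(2)])
  fix z assume "x \<le> z" "z \<le> y"
  then have "0 < 1 + k * z\<^sup>2"
    using assms by (intro pos_of_le [of "z\<^sup>2" "y\<^sup>2"]) (auto intro!: power_mono)
  then show "\<exists>d. (radial_length k has_real_derivative d) (at z) \<and> 0 < d"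
    by (intro exI [of _ "1 / (1 + k * z\<^sup>2)"] conjI radial_length_deriv) auto
qed

lemma radial_length_mono:
  assumes "0 \<le> x" "x \<le> y" "0 < 1 + k * y\<^sup>2"
  shows "radial_length k x \<le> radial_length k y"
  using radial_length_strict_mono [of x y k] assms by (cases "x = y") auto

lemma radial_length_nonneg: "0 \<le> y \<Longrightarrow> 0 < 1 + k * y\<^sup>2 \<Longrightarrow> 0 \<le> radial_length k y"
  using radial_length_mono [of 0 y k] by simp

lemma radial_length_le_iff:
  assumes "0 \<le> x" "0 \<le> y" "0 < 1 + k * x\<^sup>2" "0 < 1 + k * y\<^sup>2"
  shows "radial_length k x \<le> radial_length k y \<longleftrightarrow> x \<le> y"
  by (meson assms linorder_not_le radial_length_mono radial_length_strict_mono)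

lemma radial_length_inj:
  assumes "0 \<le> x" "0 \<le> y" "0 < 1 + k * x\<^sup>2" "0 < 1 + k * y\<^sup>2" "radial_length k x = radial_length k y"
  shows "x = y"
  by (metis assms order_antisym radial_length_le_iff order_refl)

text \<open>
  The subtraction theorem common to \<open>tan\<close>, \<open>tanh\<close> and the identity; it describes the Moebius
  transformation that moves a point of a radial geodesic to the origin.
\<close>

lemma radial_length_diff:
  assumes "0 \<le> x" "x \<le> y" "0 < 1 + k * y\<^sup>2"
  shows "radial_length k y - radial_length k x = radial_length k ((y - x) / (1 + k * x * y))"
proof (cases "x = y")
  case False
  define g where "g s = (s - x) / (1 + k * x * s)" for s
  have pos: "0 < 1 + k * x * s" "0 < 1 + k * s\<^sup>2" "0 < 1 + k * x\<^sup>2" if "x \<le> s" "s \<le> y" for s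
  proof -
    have "x * s \<le> y\<^sup>2" "s\<^sup>2 \<le> y\<^sup>2" "x\<^sup>2 \<le> y\<^sup>2"
      using that assms by (auto simp: power2_eq_square intro!: mult_mono)
    then show "0 < 1 + k * x * s" "0 < 1 + k * s\<^sup>2" "0 < 1 + k * x\<^sup>2"
      using that assms pos_of_le [of "x * s" "y\<^sup>2" k] pos_of_le [of "s\<^sup>2" "y\<^sup>2" k]
        pos_of_le [of "x\<^sup>2" "y\<^sup>2" k] by (auto simp: mult.assoc)
  qed
  have key: "1 + k * (g s)\<^sup>2 = (1 + k * x\<^sup>2) * (1 + k * s\<^sup>2) / (1 + k * x * s)\<^sup>2"
    if "x \<le> s" "s \<le> y" for s
    using pos(1) [OF that] unfolding g_def
    by (simp add: power_divide field_simps) (simp add: power2_eq_square algebra_simps)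
  have d: "((\<lambda>s. radial_length k s - radial_length k (g s)) has_real_derivative 0) (at s)"
    if s: "x \<le> s" "s \<le> y" for s
  proof -
    have g': "(g has_real_derivative (1 + k * x\<^sup>2) / (1 + k * x * s)\<^sup>2) (at s)"
      unfolding g_def using pos(1) [OF s]
      by (auto intro!: derivative_eq_intros simp: power2_eq_square algebra_simps)
    have "0 < 1 + k * (g s)\<^sup>2"
      unfolding key [OF s] using pos [OF s] by simp
    from DERIV_chain2 [OF radial_length_deriv [OF this] g']
    have c: "((\<lambda>s. radial_length k (g s)) has_real_derivative
       1 / (1 + k * (g s)\<^sup>2) * ((1 + k * x\<^sup>2) / (1 + k * x * s)\<^sup>2)) (at s)" .
    have e: "1 / (1 + k * (g s)\<^sup>2) * ((1 + k * x\<^sup>2) / (1 + k * x * s)\<^sup>2) = 1 / (1 + k * s\<^sup>2)"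
    proof -
      have "1 / (A * B / C\<^sup>2) * (A / C\<^sup>2) = 1 / B" if "A \<noteq> 0" "B \<noteq> 0" "C \<noteq> 0" for A B C :: real
        using that by (simp add: field_simps)
      then show "1 / (1 + k * (g s)\<^sup>2) * ((1 + k * x\<^sup>2) / (1 + k * x * s)\<^sup>2) = 1 / (1 + k * s\<^sup>2)"
        unfolding key [OF s] using pos [OF s] by (metis less_numeral_extra(3))
    qed
    show ?thesis
      using DERIV_diff [OF radial_length_deriv [OF pos(2) [OF s]] c] unfolding e by simp
  qed
  have "radial_length k y - radial_length k (g y) = radial_length k x - radial_length k (g x)"
  proof (rule DERIV_isconst_end [of x y "\<lambda>s. radial_length k s - radial_length k (g s)"])
    show "x < y" using assms False by simp
    show "continuous_on {x..y} (\<lambda>s. radial_length k s - radial_length k (g s))"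
      using d by (intro continuous_at_imp_continuous_on ballI) (auto intro: DERIV_isCont)
  qed (use d in auto)
  then show ?thesis by (simp add: g_def)
qed simp

section \<open>Partitions and curves with additive separation\<close>

lemma nondecreasing_of_deriv:
  fixes f :: "real \<Rightarrow> real"
  assumes "continuous_on {a..b} f" "finite S" "a \<le> b"
    and "\<And>s. s \<in> {a<..<b} - S \<Longrightarrow> \<exists>d\<ge>0. (f has_real_derivative d) (at s)"
  shows "f a \<le> f b"
proof -
  define d where "d s = (if s \<in> {a<..<b} - S then (SOME d. d \<ge> 0 \<and> (f has_real_derivative d) (at s)) else 0)" for s
  have d: "d s \<ge> 0 \<and> (f has_real_derivative d s) (at s)" if "s \<in> {a<..<b} - S" for s
    using someI_ex [OF assms(4) [OF that, unfolded Bex_def]] that unfolding d_def by auto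
  have d0: "d s \<ge> 0" for s using d by (cases "s \<in> {a<..<b} - S") (auto simp: d_def)
  have "(d has_integral f b - f a) {a..b}"
    using assms d
    by (intro fundamental_theorem_of_calculus_interior_strong [of S])
       (auto simp: has_real_derivative_iff_has_vector_derivative)
  from has_integral_nonneg [OF this] d0 show ?thesis by auto
qed

lemma interval_partition_mono:
  assumes "interval_partition a b n t" "i \<le> j" "j \<le> n"
  shows "t i \<le> t j"
proof -
  have "j \<le> n \<longrightarrow> t i \<le> t j"
    using assms(2)
  proof (induction j rule: dec_induct)
    case (step m)
    show ?case
    proof
      assume "Suc m \<le> n"
      then have "t m < t (Suc m)" using assms(1) by (auto simp: interval_partition_def)
      then show "t i \<le> t (Suc m)" using step.IH \<open>Suc m \<le> n\<close> by linarith
    qed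
  qed simp
  then show ?thesis using assms(3) by blast
qed

lemma interval_partition_range:
  assumes "interval_partition a b n t" "i \<le> n"
  shows "t i \<in> {a..b}"
  using interval_partition_mono [OF assms(1), of 0 i] interval_partition_mono [OF assms(1), of i n] assms
  by (auto simp: interval_partition_def)

text \<open>
  If the time separation along \<open>c\<close> is the increment of a monotone \<open>f\<close>, the sum over every
  partition telescopes to the same value. Such curves are therefore maximising.
\<close>

lemma ell_length_additive:
  assumes "a < b"
    and add: "\<And>s t. a \<le> s \<Longrightarrow> s < t \<Longrightarrow> t \<le> b \<Longrightarrow> f s \<le> f t \<and> ell (c s) (c t) = ennreal (f t - f s)"
  shows "ell_length ell c a b = ell (c a) (c b)"
proof -
  have sum: "(\<Sum>i<n. ell (c (t i)) (c (t (Suc i)))) = ennreal (f b - f a)"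
    if p: "interval_partition a b n t" for n t
  proof -
    have st: "f (t i) \<le> f (t (Suc i)) \<and> ell (c (t i)) (c (t (Suc i))) = ennreal (f (t (Suc i)) - f (t i))"
      if "i < n" for i
      using interval_partition_range [OF p, of i] interval_partition_range [OF p, of "Suc i"] that p
      by (intro add) (auto simp: interval_partition_def)
    have "(\<Sum>i<n. ell (c (t i)) (c (t (Suc i)))) = (\<Sum>i<n. ennreal (f (t (Suc i)) - f (t i)))"
      using st by (intro sum.cong) auto
    also have "\<dots> = ennreal (\<Sum>i<n. f (t (Suc i)) - f (t i))"
      using st by (intro sum_ennreal) auto
    also have "(\<Sum>i<n. f (t (Suc i)) - f (t i)) = f (t n) - f (t 0)"
      by (rule sum_lessThan_telescope)
    finally show ?thesis using p by (simp add: interval_partition_def)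
  qed
  have ex: "interval_partition a b 1 (\<lambda>i. if i = 0 then a else b)"
    using assms by (simp add: interval_partition_def)
  have "{\<Sum>i<n. ell (c (t i)) (c (t (Suc i))) | n t. interval_partition a b n t} = {ennreal (f b - f a)}"
    using ex by (auto simp: sum) (metis sum)
  then show ?thesis
    using add [of a b] assms(1) by (simp add: ell_length_def)
qed

section \<open>Causal curves in the model spaces\<close>

lemma model_causal_curveE:
  assumes "model_causal_curve K c"
  obtains S where "finite S" "continuous_on {0..1} c"
    "\<And>s. s \<in> {0..1} - S \<Longrightarrow> (c has_vector_derivative vector_derivative c (at s)) (at s)"
    "\<And>s. s \<in> {0..1} - S \<Longrightarrow>
       0 \<le> model_metric K (c s) (vector_derivative c (at s)) (vector_derivative c (at s))"
    "\<And>s. s \<in> {0..1} - S \<Longrightarrow> 0 < fst (vector_derivative c (at s))"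
proof -
  from assms obtain S where S: "finite S" "c C1_differentiable_on ({0..1} - S)"
     "\<forall>s\<in>{0..1} - S. let v = vector_derivative c (at s) in model_metric K (c s) v v \<ge> 0 \<and> fst v > 0"
     "continuous_on {0..1} c"
    unfolding model_causal_curve_def by blast
  then have "\<And>s. s \<in> {0..1} - S \<Longrightarrow> (c has_vector_derivative vector_derivative c (at s)) (at s)"
    by (simp add: C1_differentiable_on_eq vector_derivative_works)
  then show ?thesis using S that by (auto simp: Let_def)
qed

lemma has_vector_derivative_fst_snd:
  assumes "(c has_vector_derivative c') F"
  shows "((\<lambda>s. fst (c s)) has_vector_derivative fst c') F"
    "((\<lambda>s. snd (c s)) has_vector_derivative snd c') F"
  using has_derivative_fst [OF assms [unfolded has_vector_derivative_def]]
    has_derivative_snd [OF assms [unfolded has_vector_derivative_def]]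
  by (simp_all add: has_vector_derivative_def)

text \<open>
  The time coordinate of a causal curve has positive derivative off a finite set. This excludes
  closed causal curves, so that no two points of the model space are separated in both directions.
\<close>

lemma model_causal_curve_time:
  assumes "model_causal_curve K c"
  shows "fst (c 0) < fst (c 1)"
proof -
  from assms obtain S where S: "finite S" "continuous_on {0..1} c"
    "\<And>s. s \<in> {0..1} - S \<Longrightarrow> (c has_vector_derivative vector_derivative c (at s)) (at s)"
    "\<And>s. s \<in> {0..1} - S \<Longrightarrow> 0 < fst (vector_derivative c (at s))"
    by (rule model_causal_curveE) blast
  define f where "f s = fst (c s)" for s
  have cf: "continuous_on {0..1} f" unfolding f_def using S(2) by (intro continuous_intros)
  have df: "(f has_real_derivative fst (vector_derivative c (at s))) (at s)" if "s \<in> {0..1} - S" for s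
    using has_vector_derivative_fst_snd(1) [OF S(3) [OF that]]
    by (simp add: f_def [abs_def] has_real_derivative_iff_has_vector_derivative)
  have mono: "f s \<le> f t" if "0 \<le> s" "s \<le> t" "t \<le> 1" for s t
  proof (rule nondecreasing_of_deriv [OF continuous_on_subset [OF cf] S(1)])
    fix r assume "r \<in> {s<..<t} - S"
    then have "r \<in> {0..1} - S" using that by auto
    from df [OF this] S(4) [OF this]
    show "\<exists>d\<ge>0. (f has_real_derivative d) (at r)" by (auto intro: less_imp_le)
  qed (use that in auto)
  show ?thesis
  proof (rule ccontr)
    assume "\<not> fst (c 0) < fst (c 1)"
    then have const: "f s = f 0" if "s \<in> {0..1}" for s
      using mono [of 0 s] mono [of s 1] that by (auto simp: f_def)
    have "{0<..<1} - S \<noteq> {}"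
      using infinite_imp_nonempty [OF Diff_infinite_finite [OF S(1), of "{0<..<1::real}"]] infinite_Ioo [of 0 "1::real"] by simp
    then obtain s where s: "s \<in> {0<..<1} - S" by blast
    from s have "(f has_real_derivative fst (vector_derivative c (at s))) (at s)"
      by (intro df) auto
    then have "((\<lambda>_. f 0) has_real_derivative fst (vector_derivative c (at s))) (at s)"
      using s const
      by (elim has_field_derivative_transform_within_open [of _ _ _ "{0<..<1}"]) (simp, simp, rule const, simp)
    then have "fst (vector_derivative c (at s)) = 0"
      by (rule DERIV_unique) (rule DERIV_const)
    then show False using S(4) [of s] s by auto
  qed
qed

lemma model_le_time: "model_le K p q \<Longrightarrow> p = q \<or> fst p < fst q"
  using model_causal_curve_time unfolding model_le_def by blast

lemma model_ell_eq_0: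
  assumes "fst q \<le> fst p"
  shows "model_ell K p q = 0"
proof -
  have "{c. model_causal_curve K c \<and> c 0 = p \<and> c 1 = q} = {}"
  proof (rule equals0I)
    fix c assume "c \<in> {c. model_causal_curve K c \<and> c 0 = p \<and> c 1 = q}"
    then show False using model_causal_curve_time [of K c] assms by auto
  qed
  then show ?thesis by (simp only: model_ell_def) (simp add: bot_ennreal)
qed

lemma model_ell_pos_curve:
  assumes "0 < model_ell K p q"
  obtains c where "model_causal_curve K c" "c 0 = p" "c 1 = q"
proof -
  have "{c. model_causal_curve K c \<and> c 0 = p \<and> c 1 = q} \<noteq> {}"
    using assms by (intro notI) (simp add: model_ell_def bot_ennreal)
  then show ?thesis using that by blast
qed

section \<open>Null charts and time separation\<close>

type_synonym point = "real \<times> real"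

text \<open>
  A Lorentzian plane of constant curvature \<open>4 \<kappa>\<close> in the frame \<open>h1 dt \<plusminus> h2 dx\<close> has around every
  point \<open>y\<close> a chart with null coordinates \<open>u y\<close>, \<open>v y\<close> vanishing at \<open>y\<close>, in which the metric is
  \<open>du dv / (1 + \<kappa> u v)\<^sup>2\<close>. Here \<open>M y p\<close> says that \<open>p\<close> lies in the chart centred at \<open>y\<close>; \<open>A y\<close> and
  \<open>B y\<close> are the factors by which \<open>du\<close> and \<open>dv\<close> stretch the two null covectors of the frame; \<open>iv y\<close>
  inverts the chart; \<open>gU\<close> and \<open>gV\<close> are global null coordinates, which have the same monotonicity
  as every \<open>u y\<close> and \<open>v y\<close>.

  The axiom \<open>moebius\<close> is homogeneity of the plane. A change of centre acts on each null coordinate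
  by a fractional linear map, and the factor \<open>\<rho>\<close> is the remaining Lorentz boost. All trigonometry
  below is derived from it.

  The axioms speak of the frame and not of the metric, whose sign would single out time; they are
  therefore stable under exchanging the roles of time and space.
\<close>

locale null_charts =
  fixes \<kappa> :: real
    and M :: "point \<Rightarrow> point \<Rightarrow> bool"
    and u v A B :: "point \<Rightarrow> point \<Rightarrow> real"
    and iv :: "point \<Rightarrow> real \<Rightarrow> real \<Rightarrow> point"
    and h1 h2 gU gV :: "point \<Rightarrow> real"
  assumes h_pos: "0 < h1 p" "0 < h2 p"
    and h_cont: "continuous_on UNIV h1" "continuous_on UNIV h2"
    and centre: "M y y" "u y y = 0" "v y y = 0"
    and conf_pos: "M y p \<Longrightarrow> 0 < 1 + \<kappa> * (u y p * v y p)"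
    and AB_pos: "M y p \<Longrightarrow> 0 < A y p" "M y p \<Longrightarrow> 0 < B y p"
    and AB_mult: "M y p \<Longrightarrow> A y p * B y p = (1 + \<kappa> * (u y p * v y p))\<^sup>2"
    and AB_cont: "continuous_on {p. M y p} (A y)" "continuous_on {p. M y p} (B y)"
    and uv_cont: "continuous_on {p. M y p} (u y)" "continuous_on {p. M y p} (v y)"
    and u_deriv: "M y (c s) \<Longrightarrow> (c has_vector_derivative c') (at s within T) \<Longrightarrow>
      ((\<lambda>s. u y (c s)) has_real_derivative A y (c s) * (h1 (c s) * fst c' + h2 (c s) * snd c')) (at s within T)"
    and v_deriv: "M y (c s) \<Longrightarrow> (c has_vector_derivative c') (at s within T) \<Longrightarrow>
      ((\<lambda>s. v y (c s)) has_real_derivative B y (c s) * (h1 (c s) * fst c' - h2 (c s) * snd c')) (at s within T)"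
    and iv: "0 < 1 + \<kappa> * (a * b) \<Longrightarrow> M y (iv y a b)" "0 < 1 + \<kappa> * (a * b) \<Longrightarrow> u y (iv y a b) = a"
      "0 < 1 + \<kappa> * (a * b) \<Longrightarrow> v y (iv y a b) = b"
    and iv_uv: "M y p \<Longrightarrow> iv y (u y p) (v y p) = p"
    and iv_diff: "0 < 1 + \<kappa> * ((s * a) * (s * b)) \<Longrightarrow> (\<lambda>s. iv y (s * a) (s * b)) differentiable (at s)"
    and moebius: "M y p \<Longrightarrow> \<exists>\<rho>>0. \<forall>q. M y q \<longrightarrow> 0 < 1 + \<kappa> * (u y q * v y p) \<longrightarrow> 0 < 1 + \<kappa> * (u y p * v y q) \<longrightarrow>
        M p q \<and> u p q = \<rho> * ((u y q - u y p) / (1 + \<kappa> * (u y q * v y p)))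
              \<and> v p q = (v y q - v y p) / (1 + \<kappa> * (u y p * v y q)) / \<rho>"
    and u_le_iff: "M y p \<Longrightarrow> M y q \<Longrightarrow> u y p \<le> u y q \<longleftrightarrow> gU p \<le> gU q"
    and v_le_iff: "M y p \<Longrightarrow> M y q \<Longrightarrow> v y p \<le> v y q \<longleftrightarrow> gV p \<le> gV q"

text \<open>
  The charts of the model space of curvature \<open>K\<close>. The last two axioms control the domains of the
  charts: they contain every causal diamond starting at the centre whose end point they contain,
  and a causal curve can leave the chart centred at its starting point only for positive curvature
  and only after \<open>u v\<close> has become arbitrarily large, that is, after the time separation from the
  centre has come arbitrarily close to the diameter.
\<close>

locale model_null_charts = null_charts +
  fixes K :: real and G :: "point \<Rightarrow> real"
  assumes K: "K = 4 * \<kappa>"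
    and metric: "model_metric K p a b = (h1 p)\<^sup>2 * (fst a * fst b) - (h2 p)\<^sup>2 * (snd a * snd b)"
    and G_pos: "0 < G p"
    and gU_cont: "continuous_on UNIV gU" "continuous_on UNIV gV"
    and gU_deriv: "(c has_vector_derivative c') (at s) \<Longrightarrow>
      ((\<lambda>s. gU (c s)) has_real_derivative G (c s) * (h1 (c s) * fst c' + h2 (c s) * snd c')) (at s)"
    and gV_deriv: "(c has_vector_derivative c') (at s) \<Longrightarrow>
      ((\<lambda>s. gV (c s)) has_real_derivative G (c s) * (h1 (c s) * fst c' - h2 (c s) * snd c')) (at s)"
    and between: "M p q \<Longrightarrow> gU p \<le> gU m \<Longrightarrow> gU m \<le> gU q \<Longrightarrow> gV p \<le> gV m \<Longrightarrow> gV m \<le> gV q \<Longrightarrow> M p m"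
    and exit: "continuous_on {0..1} c \<Longrightarrow> c 0 = p \<Longrightarrow> mono_on {0..1} (\<lambda>s. gU (c s)) \<Longrightarrow>
       mono_on {0..1} (\<lambda>s. gV (c s)) \<Longrightarrow> \<not> M p (c 1) \<Longrightarrow>
       0 < \<kappa> \<and> (\<forall>R. \<exists>s\<in>{0..1}. M p (c s) \<and> R < u p (c s) * v p (c s))"
begin

abbreviation "e \<equiv> model_ell K"
abbreviation "rl \<equiv> radial_length \<kappa>"

lemma metric_split: "model_metric K p w w = (h1 p * fst w + h2 p * snd w) * (h1 p * fst w - h2 p * snd w)"
  by (simp add: metric power2_eq_square algebra_simps)

lemma causal_vector:
  assumes "0 \<le> model_metric K p w w" "0 < fst w"
  shows "0 \<le> h1 p * fst w + h2 p * snd w" "0 \<le> h1 p * fst w - h2 p * snd w"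
proof -
  let ?a = "h1 p * fst w + h2 p * snd w" and ?b = "h1 p * fst w - h2 p * snd w"
  have ab: "0 \<le> ?a * ?b" using assms(1) by (simp add: metric_split)
  have s: "0 < ?a + ?b" using mult_pos_pos [OF h_pos(1) assms(2), of p] by (simp add: mult.commute)
  show "0 \<le> ?a" using ab s by (smt (verit) mult_nonneg_nonpos zero_less_mult_iff mult_neg_pos)
  show "0 \<le> ?b" using ab s by (smt (verit) mult_nonneg_nonpos zero_less_mult_iff mult_pos_neg)
qed

lemma curve_null_mono:
  assumes "model_causal_curve K c" "0 \<le> s" "s \<le> t" "t \<le> 1"
  shows "gU (c s) \<le> gU (c t)" "gV (c s) \<le> gV (c t)"
proof -
  from assms(1) obtain S where S: "finite S" "continuous_on {0..1} c"
    "\<And>s. s \<in> {0..1} - S \<Longrightarrow> (c has_vector_derivative vector_derivative c (at s)) (at s)"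
    "\<And>s. s \<in> {0..1} - S \<Longrightarrow>
       0 \<le> model_metric K (c s) (vector_derivative c (at s)) (vector_derivative c (at s))"
    "\<And>s. s \<in> {0..1} - S \<Longrightarrow> 0 < fst (vector_derivative c (at s))"
    by (rule model_causal_curveE) blast
  have cst: "continuous_on {s..t} c"
    using assms by (intro continuous_on_subset [OF S(2)]) auto
  have cont: "continuous_on {s..t} (\<lambda>s. gU (c s))" "continuous_on {s..t} (\<lambda>s. gV (c s))"
    by (rule continuous_on_compose2 [OF gU_cont(1) cst] continuous_on_compose2 [OF gU_cont(2) cst], simp)+
  show "gU (c s) \<le> gU (c t)"
  proof (rule nondecreasing_of_deriv [OF cont(1) S(1) assms(3)])
    fix r assume "r \<in> {s<..<t} - S"
    then have r: "r \<in> {0..1} - S" using assms by auto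
    show "\<exists>d\<ge>0. ((\<lambda>s. gU (c s)) has_real_derivative d) (at r)"
      by (intro exI conjI, rule mult_nonneg_nonneg [OF less_imp_le [OF G_pos] causal_vector(1) [OF S(4) [OF r] S(5) [OF r]]],
          rule gU_deriv [OF S(3) [OF r]])
  qed
  show "gV (c s) \<le> gV (c t)"
  proof (rule nondecreasing_of_deriv [OF cont(2) S(1) assms(3)])
    fix r assume "r \<in> {s<..<t} - S"
    then have r: "r \<in> {0..1} - S" using assms by auto
    show "\<exists>d\<ge>0. ((\<lambda>s. gV (c s)) has_real_derivative d) (at r)"
      by (intro exI conjI, rule mult_nonneg_nonneg [OF less_imp_le [OF G_pos] causal_vector(2) [OF S(4) [OF r] S(5) [OF r]]],
          rule gV_deriv [OF S(3) [OF r]])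
  qed
qed

lemma model_le_null:
  assumes "model_le K p q"
  shows "gU p \<le> gU q" "gV p \<le> gV q"
  using assms curve_null_mono [of _ 0 1] unfolding model_le_def by auto

lemma chart_nonneg:
  assumes "M p q" "gU p \<le> gU q" "gV p \<le> gV q"
  shows "0 \<le> u p q" "0 \<le> v p q"
  using u_le_iff [OF centre(1) assms(1)] v_le_iff [OF centre(1) assms(1)] assms by (auto simp: centre)

text \<open>
  In the null coordinates \<open>x, y\<close> of the starting point, the speed of the curve is
  \<open>sqrt (x' y') / (1 + \<kappa> x y)\<close>. By the inequality of the arithmetic and the geometric mean,
  \<open>sqrt (x' y' x y) \<le> (x' y + x y') / 2\<close>, so the speed is at most the derivative of the radial
  length of \<open>sqrt (x y)\<close>. That function is not differentiable where \<open>x y = 0\<close>, but as both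
  coordinates are monotone this is an initial piece of the curve, on which the curve is null and
  has length zero.
\<close>

lemma curve_length_le:
  assumes c: "model_causal_curve K c" and p: "c 0 = p" and M1: "M p (c 1)"
  shows "model_curve_length K c \<le> ennreal (rl (sqrt (u p (c 1) * v p (c 1))))"
proof -
  from c obtain S where S: "finite S" "continuous_on {0..1} c"
    "\<And>s. s \<in> {0..1} - S \<Longrightarrow> (c has_vector_derivative vector_derivative c (at s)) (at s)"
    "\<And>s. s \<in> {0..1} - S \<Longrightarrow>
       0 \<le> model_metric K (c s) (vector_derivative c (at s)) (vector_derivative c (at s))"
    "\<And>s. s \<in> {0..1} - S \<Longrightarrow> 0 < fst (vector_derivative c (at s))"
    by (rule model_causal_curveE) blast
  define w where "w s = vector_derivative c (at s)" for s
  define x where "x s = u p (c s)" for s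
  define y where "y s = v p (c s)" for s
  define x' where "x' s = A p (c s) * (h1 (c s) * fst (w s) + h2 (c s) * snd (w s))" for s
  define y' where "y' s = B p (c s) * (h1 (c s) * fst (w s) - h2 (c s) * snd (w s))" for s
  have M: "M p (c s)" if "s \<in> {0..1}" for s
    using that curve_null_mono [OF c, of 0 s] curve_null_mono [OF c, of s 1]
    by (intro between [OF M1]) (auto simp: p)
  have xmono: "x s \<le> x t" "y s \<le> y t" if "0 \<le> s" "s \<le> t" "t \<le> 1" for s t
    using that u_le_iff [OF M M, of s t] v_le_iff [OF M M, of s t] curve_null_mono [OF c, of s t]
    by (auto simp: x_def y_def)
  have xy0: "x 0 = 0" "y 0 = 0" by (simp_all add: x_def y_def p centre)
  have nn: "0 \<le> x s" "0 \<le> y s" if "s \<in> {0..1}" for s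
    using xmono [of 0 s] that by (auto simp: xy0)
  have conf: "0 < 1 + \<kappa> * (x s * y s)" if "s \<in> {0..1}" for s
    using conf_pos [OF M [OF that]] by (simp add: x_def y_def)
  have dx: "(x has_real_derivative x' s) (at s)" and dy: "(y has_real_derivative y' s) (at s)"
    and x'y': "0 \<le> x' s" "0 \<le> y' s"
    and speed: "model_metric K (c s) (w s) (w s) = x' s * y' s / (1 + \<kappa> * (x s * y s))\<^sup>2"
    if s: "s \<in> {0..1} - S" for s
  proof -
    from s have Ms: "M p (c s)" by (intro M) auto
    show "(x has_real_derivative x' s) (at s)" "(y has_real_derivative y' s) (at s)"
      unfolding x_def [abs_def] y_def [abs_def] x'_def y'_def w_def
      by (rule u_deriv [OF Ms S(3) [OF s]] v_deriv [OF Ms S(3) [OF s]])+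
    show "0 \<le> x' s" "0 \<le> y' s"
      unfolding x'_def y'_def w_def
      using causal_vector [OF S(4) [OF s] S(5) [OF s]] AB_pos [OF Ms] by auto
    have "(1 + \<kappa> * (x s * y s))\<^sup>2 = A p (c s) * B p (c s)"
      by (simp add: AB_mult [OF Ms] x_def y_def)
    then show "model_metric K (c s) (w s) (w s) = x' s * y' s / (1 + \<kappa> * (x s * y s))\<^sup>2"
      using AB_pos [OF Ms] by (simp add: metric_split x'_def y'_def)
  qed
  have cx: "continuous_on {0..1} x" and cy: "continuous_on {0..1} y"
    unfolding x_def [abs_def] y_def [abs_def]
    by (rule continuous_on_compose2 [OF uv_cont(1) S(2)] continuous_on_compose2 [OF uv_cont(2) S(2)], use M in auto)+
  \<comment> \<open>The set of zeros of \<open>x y\<close> is an initial interval by monotonicity; \<open>s0\<close> is its end.\<close>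
  define Z where "Z = {s \<in> {0..1}. x s * y s = 0}"
  have "closed Z" unfolding Z_def
    by (intro continuous_closed_preimage_constant continuous_intros cx cy)
  then have "compact ({0..1} \<inter> Z)" by (intro compact_Int_closed) auto
  moreover have "{0..1} \<inter> Z = Z" by (auto simp: Z_def)
  ultimately have "compact Z" by simp
  moreover have "0 \<in> Z" by (simp add: Z_def xy0)
  ultimately obtain s0 where s0: "s0 \<in> Z" "\<And>s. s \<in> Z \<Longrightarrow> s \<le> s0"
    using compact_attains_sup [of Z] by blast
  then have s01: "0 \<le> s0" "s0 \<le> 1" "x s0 = 0 \<or> y s0 = 0" by (auto simp: Z_def)
  define f where "f s = rl (sqrt (x s * y s))" for s
  define g where "g s = (if s \<in> {s0<..<1} - S then (x' s * y s + x s * y' s) / (2 * sqrt (x s * y s)) / (1 + \<kappa> * (x s * y s)) else 0)" for s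
  have pos: "0 < x s * y s" if "s \<in> {s0<..1}" for s
  proof -
    have "s \<notin> Z" using s0(2) [of s] that by auto
    then have "x s * y s \<noteq> 0" using that s01 by (auto simp: Z_def)
    moreover have "0 \<le> x s * y s" using nn [of s] that s01 by auto
    ultimately show ?thesis by linarith
  qed
  have g0: "0 \<le> g s" for s
    using nn [of s] x'y' [of s] conf [of s] s01 by (auto simp: g_def)
  have int: "(g has_integral f 1 - f s0) {s0..1}"
  proof (rule fundamental_theorem_of_calculus_interior_strong [OF S(1) s01(2)])
    show "continuous_on {s0..1} f"
      unfolding f_def [abs_def]
    proof (rule continuous_on_compose2 [where t = "{r. 0 < 1 + \<kappa> * r\<^sup>2}" and g = rl])
      show "continuous_on {r. 0 < 1 + \<kappa> * r\<^sup>2} rl"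
        by (intro continuous_at_imp_continuous_on ballI DERIV_isCont [OF radial_length_deriv]) auto
      show "continuous_on {s0..1} (\<lambda>s. sqrt (x s * y s))"
        using s01 by (intro continuous_intros continuous_on_subset [OF cx] continuous_on_subset [OF cy]) auto
      show "(\<lambda>s. sqrt (x s * y s)) ` {s0..1} \<subseteq> {r. 0 < 1 + \<kappa> * r\<^sup>2}"
        using conf nn s01 by auto
    qed
    fix s assume s: "s \<in> {s0<..<1} - S"
    then have s': "s \<in> {0..1} - S" "s \<in> {s0<..1}" using s01 by auto
    have "((\<lambda>s. sqrt (x s * y s)) has_real_derivative (x' s * y s + x s * y' s) / (2 * sqrt (x s * y s))) (at s)"
      using pos [OF s'(2)] dx [OF s'(1)] dy [OF s'(1)]
      by (auto intro!: derivative_eq_intros simp: field_simps)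
    moreover have "0 < 1 + \<kappa> * (sqrt (x s * y s))\<^sup>2" using conf [of s] pos [OF s'(2)] s' by auto
    ultimately have "(f has_real_derivative 1 / (1 + \<kappa> * (sqrt (x s * y s))\<^sup>2) * ((x' s * y s + x s * y' s) / (2 * sqrt (x s * y s)))) (at s)"
      unfolding f_def [abs_def] by (intro DERIV_chain2 [OF radial_length_deriv])
    moreover have "1 / (1 + \<kappa> * (sqrt (x s * y s))\<^sup>2) * ((x' s * y s + x s * y' s) / (2 * sqrt (x s * y s))) = g s"
      using s pos [OF s'(2)] by (simp add: g_def)
    ultimately show "(f has_vector_derivative g s) (at s)"
      by (simp add: has_real_derivative_iff_has_vector_derivative)
  qed
  have le: "sqrt (model_metric K (c s) (w s) (w s)) \<le> (if s \<in> {s0..1} then g s else 0)"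
    if s: "s \<in> {0..1} - S" "s \<noteq> s0" "s \<noteq> 0" "s \<noteq> 1" for s
  proof (cases "s < s0")
    case True
    \<comment> \<open>A nonnegative monotone coordinate that vanishes at \<open>s0\<close> vanishes identically before it.\<close>
    have zero: "x' s * y' s = 0" using s01(3)
    proof
      assume "x s0 = 0"
      then have z: "x r = 0" if "r \<in> {0<..<s0}" for r
        using that xmono [of 0 r] xmono [of r s0] s01 by (auto simp: xy0)
      have "((\<lambda>_. 0) has_real_derivative x' s) (at s)"
        using dx [OF s(1)] True s z by (elim has_field_derivative_transform_within_open [of _ _ _ "{0<..<s0}"]) auto
      then have "x' s = 0" by (rule DERIV_unique) (rule DERIV_const)
      then show ?thesis by simp
    next
      assume "y s0 = 0"
      then have z: "y r = 0" if "r \<in> {0<..<s0}" for r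
        using that xmono [of 0 r] xmono [of r s0] s01 by (auto simp: xy0)
      have "((\<lambda>_. 0) has_real_derivative y' s) (at s)"
        using dy [OF s(1)] True s z by (elim has_field_derivative_transform_within_open [of _ _ _ "{0<..<s0}"]) auto
      then have "y' s = 0" by (rule DERIV_unique) (rule DERIV_const)
      then show ?thesis by simp
    qed
    show ?thesis unfolding speed [OF s(1)] zero using True by simp
  next
    case False
    then have s': "s \<in> {s0<..<1} - S" "s \<in> {s0<..1}" "s \<in> {0..1}" using s s01 by auto
    have P: "0 < sqrt (x s * y s)" "0 < 1 + \<kappa> * (x s * y s)"
      using pos [OF s'(2)] conf [OF s'(3)] by auto
    have "sqrt (x' s * y' s) * sqrt (x s * y s) = sqrt ((x' s * y s) * (x s * y' s))"
      by (simp add: real_sqrt_mult [symmetric] mult_ac)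
    also have "\<dots> \<le> (x' s * y s + x s * y' s) / 2"
      using nn [OF s'(3)] x'y' [OF s(1)] by (intro arith_geo_mean_sqrt) auto
    finally have "sqrt (x' s * y' s) \<le> (x' s * y s + x s * y' s) / (2 * sqrt (x s * y s))"
      using P(1) by (simp add: field_simps)
    from divide_right_mono [OF this, of "1 + \<kappa> * (x s * y s)"]
    have "sqrt (x' s * y' s) / (1 + \<kappa> * (x s * y s)) \<le> g s"
      using P(2) s' by (simp add: g_def)
    moreover have "sqrt (model_metric K (c s) (w s) (w s)) = sqrt (x' s * y' s) / (1 + \<kappa> * (x s * y s))"
      using P(2) by (simp add: speed [OF s(1)] real_sqrt_divide)
    ultimately show ?thesis using s' by simp
  qed
  have "model_curve_length K c = (\<integral>\<^sup>+ s. ennreal (sqrt (model_metric K (c s) (w s) (w s))) * indicator {0..1} s \<partial>lborel)"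
    by (simp add: model_curve_length_def w_def Let_def)
  also have "\<dots> \<le> (\<integral>\<^sup>+ s. ennreal (g s) * indicator {s0..1} s \<partial>lborel)"
  proof (rule nn_integral_mono_AE)
    have "AE s in lborel. s \<notin> S \<union> {s0, 0, 1}"
      using S(1) by (intro AE_not_in finite_imp_null_set_lborel) auto
    then show "AE s in lborel. ennreal (sqrt (model_metric K (c s) (w s) (w s))) * indicator {0..1} s \<le> ennreal (g s) * indicator {s0..1} s"
    proof eventually_elim
      case (elim s)
      then show ?case using le [of s] s01 by (cases "s \<in> {0..1}"; cases "s \<in> {s0..1}") (auto intro!: ennreal_leI simp: ennreal_eq_0_iff)
    qed
  qed
  also have "\<dots> = ennreal (f 1 - f s0)"
    using int g0 by (intro nn_integral_has_integral_lebesgue') auto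
  also have "f s0 = 0" using s01(3) by (auto simp: f_def)
  finally show ?thesis by (simp add: f_def x_def y_def)
qed

text \<open>
  The straight segment from the origin in the chart centred at \<open>p\<close>, along which the inequality of
  the means in the length estimate is an equality.
\<close>

definition seg :: "point \<Rightarrow> point \<Rightarrow> real \<Rightarrow> point" where
  "seg p q s = iv p (s * u p q) (s * v p q)"

definition timelike_pair :: "point \<Rightarrow> point \<Rightarrow> bool" where
  "timelike_pair p q \<longleftrightarrow> M p q \<and> 0 < u p q \<and> 0 < v p q"

lemma seg_conf:
  assumes "timelike_pair p q" "0 \<le> s" "s \<le> 1" "0 \<le> t" "t \<le> 1"
  shows "0 < 1 + \<kappa> * ((s * u p q) * (t * v p q))"
proof (rule pos_of_le [of _ "u p q * v p q"])
  have "s * t \<le> 1" using assms by (simp add: mult_le_one)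
  moreover have "0 \<le> u p q * v p q" using assms(1) by (simp add: timelike_pair_def)
  ultimately have "(s * t) * (u p q * v p q) \<le> 1 * (u p q * v p q)"
    by (rule mult_right_mono)
  then show "(s * u p q) * (t * v p q) \<le> u p q * v p q" by (simp add: mult_ac)
qed (use assms conf_pos in \<open>auto simp: timelike_pair_def\<close>)

lemma seg_chart:
  assumes "timelike_pair p q" "0 \<le> s" "s \<le> 1"
  shows "M p (seg p q s)" "u p (seg p q s) = s * u p q" "v p (seg p q s) = s * v p q"
  using iv [OF seg_conf [OF assms(1) assms(2,3) assms(2,3)]] by (auto simp: seg_def)

lemma seg_ends:
  assumes "timelike_pair p q"
  shows "seg p q 0 = p" "seg p q 1 = q"
  using iv_uv [of p q] iv_uv [of p p] assms by (auto simp: seg_def timelike_pair_def centre)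

lemma seg_deriv:
  assumes "timelike_pair p q" "0 \<le> s" "s \<le> 1"
  defines "z \<equiv> seg p q s"
  shows "(seg p q has_vector_derivative
     ((u p q / A p z + v p q / B p z) / (2 * h1 z), (u p q / A p z - v p q / B p z) / (2 * h2 z))) (at s)"
proof -
  have conf: "0 < 1 + \<kappa> * ((s * u p q) * (s * v p q))" by (rule seg_conf [OF assms(1) assms(2,3) assms(2,3)])
  from iv_diff [OF this] have "seg p q differentiable (at s)" by (simp add: seg_def [abs_def])
  then obtain c' where c': "(seg p q has_vector_derivative c') (at s)"
    using vector_derivative_works by blast
  have Mz: "M p z" using seg_chart(1) [OF assms(1-3)] by (simp add: z_def)
  define O' where "O' = {r. 0 < 1 + \<kappa> * ((r * u p q) * (r * v p q))}"
  have O': "open O'" "s \<in> O'"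
    unfolding O'_def using conf by (auto intro!: open_Collect_less continuous_intros)
  have uvs: "u p (seg p q r) = r * u p q" "v p (seg p q r) = r * v p q" if "r \<in> O'" for r
    using that iv unfolding O'_def seg_def by blast+
  have "((\<lambda>r. r * u p q) has_real_derivative A p z * (h1 z * fst c' + h2 z * snd c')) (at s)"
    using has_field_derivative_transform_within_open [OF u_deriv [OF Mz [unfolded z_def] c'] O' uvs(1)]
    by (simp add: z_def)
  moreover have "((\<lambda>r. r * v p q) has_real_derivative B p z * (h1 z * fst c' - h2 z * snd c')) (at s)"
    using has_field_derivative_transform_within_open [OF v_deriv [OF Mz [unfolded z_def] c'] O' uvs(2)]
    by (simp add: z_def)
  moreover have "((\<lambda>r. r * u p q) has_real_derivative u p q) (at s)" "((\<lambda>r. r * v p q) has_real_derivative v p q) (at s)"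
    by (auto intro!: derivative_eq_intros)
  ultimately have "A p z * (h1 z * fst c' + h2 z * snd c') = u p q" "B p z * (h1 z * fst c' - h2 z * snd c') = v p q"
    using DERIV_unique by blast+
  then have "u p q / A p z = h1 z * fst c' + h2 z * snd c'" "v p q / B p z = h1 z * fst c' - h2 z * snd c'"
    using AB_pos [OF Mz] by (auto simp: field_simps)
  then have "c' = ((u p q / A p z + v p q / B p z) / (2 * h1 z), (u p q / A p z - v p q / B p z) / (2 * h2 z))"
    using h_pos [of z] by (auto simp: prod_eq_iff field_simps)
  then show ?thesis using c' by simp
qed

text \<open>
  Along the segment both null coordinates grow linearly, so the speed is exactly the derivative of
  the radial length.
\<close>

lemma seg_curve:
  assumes t: "timelike_pair p q"
  shows "model_causal_curve K (seg p q)"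
    and "model_curve_length K (seg p q) = ennreal (rl (sqrt (u p q * v p q)))"
proof -
  define W where "W z = ((u p q / A p z + v p q / B p z) / (2 * h1 z), (u p q / A p z - v p q / B p z) / (2 * h2 z))" for z
  have d: "(seg p q has_vector_derivative W (seg p q s)) (at s)" if "s \<in> {0..1}" for s
    using seg_deriv [OF t, of s] that by (simp add: W_def)
  have vd: "vector_derivative (seg p q) (at s) = W (seg p q s)" if "s \<in> {0..1}" for s
    by (rule vector_derivative_at [OF d [OF that]])
  have cs: "continuous_on {0..1} (seg p q)"
    using d by (intro continuous_at_imp_continuous_on ballI) (auto intro: has_vector_derivative_continuous)
  have M: "M p (seg p q s)" if "s \<in> {0..1}" for s using seg_chart(1) [OF t, of s] that by auto
  have pos: "0 < A p (seg p q s)" "0 < B p (seg p q s)" if "s \<in> {0..1}" for s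
    using AB_pos [OF M [OF that]] by auto
  have uvp: "0 < u p q" "0 < v p q" using t by (auto simp: timelike_pair_def)
  have hW: "h1 z * fst (W z) = (u p q / A p z + v p q / B p z) / 2"
      "h2 z * snd (W z) = (u p q / A p z - v p q / B p z) / 2" for z
    using h_pos [of z] by (simp_all add: W_def)
  have halves: "(x + y) / 2 + (x - y) / 2 = x" "(x + y) / 2 - (x - y) / 2 = y" for x y :: real
    by (simp_all add: field_simps)
  have met: "model_metric K (seg p q s) (W (seg p q s)) (W (seg p q s)) = (u p q * v p q) / (1 + \<kappa> * (s\<^sup>2 * (u p q * v p q)))\<^sup>2"
    if "s \<in> {0..1}" for s
  proof -
    have "A p (seg p q s) * B p (seg p q s) = (1 + \<kappa> * (s\<^sup>2 * (u p q * v p q)))\<^sup>2"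
      using AB_mult [OF M [OF that]] seg_chart [OF t, of s] that by (simp add: power2_eq_square mult_ac)
    moreover have "h1 (seg p q s) * fst (W (seg p q s)) + h2 (seg p q s) * snd (W (seg p q s)) = u p q / A p (seg p q s)"
      by (simp only: hW halves)
    moreover have "h1 (seg p q s) * fst (W (seg p q s)) - h2 (seg p q s) * snd (W (seg p q s)) = v p q / B p (seg p q s)"
      by (simp only: hW halves)
    ultimately show ?thesis unfolding metric_split by (simp only: times_divide_times_eq)
  qed
  have fstW: "0 < fst (W (seg p q s))" if "s \<in> {0..1}" for s
  proof -
    have "0 < u p q / A p (seg p q s)" "0 < v p q / B p (seg p q s)"
      using pos [OF that] uvp by (simp_all only: divide_pos_pos)
    then have "0 < h1 (seg p q s) * fst (W (seg p q s))" unfolding hW by (intro half_gt_zero add_pos_pos)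
    then show ?thesis using h_pos(1) [of "seg p q s"] by (simp only: zero_less_mult_pos)
  qed
  have contc: "continuous_on {0..1} (\<lambda>s. A p (seg p q s))" "continuous_on {0..1} (\<lambda>s. B p (seg p q s))"
    "continuous_on {0..1} (\<lambda>s. h1 (seg p q s))" "continuous_on {0..1} (\<lambda>s. h2 (seg p q s))"
    by (rule continuous_on_compose2 [OF AB_cont(1) cs] continuous_on_compose2 [OF AB_cont(2) cs]
         continuous_on_compose2 [OF h_cont(1) cs] continuous_on_compose2 [OF h_cont(2) cs], use M in auto)+
  have nz: "\<forall>s\<in>{0..1}. A p (seg p q s) \<noteq> 0" "\<forall>s\<in>{0..1}. B p (seg p q s) \<noteq> 0"
    "\<forall>s\<in>{0..1}. 2 * h1 (seg p q s) \<noteq> 0" "\<forall>s\<in>{0..1}. 2 * h2 (seg p q s) \<noteq> 0"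
    using pos h_pos by (metis less_numeral_extra(3) mult_pos_pos zero_less_numeral)+
  have "continuous_on {0..1} (\<lambda>s. W (seg p q s))"
    unfolding W_def
    by (intro continuous_on_Pair continuous_on_divide continuous_on_add continuous_on_diff
        continuous_on_mult continuous_on_const contc nz)
  then have "seg p q C1_differentiable_on {0..1} - {}"
    unfolding C1_differentiable_on_def using d by (intro exI [of _ "\<lambda>s. W (seg p q s)"]) simp
  moreover have "let v = vector_derivative (seg p q) (at s) in 0 \<le> model_metric K (seg p q s) v v \<and> 0 < fst v"
    if "s \<in> {0..1} - {}" for s
  proof -
    have s: "s \<in> {0..1}" using that by simp
    have "0 \<le> (u p q * v p q) / (1 + \<kappa> * (s\<^sup>2 * (u p q * v p q)))\<^sup>2"
      using uvp by (intro divide_nonneg_nonneg) auto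
    then show ?thesis unfolding vd [OF s] Let_def met [OF s] using fstW [OF s] by blast
  qed
  ultimately show "model_causal_curve K (seg p q)"
    unfolding model_causal_curve_def using cs finite.emptyI by blast
  have conf: "0 < 1 + \<kappa> * (s\<^sup>2 * (u p q * v p q))" if "s \<in> {0..1}" for s
    using seg_conf [OF t, of s s] that by (auto simp: power2_eq_square mult_ac)
  define a where "a = sqrt (u p q * v p q)"
  have a: "0 < a" "a\<^sup>2 = u p q * v p q" using uvp by (auto simp: a_def)
  have sp: "sqrt (model_metric K (seg p q s) (W (seg p q s)) (W (seg p q s))) = a / (1 + \<kappa> * (s * a)\<^sup>2)"
    if "s \<in> {0..1}" for s
    unfolding met [OF that] real_sqrt_divide using conf [OF that] by (simp add: power_mult_distrib a(2)) (simp add: a_def)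
  have "model_curve_length K (seg p q) = (\<integral>\<^sup>+ s\<in>{0..1}. ennreal (a / (1 + \<kappa> * (s * a)\<^sup>2)) \<partial>lborel)"
    unfolding model_curve_length_def
  proof (rule nn_integral_cong)
    fix s :: real
    show "ennreal (let v = vector_derivative (seg p q) (at s) in sqrt (model_metric K (seg p q s) v v)) * indicator {0..1} s
        = ennreal (a / (1 + \<kappa> * (s * a)\<^sup>2)) * indicator {0..1} s"
      by (cases "s \<in> {0..1}") (simp only: vd Let_def sp, simp)
  qed
  also have "\<dots> = ennreal (rl (1 * a) - rl (0 * a))"
  proof (rule nn_integral_FTC_Icc)
    fix s :: real assume s: "s \<in> {0..1}"
    have "0 < 1 + \<kappa> * (s * a)\<^sup>2" using conf [OF s] by (simp add: power_mult_distrib a)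
    have "((\<lambda>s. s * a) has_real_derivative a) (at s)"
      by (auto intro!: derivative_eq_intros)
    from DERIV_chain2 [where g = "\<lambda>s. s * a", OF radial_length_deriv [OF \<open>0 < 1 + \<kappa> * (s * a)\<^sup>2\<close>, where T = UNIV] this]
    show "((\<lambda>s. rl (s * a)) has_real_derivative a / (1 + \<kappa> * (s * a)\<^sup>2)) (at s)" by simp
    show "0 \<le> a / (1 + \<kappa> * (s * a)\<^sup>2)" using \<open>0 < 1 + \<kappa> * (s * a)\<^sup>2\<close> a by simp
  qed auto
  finally show "model_curve_length K (seg p q) = ennreal (rl (sqrt (u p q * v p q)))" by (simp add: a_def)
qed

lemma timelike_pair_model_le: "timelike_pair p q \<Longrightarrow> model_le K p q"
  using seg_curve seg_ends unfolding model_le_def by blast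

text \<open>
  The radial length bounds the length of every causal curve, and is attained by the radial segment
  unless the points are null related, where it vanishes.
\<close>

lemma model_ell_chart:
  assumes "M p q" "gU p \<le> gU q" "gV p \<le> gV q"
  shows "e p q = ennreal (rl (sqrt (u p q * v p q)))"
proof (rule antisym)
  show "e p q \<le> ennreal (rl (sqrt (u p q * v p q)))"
    unfolding model_ell_def
  proof (rule SUP_least)
    fix c assume "c \<in> {c. model_causal_curve K c \<and> c 0 = p \<and> c 1 = q}"
    then show "model_curve_length K c \<le> ennreal (rl (sqrt (u p q * v p q)))"
      using curve_length_le [of c p] assms(1) by simp
  qed
  show "ennreal (rl (sqrt (u p q * v p q))) \<le> e p q"
  proof (cases "timelike_pair p q")
    case True
    then show ?thesis unfolding model_ell_def
      using seg_curve [OF True] seg_ends [OF True] by (intro SUP_upper2 [of "seg p q"]) auto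
  next
    case False
    then have "u p q * v p q = 0" using chart_nonneg [OF assms] assms by (auto simp: timelike_pair_def)
    then have "rl (sqrt (u p q * v p q)) = 0" by (simp only: real_sqrt_zero radial_length_0)
    then show ?thesis by simp
  qed
qed

lemma model_ell_timelike_pair:
  assumes "timelike_pair p q"
  shows "e p q = ennreal (rl (sqrt (u p q * v p q)))" "0 < e p q" "0 < rl (sqrt (u p q * v p q))"
proof -
  show 1: "e p q = ennreal (rl (sqrt (u p q * v p q)))"
    using assms model_le_null [OF timelike_pair_model_le [OF assms]]
    by (intro model_ell_chart) (auto simp: timelike_pair_def)
  show 2: "0 < rl (sqrt (u p q * v p q))"
    using radial_length_strict_mono [of 0 "sqrt (u p q * v p q)" \<kappa>] assms conf_pos [of p q]
    by (auto simp: timelike_pair_def)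
  show "0 < e p q" using 1 2 by simp
qed

end

section \<open>Concatenation of causal curves\<close>

lemma affine_vector_derivative:
  assumes "(c has_vector_derivative d) (at (m + r * s))"
  shows "((\<lambda>s. c (m + r * s)) has_vector_derivative r *\<^sub>R d) (at (s::real))"
proof -
  have "((\<lambda>s. m + r * s) has_vector_derivative r) (at s)"
    by (auto intro!: derivative_eq_intros simp flip: has_real_derivative_iff_has_vector_derivative)
  from vector_diff_chain_at [OF this assms] show ?thesis by (simp add: o_def)
qed

lemma model_metric_scaleR:
  "model_metric K p (r *\<^sub>R w) (r *\<^sub>R w) = r\<^sup>2 * model_metric K p w w"
  by (simp add: model_metric_def power2_eq_square algebra_simps)

lemma continuous_on_affine_compose:
  fixes c :: "real \<Rightarrow> 'b::topological_space"
  assumes "continuous_on T c" "\<And>s. s \<in> T' \<Longrightarrow> m + r * s \<in> T"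
  shows "continuous_on T' (\<lambda>s. c (m + r * s))"
proof (rule continuous_on_compose2 [OF assms(1)])
  show "continuous_on T' (\<lambda>s. m + r * s)" by (intro continuous_on_add continuous_on_mult continuous_on_const continuous_on_id)
qed (use assms(2) in blast)

lemma C1_affine:
  fixes c :: "real \<Rightarrow> 'b::real_normed_vector"
  assumes "c C1_differentiable_on T" "\<And>s. s \<in> T' \<Longrightarrow> m + r * s \<in> T"
  shows "(\<lambda>s. c (m + r * s)) C1_differentiable_on T'"
proof -
  obtain D where D: "\<And>s. s \<in> T \<Longrightarrow> (c has_vector_derivative D s) (at s)" "continuous_on T D"
    using assms(1) unfolding C1_differentiable_on_def by blast
  have "continuous_on T' (\<lambda>s. D (m + r * s))"
    by (rule continuous_on_affine_compose [OF D(2) assms(2)])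
  then have "continuous_on T' (\<lambda>s. r *\<^sub>R D (m + r * s))"
    by (intro continuous_on_scaleR continuous_on_const)
  moreover have "\<forall>s\<in>T'. ((\<lambda>s. c (m + r * s)) has_vector_derivative r *\<^sub>R D (m + r * s)) (at s)"
    using affine_vector_derivative [OF D(1) [OF assms(2)]] by simp
  ultimately show ?thesis
    unfolding C1_differentiable_on_def by (intro exI [of _ "\<lambda>s. r *\<^sub>R D (m + r * s)"] conjI)
qed

lemma finite_affine_preimage:
  fixes S :: "real set"
  assumes "finite S" "r \<noteq> 0"
  shows "finite {s. m + r * s \<in> S}"
  using finite_vimageI [OF assms(1), of "\<lambda>s. m + r * s"] assms(2) by (simp add: inj_def vimage_def)

lemma model_causal_curve_sub:
  assumes c: "model_causal_curve K c" and m: "0 \<le> m" "0 < r" "m + r \<le> 1"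
  shows "model_causal_curve K (\<lambda>s. c (m + r * s))"
proof -
  from c obtain S where S: "finite S" "c C1_differentiable_on ({0..1} - S)" "continuous_on {0..1} c"
     "\<And>s. s \<in> {0..1} - S \<Longrightarrow> model_metric K (c s) (vector_derivative c (at s)) (vector_derivative c (at s)) \<ge> 0 \<and> fst (vector_derivative c (at s)) > 0"
    unfolding model_causal_curve_def Let_def by blast
  define S' where "S' = {s. m + r * s \<in> S}"
  have in01: "m + r * s \<in> {0..1}" if "s \<in> {0..1}" for s
  proof -
    have "0 \<le> r * s" "r * s \<le> r" using that m mult_left_mono [of s 1 r] by auto
    then have "0 \<le> m + r * s" "m + r * s \<le> 1" using m by linarith+
    then show ?thesis by simp
  qed
  have in': "m + r * s \<in> {0..1} - S" if "s \<in> {0..1} - S'" for s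
    using that in01 by (auto simp: S'_def)
  have "(c has_vector_derivative vector_derivative c (at s)) (at s)" if "s \<in> {0..1} - S" for s
    using S(2) that by (simp add: C1_differentiable_on_eq vector_derivative_works)
  then have vd: "vector_derivative (\<lambda>s. c (m + r * s)) (at s) = r *\<^sub>R vector_derivative c (at (m + r * s))"
    if "s \<in> {0..1} - S'" for s
    using in' [OF that] by (intro vector_derivative_at affine_vector_derivative) auto
  show ?thesis unfolding model_causal_curve_def Let_def
  proof (intro conjI exI [of _ S'] ballI)
    show "continuous_on {0..1} (\<lambda>s. c (m + r * s))"
      by (rule continuous_on_affine_compose [OF S(3) in01])
    show "finite S'" unfolding S'_def using S(1) m by (intro finite_affine_preimage) auto
    show "(\<lambda>s. c (m + r * s)) C1_differentiable_on {0..1} - S'"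
      using in' by (intro C1_affine [OF S(2)])
    fix s assume s: "s \<in> {0..1} - S'"
    show "0 \<le> model_metric K (c (m + r * s)) (vector_derivative (\<lambda>s. c (m + r * s)) (at s)) (vector_derivative (\<lambda>s. c (m + r * s)) (at s))"
      "0 < fst (vector_derivative (\<lambda>s. c (m + r * s)) (at s))"
      unfolding vd [OF s] model_metric_scaleR using S(4) [OF in' [OF s]] m by auto
  qed
qed

text \<open>
  The curves are run through at double speed, and the length of the first one is invariant under
  this reparametrisation.
\<close>

lemma model_causal_curve_join:
  assumes c1: "model_causal_curve K c1" and c2: "model_causal_curve K c2" and j: "c1 1 = c2 0"
  obtains c where "model_causal_curve K c" "c 0 = c1 0" "c 1 = c2 1"
    "model_curve_length K c1 \<le> model_curve_length K c"
proof -
  from c1 obtain S1 where S1: "finite S1" "c1 C1_differentiable_on ({0..1} - S1)" "continuous_on {0..1} c1"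
     "\<And>s. s \<in> {0..1} - S1 \<Longrightarrow> model_metric K (c1 s) (vector_derivative c1 (at s)) (vector_derivative c1 (at s)) \<ge> 0 \<and> fst (vector_derivative c1 (at s)) > 0"
    unfolding model_causal_curve_def Let_def by blast
  from c2 obtain S2 where S2: "finite S2" "c2 C1_differentiable_on ({0..1} - S2)" "continuous_on {0..1} c2"
     "\<And>s. s \<in> {0..1} - S2 \<Longrightarrow> model_metric K (c2 s) (vector_derivative c2 (at s)) (vector_derivative c2 (at s)) \<ge> 0 \<and> fst (vector_derivative c2 (at s)) > 0"
    unfolding model_causal_curve_def Let_def by blast
  define c where "c s = (if s \<le> 1/2 then c1 (0 + 2 * s) else c2 (-1 + 2 * s))" for s
  define S where "S = {s. 0 + 2 * s \<in> S1} \<union> {s. -1 + 2 * s \<in> S2} \<union> {1/2, 0, 1::real}"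
  have fS: "finite S" unfolding S_def using finite_affine_preimage [OF S1(1), of 2 0] finite_affine_preimage [OF S2(1), of 2 "-1"] by simp
  have eq1: "c s = c1 (0 + 2 * s)" if "s \<in> {..<1/2}" for s using that by (simp add: c_def)
  have eq2: "c s = c2 (-1 + 2 * s)" if "s \<in> {1/2<..}" for s using that by (simp add: c_def)
  have d1: "(c1 has_vector_derivative vector_derivative c1 (at s)) (at s)" if "s \<in> {0..1} - S1" for s
    using S1(2) that by (simp add: C1_differentiable_on_eq vector_derivative_works)
  have d2: "(c2 has_vector_derivative vector_derivative c2 (at s)) (at s)" if "s \<in> {0..1} - S2" for s
    using S2(2) that by (simp add: C1_differentiable_on_eq vector_derivative_works)
  have D1: "(c has_vector_derivative 2 *\<^sub>R vector_derivative c1 (at (0 + 2 * s))) (at s)"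
    if "s \<in> {0..1} - S" "s < 1/2" for s
  proof (rule has_vector_derivative_transform_within_open [of "\<lambda>s. c1 (0 + 2 * s)" _ _ "{..<1/2}"])
    show "((\<lambda>s. c1 (0 + 2 * s)) has_vector_derivative 2 *\<^sub>R vector_derivative c1 (at (0 + 2 * s))) (at s)"
      using that by (intro affine_vector_derivative d1) (auto simp: S_def)
  qed (use that eq1 in auto)
  have D2: "(c has_vector_derivative 2 *\<^sub>R vector_derivative c2 (at (-1 + 2 * s))) (at s)"
    if "s \<in> {0..1} - S" "s > 1/2" for s
  proof (rule has_vector_derivative_transform_within_open [of "\<lambda>s. c2 (-1 + 2 * s)" _ _ "{1/2<..}"])
    show "((\<lambda>s. c2 (-1 + 2 * s)) has_vector_derivative 2 *\<^sub>R vector_derivative c2 (at (-1 + 2 * s))) (at s)"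
      using that by (intro affine_vector_derivative d2) (auto simp: S_def)
  qed (use that eq2 in auto)
  define D where "D s = (if s < 1/2 then 2 *\<^sub>R vector_derivative c1 (at (0 + 2 * s)) else 2 *\<^sub>R vector_derivative c2 (at (-1 + 2 * s)))" for s
  have DD: "(c has_vector_derivative D s) (at s)" if "s \<in> {0..1} - S" for s
  proof -
    have "s \<noteq> 1/2" using that by (auto simp: S_def)
    then show ?thesis using D1 [OF that] D2 [OF that] by (cases "s < 1/2") (auto simp: D_def)
  qed
  have vd: "vector_derivative c (at s) = D s" if "s \<in> {0..1} - S" for s
    by (rule vector_derivative_at [OF DD [OF that]])
  have cD1: "continuous_on ({0<..<1/2} - S) D"
  proof (rule continuous_on_eq)
    have "continuous_on ({0<..<1/2} - S) (\<lambda>s. vector_derivative c1 (at (0 + 2 * s)))"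
      using S1(2) unfolding C1_differentiable_on_eq
      by (intro continuous_on_affine_compose [of "{0..1} - S1" "\<lambda>s. vector_derivative c1 (at s)"]) (auto simp: S_def)
    then show "continuous_on ({0<..<1/2} - S) (\<lambda>s. 2 *\<^sub>R vector_derivative c1 (at (0 + 2 * s)))"
      by (intro continuous_on_scaleR continuous_on_const)
  qed (auto simp: D_def)
  have cD2: "continuous_on ({1/2<..<1} - S) D"
  proof (rule continuous_on_eq)
    have "continuous_on ({1/2<..<1} - S) (\<lambda>s. vector_derivative c2 (at (-1 + 2 * s)))"
      using S2(2) unfolding C1_differentiable_on_eq
      by (intro continuous_on_affine_compose [of "{0..1} - S2" "\<lambda>s. vector_derivative c2 (at s)"]) (auto simp: S_def)
    then show "continuous_on ({1/2<..<1} - S) (\<lambda>s. 2 *\<^sub>R vector_derivative c2 (at (-1 + 2 * s)))"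
      by (intro continuous_on_scaleR continuous_on_const)
  qed (auto simp: D_def)
  have un: "{0..1} - S = ({0<..<1/2} - S) \<union> ({1/2<..<1} - S)" by (auto simp: S_def)
  have "continuous_on ({0..1} - S) D"
    unfolding un using fS cD1 cD2
    by (intro continuous_on_open_Un open_Diff finite_imp_closed) auto
  then have C1: "c C1_differentiable_on ({0..1} - S)"
    unfolding C1_differentiable_on_def using DD by blast
  have cc: "continuous_on {0..1} c"
  proof -
    have "continuous_on {0..1/2} (\<lambda>s. c1 (0 + 2 * s))"
      by (rule continuous_on_affine_compose [OF S1(3)]) auto
    moreover have "continuous_on {1/2..1} (\<lambda>s. c2 (-1 + 2 * s))"
      by (rule continuous_on_affine_compose [OF S2(3)]) auto
    ultimately have "continuous_on ({0..1/2} \<union> {1/2..1}) (\<lambda>s. if s \<le> 1/2 then c1 (0 + 2 * s) else c2 (-1 + 2 * s))"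
    proof (intro continuous_on_cases allI impI)
      fix t :: real assume "t \<in> {0..1/2} \<and> \<not> t \<le> 1/2 \<or> t \<in> {1/2..1} \<and> t \<le> 1/2"
      then have "t = 1/2" by auto
      show "c1 (0 + 2 * t) = c2 (-1 + 2 * t)" unfolding \<open>t = 1/2\<close> using j by simp
    qed auto
    moreover have "{0..1/2} \<union> {1/2..1} = {0..1::real}" by auto
    ultimately show ?thesis unfolding c_def [abs_def] by simp
  qed
  have causal: "0 \<le> model_metric K (c s) (vector_derivative c (at s)) (vector_derivative c (at s)) \<and> 0 < fst (vector_derivative c (at s))"
    if s: "s \<in> {0..1} - S" for s
  proof (cases "s < 1/2")
    case True
    then have "0 + 2 * s \<in> {0..1} - S1" using s by (auto simp: S_def)
    from S1(4) [OF this] show ?thesis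
      unfolding vd [OF s] using True eq1 [of s] by (simp add: D_def model_metric_scaleR)
  next
    case False
    then have s': "-1 + 2 * s \<in> {0..1} - S2" "s > 1/2" using s by (auto simp: S_def)
    from S2(4) [OF s'(1)] show ?thesis
      unfolding vd [OF s] using s'(2) eq2 [of s] by (simp add: D_def model_metric_scaleR)
  qed
  have curve: "model_causal_curve K c"
    unfolding model_causal_curve_def Let_def using cc fS C1 causal by blast
  define w where "w s = ennreal (sqrt (model_metric K (c1 s) (vector_derivative c1 (at s)) (vector_derivative c1 (at s)))) * indicator {0..1} s" for s
  have cw: "continuous_on ({0<..<1} - S1) (\<lambda>s. sqrt (model_metric K (c1 s) (vector_derivative c1 (at s)) (vector_derivative c1 (at s))))"
  proof -
    have "continuous_on ({0<..<1} - S1) c1" "continuous_on ({0<..<1} - S1) (\<lambda>s. vector_derivative c1 (at s))"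
      using S1(2,3) unfolding C1_differentiable_on_eq by (auto elim!: continuous_on_subset)
    then show ?thesis unfolding model_metric_def
      by (cases "K > 0"; cases "K < 0") (simp_all, (intro continuous_intros; assumption)+)
  qed
  have "(\<lambda>s. indicator ({0<..<1} - S1) s *\<^sub>R sqrt (model_metric K (c1 s) (vector_derivative c1 (at s)) (vector_derivative c1 (at s)))) \<in> borel_measurable borel"
    using S1(1) by (intro borel_measurable_continuous_on_indicator cw) (auto intro!: borel_open open_Diff finite_imp_closed)
  then have meas: "(\<lambda>s. ennreal (indicator ({0<..<1} - S1) s *\<^sub>R sqrt (model_metric K (c1 s) (vector_derivative c1 (at s)) (vector_derivative c1 (at s))))) \<in> borel_measurable borel"
    by measurable
  define w' where "w' s = ennreal (indicator ({0<..<1} - S1) s *\<^sub>R sqrt (model_metric K (c1 s) (vector_derivative c1 (at s)) (vector_derivative c1 (at s))))" for s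
  have w'm: "w' \<in> borel_measurable borel" using meas by (simp add: w'_def [abs_def])
  have "model_curve_length K c1 = (\<integral>\<^sup>+ s. w s \<partial>lborel)"
    by (simp add: model_curve_length_def w_def Let_def)
  also have "\<dots> = (\<integral>\<^sup>+ s. w' s \<partial>lborel)"
  proof (rule nn_integral_cong_AE)
    have "AE s in lborel. s \<notin> S1 \<union> {0, 1}"
      using S1(1) by (intro AE_not_in finite_imp_null_set_lborel) auto
    then show "AE s in lborel. w s = w' s"
      by eventually_elim (auto simp: w_def w'_def indicator_def)
  qed
  also have "\<dots> = ennreal \<bar>2\<bar> * (\<integral>\<^sup>+ s. w' (0 + 2 * s) \<partial>lborel)"
    using w'm by (intro nn_integral_real_affine) auto
  also have "\<dots> = (\<integral>\<^sup>+ s. ennreal 2 * w' (0 + 2 * s) \<partial>lborel)"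
    using w'm by (subst nn_integral_cmult) auto
  also have "\<dots> \<le> (\<integral>\<^sup>+ s. ennreal (sqrt (model_metric K (c s) (vector_derivative c (at s)) (vector_derivative c (at s)))) * indicator {0..1} s \<partial>lborel)"
  proof (rule nn_integral_mono_AE)
    have "AE s in lborel. s \<notin> S"
      using fS by (intro AE_not_in finite_imp_null_set_lborel) auto
    then show "AE s in lborel. ennreal 2 * w' (0 + 2 * s) \<le> ennreal (sqrt (model_metric K (c s) (vector_derivative c (at s)) (vector_derivative c (at s)))) * indicator {0..1} s"
    proof eventually_elim
      case (elim s)
      show ?case
      proof (cases "0 + 2 * s \<in> {0<..<1} - S1")
        case True
        then have s: "s \<in> {0..1} - S" "s < 1/2" using elim by auto
        have "sqrt (model_metric K (c s) (vector_derivative c (at s)) (vector_derivative c (at s)))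
           = 2 * sqrt (model_metric K (c1 (0 + 2 * s)) (vector_derivative c1 (at (0 + 2 * s))) (vector_derivative c1 (at (0 + 2 * s))))"
          unfolding vd [OF s(1)] using s(2) eq1 [of s]
          by (simp add: D_def model_metric_scaleR real_sqrt_mult)
        then show ?thesis using True s by (simp add: w'_def ennreal_mult'' [symmetric] ennreal_mult')
      next
        case False
        then show ?thesis by (simp add: w'_def)
      qed
    qed
  qed
  also have "\<dots> = model_curve_length K c"
    by (simp add: model_curve_length_def Let_def)
  finally have len: "model_curve_length K c1 \<le> model_curve_length K c" .
  show ?thesis
    by (rule that [OF curve _ _ len]) (simp_all add: c_def)
qed

lemma model_ell_mono_curve:
  assumes "model_causal_curve K c2" "c2 0 = q" "c2 1 = r"
  shows "model_ell K p q \<le> model_ell K p r"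
  unfolding model_ell_def [of K p q]
proof (rule SUP_least)
  fix c1 assume "c1 \<in> {c. model_causal_curve K c \<and> c 0 = p \<and> c 1 = q}"
  then have c1: "model_causal_curve K c1" "c1 0 = p" "c1 1 = c2 0" using assms by auto
  obtain c where c: "model_causal_curve K c" "c 0 = c1 0" "c 1 = c2 1" "model_curve_length K c1 \<le> model_curve_length K c"
    by (rule model_causal_curve_join [OF c1(1) assms(1) c1(3)])
  then show "model_curve_length K c1 \<le> model_ell K p r"
    unfolding model_ell_def [of K p r] using c1 assms by (intro SUP_upper2 [of c]) auto
qed

lemma model_ell_mono_le:
  "model_le K q r \<Longrightarrow> model_ell K p q \<le> model_ell K p r"
  unfolding model_le_def using model_ell_mono_curve by blast

section \<open>Geodesics and the law of cosines\<close>

text \<open>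
  The hyperbolic cosine of the angle of a hinge with sides of radial parameters \<open>a\<close>, \<open>b\<close> whose end
  points have separation of radial parameter \<open>c\<close>, one side pointing to the past and the other to
  the future. For \<open>k = 0\<close> it is \<open>(c\<^sup>2 - a\<^sup>2 - b\<^sup>2) / (2 a b)\<close>.
\<close>

definition hinge_law :: "real \<Rightarrow> real \<Rightarrow> real \<Rightarrow> real \<Rightarrow> real" where
  "hinge_law k a b c = (c\<^sup>2 / (1 + k * c\<^sup>2) * ((1 + k * a\<^sup>2) * (1 + k * b\<^sup>2)) - a\<^sup>2 - b\<^sup>2) / (2 * a * b)"

context model_null_charts
begin

text \<open>
  Homogeneity in the form in which it is used: the coordinates of the old centre in the new chart
  are obtained by applying the Moebius map to the origin.
\<close>

lemma chart_swap:
  assumes "M p q"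
  obtains \<rho> where "0 < \<rho>" "M q p" "u q p = - \<rho> * u p q" "v q p = - v p q / \<rho>"
    and "\<And>m. M p m \<Longrightarrow> 0 < 1 + \<kappa> * (u p m * v p q) \<Longrightarrow> 0 < 1 + \<kappa> * (u p q * v p m) \<Longrightarrow>
        M q m \<and> u q m = \<rho> * ((u p m - u p q) / (1 + \<kappa> * (u p m * v p q)))
              \<and> v q m = (v p m - v p q) / (1 + \<kappa> * (u p q * v p m)) / \<rho>"
proof -
  obtain \<rho> where \<rho>: "0 < \<rho>" "\<And>m. M p m \<Longrightarrow> 0 < 1 + \<kappa> * (u p m * v p q) \<Longrightarrow> 0 < 1 + \<kappa> * (u p q * v p m) \<Longrightarrow>
        M q m \<and> u q m = \<rho> * ((u p m - u p q) / (1 + \<kappa> * (u p m * v p q)))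
              \<and> v q m = (v p m - v p q) / (1 + \<kappa> * (u p q * v p m)) / \<rho>"
    using moebius [OF assms] by blast
  from \<rho>(2) [OF centre(1)] show ?thesis
    using that [OF \<rho>(1) _ _ _ \<rho>(2)] by (simp add: centre)
qed

lemma chart_change:
  assumes "M p m" "M p q" "0 < 1 + \<kappa> * (u p q * v p m)" "0 < 1 + \<kappa> * (u p m * v p q)"
  obtains \<rho> where "0 < \<rho>" "M m q" "u m q = \<rho> * ((u p q - u p m) / (1 + \<kappa> * (u p q * v p m)))"
    "v m q = (v p q - v p m) / (1 + \<kappa> * (u p m * v p q)) / \<rho>"
  using moebius [OF assms(1)] assms(2-4) by blast

text \<open>
  For positive curvature \<open>arctan\<close> stays below \<open>pi / 2\<close>, and \<open>K = 4 \<kappa>\<close>.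
\<close>

lemma radial_length_lt_diameter: "ennreal (rl r) < model_diameter K"
proof (cases "K > 0")
  case True
  then have k: "0 < \<kappa>" "sqrt K = 2 * sqrt \<kappa>" by (auto simp: K real_sqrt_mult)
  have "arctan (sqrt \<kappa> * r) < pi / 2" by (rule arctan_ubound)
  then have "rl r < pi / sqrt K" using k by (simp add: radial_length_def field_simps)
  then show ?thesis using True by (simp add: model_diameter_def ennreal_lessI)
next
  case False
  then show ?thesis by (simp add: model_diameter_def)
qed

text \<open>
  A causal curve from \<open>p\<close> to a point outside the chart of \<open>p\<close> passes through points with
  arbitrarily large \<open>u v\<close> in positive curvature, so by the reverse triangle inequality its end has
  separation at least the diameter from \<open>p\<close>. Below the diameter everything therefore happens in
  one chart.
\<close>

lemma timelike_pairI:
  assumes "0 < e p q" "e p q < model_diameter K"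
  shows "timelike_pair p q"
proof -
  obtain c where c: "model_causal_curve K c" "c 0 = p" "c 1 = q"
    by (rule model_ell_pos_curve [OF assms(1)])
  have mono: "mono_on {0..1} (\<lambda>s. gU (c s))" "mono_on {0..1} (\<lambda>s. gV (c s))"
    using curve_null_mono [OF c(1)] by (auto simp: mono_on_def)
  have g: "gU p \<le> gU q" "gV p \<le> gV q" using curve_null_mono [OF c(1), of 0 1] c by auto
  have "M p q"
  proof (rule ccontr)
    assume "\<not> M p q"
    moreover have "continuous_on {0..1} c" using c(1) by (simp add: model_causal_curve_def)
    ultimately have k: "0 < \<kappa>" and ex: "\<And>R. \<exists>s\<in>{0..1}. M p (c s) \<and> R < u p (c s) * v p (c s)"
      using exit [OF _ c(2) mono] c(3) by auto
    have "K > 0" and sq: "sqrt K = 2 * sqrt \<kappa>" using k by (auto simp: K real_sqrt_mult)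
    then have "e p q < ennreal (pi / sqrt K)" using assms(2) by (simp add: model_diameter_def)
    then obtain d where d: "e p q = ennreal d" "0 \<le> d" "d < pi / sqrt K"
      by (cases "e p q") (auto simp: ennreal_less_iff)
    define r where "r = tan (sqrt \<kappa> * d) / sqrt \<kappa>"
    have sd: "0 \<le> sqrt \<kappa> * d" "sqrt \<kappa> * d < pi / 2" using d k sq by (auto simp: field_simps)
    have rlr: "rl r = d"
      using k sd arctan_tan [of "sqrt \<kappa> * d"] by (simp add: r_def radial_length_def)
    have r0: "0 \<le> r"
      using tan_gt_zero [of "sqrt \<kappa> * d"] sd k by (cases "sqrt \<kappa> * d = 0") (simp_all add: r_def)
    obtain s where s: "s \<in> {0..1}" "M p (c s)" "r\<^sup>2 < u p (c s) * v p (c s)" using ex by blast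
    then have "s \<noteq> 1" using \<open>\<not> M p q\<close> c by auto
    then have s1: "0 \<le> s" "0 < 1 - s" using s by auto
    have "r < sqrt (u p (c s) * v p (c s))" using s(3) r0 by (simp add: real_less_rsqrt)
    then have "d < rl (sqrt (u p (c s) * v p (c s)))"
      unfolding rlr [symmetric] using r0 conf_pos [OF s(2)] s(3)
      by (intro radial_length_strict_mono) (auto simp: less_le_trans [OF _ less_imp_le] order.trans [OF zero_le_power2 less_imp_le])
    moreover have "e p (c s) = ennreal (rl (sqrt (u p (c s) * v p (c s))))"
      using curve_null_mono [OF c(1), of 0 s] s by (intro model_ell_chart) (auto simp: c)
    moreover have "e p (c s) \<le> e p q"
    proof (rule model_ell_mono_curve [OF model_causal_curve_sub [OF c(1)]])
      show "0 \<le> s" "0 < 1 - s" "s + (1 - s) \<le> 1" using s1 by auto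
    qed (simp_all add: c)
    ultimately show False using d by (simp add: ennreal_le_iff2)
  qed
  moreover have "u p q * v p q \<noteq> 0"
    using model_ell_chart [OF \<open>M p q\<close> g] assms(1) by auto
  ultimately show ?thesis using chart_nonneg [OF _ g] by (auto simp: timelike_pair_def order_less_le)
qed

lemma timelike_pair_product:
  assumes t: "timelike_pair p q" and l: "e p q = ennreal (rl r)" "0 < r" "0 < 1 + \<kappa> * r\<^sup>2"
  shows "u p q * v p q = r\<^sup>2"
proof -
  have uv: "0 < u p q * v p q" "0 < 1 + \<kappa> * (u p q * v p q)"
    using t conf_pos [of p q] by (simp_all add: timelike_pair_def)
  have sq: "(sqrt (u p q * v p q))\<^sup>2 = u p q * v p q" using uv(1) by simp
  have "ennreal (rl (sqrt (u p q * v p q))) = ennreal (rl r)"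
    using model_ell_timelike_pair(1) [OF t] l(1) by simp
  moreover have "0 \<le> rl (sqrt (u p q * v p q))" "0 \<le> rl r"
    using model_ell_timelike_pair(3) [OF t] radial_length_nonneg [of r \<kappa>] l by (simp_all only: less_imp_le)
  ultimately have eq: "rl (sqrt (u p q * v p q)) = rl r" by (simp only: ennreal_inj)
  have "sqrt (u p q * v p q) = r"
  proof (rule radial_length_inj [OF _ _ _ l(3) eq])
    show "0 < 1 + \<kappa> * (sqrt (u p q * v p q))\<^sup>2" unfolding sq by (rule uv(2))
  qed (use uv l in simp_all)
  then show ?thesis using sq by simp
qed

text \<open>
  Recentring at a point of a radial segment sends the segment to a radial segment, and the
  subtraction theorem turns the Moebius map into the difference of the radial lengths.
\<close>

lemma seg_pair:
  assumes t: "timelike_pair p q" and st: "0 \<le> s" "s < t" "t \<le> 1"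
  defines "\<tau> \<equiv> sqrt (u p q * v p q)"
  shows "timelike_pair (seg p q s) (seg p q t)" "rl (s * \<tau>) \<le> rl (t * \<tau>)"
    "e (seg p q s) (seg p q t) = ennreal (rl (t * \<tau>) - rl (s * \<tau>))"
proof -
  let ?m = "seg p q s" and ?n = "seg p q t" and ?D = "1 + \<kappa> * ((t * u p q) * (s * v p q))"
  have uv: "0 < u p q" "0 < v p q" using t by (auto simp: timelike_pair_def)
  have m: "M p ?m" "u p ?m = s * u p q" "v p ?m = s * v p q" using seg_chart [OF t, of s] st by auto
  have n: "M p ?n" "u p ?n = t * u p q" "v p ?n = t * v p q" using seg_chart [OF t, of t] st by auto
  have D: "0 < ?D" using seg_conf [OF t, of t s] st by auto
  have D': "1 + \<kappa> * ((s * u p q) * (t * v p q)) = ?D" by (simp add: mult_ac)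
  have D1: "0 < 1 + \<kappa> * (u p ?n * v p ?m)" "0 < 1 + \<kappa> * (u p ?m * v p ?n)"
    unfolding m n D' by (rule D)+
  obtain \<rho> where r: "0 < \<rho>" and all: "\<forall>n. M p n \<longrightarrow> 0 < 1 + \<kappa> * (u p n * v p ?m) \<longrightarrow> 0 < 1 + \<kappa> * (u p ?m * v p n) \<longrightarrow>
        M ?m n \<and> u ?m n = \<rho> * ((u p n - u p ?m) / (1 + \<kappa> * (u p n * v p ?m)))
              \<and> v ?m n = (v p n - v p ?m) / (1 + \<kappa> * (u p ?m * v p n)) / \<rho>"
    using moebius [OF m(1)] by blast
  note inst = all [rule_format, OF n(1) D1]
  have \<rho>: "0 < \<rho>" "M ?m ?n" "u ?m ?n = \<rho> * ((t * u p q - s * u p q) / ?D)"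
      "v ?m ?n = (t * v p q - s * v p q) / ?D / \<rho>"
    using r inst unfolding m(2,3) n(2,3) D' by blast+
  have diff: "0 < t * u p q - s * u p q" "0 < t * v p q - s * v p q" using uv st by auto
  show tp: "timelike_pair ?m ?n"
    unfolding timelike_pair_def \<rho>(3,4) using \<rho>(1,2) D diff by auto
  have \<tau>: "0 < \<tau>" "\<tau>\<^sup>2 = u p q * v p q" using uv by (auto simp: \<tau>_def)
  have "u ?m ?n * v ?m ?n = (t * u p q - s * u p q) * (t * v p q - s * v p q) / ?D\<^sup>2"
    unfolding \<rho>(3,4) using \<rho>(1) by (simp add: power2_eq_square)
  also have "(t * u p q - s * u p q) * (t * v p q - s * v p q) = (t * \<tau> - s * \<tau>)\<^sup>2"
  proof -
    have "(t * u p q - s * u p q) * (t * v p q - s * v p q) = (t - s)\<^sup>2 * (u p q * v p q)"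
      by (simp add: power2_eq_square algebra_simps)
    also have "\<dots> = (t * \<tau> - s * \<tau>)\<^sup>2"
      by (simp add: \<tau>(2) [symmetric] power_mult_distrib [symmetric] left_diff_distrib)
    finally show ?thesis .
  qed
  also have D2: "?D = 1 + \<kappa> * (s * \<tau>) * (t * \<tau>)"
    using \<tau>(2) by (simp add: power2_eq_square mult_ac)
  finally have "sqrt (u ?m ?n * v ?m ?n) = (t * \<tau> - s * \<tau>) / (1 + \<kappa> * (s * \<tau>) * (t * \<tau>))"
    using st \<tau>(1) D unfolding D2 by (simp add: real_sqrt_divide mult_right_mono)
  moreover have le: "0 \<le> s * \<tau>" "s * \<tau> \<le> t * \<tau>" "0 < 1 + \<kappa> * (t * \<tau>)\<^sup>2"
    using st \<tau>(1) seg_conf [OF t, of t t] by (auto simp: power_mult_distrib \<tau>(2) power2_eq_square [of t] mult_ac)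
  ultimately show "e ?m ?n = ennreal (rl (t * \<tau>) - rl (s * \<tau>))"
    using model_ell_timelike_pair(1) [OF tp] radial_length_diff [OF le] by simp
  show "rl (s * \<tau>) \<le> rl (t * \<tau>)" by (rule radial_length_mono [OF le])
qed

lemma seg_maximising:
  assumes t: "timelike_pair p q"
  shows "maximising_geodesic (model_le K) e (seg p q) 0 1 p q"
proof -
  have "continuous_on {0..1} (seg p q)" using seg_curve(1) [OF t] by (simp add: model_causal_curve_def)
  moreover have "model_le K (seg p q s) (seg p q r)" if "s \<in> {0..1}" "r \<in> {0..1}" "s < r" for s r
    using seg_pair(1) [OF t, of s r] that by (intro timelike_pair_model_le) auto
  moreover have "ell_length e (seg p q) 0 1 = e (seg p q 0) (seg p q 1)"
    using seg_pair [OF t]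
    by (intro ell_length_additive [where f = "\<lambda>s. rl (s * sqrt (u p q * v p q))"]) auto
  ultimately show ?thesis
    unfolding maximising_geodesic_def causal_curve_def by (simp add: seg_ends [OF t])
qed

lemma seg_directions:
  assumes t: "timelike_pair p q"
  shows "\<exists>w. model_direction K p q w" "\<exists>w. model_direction K q p w"
proof -
  let ?c = "seg p q"
  define W where "W s = vector_derivative ?c (at s)" for s
  have W: "(?c has_vector_derivative W s) (at s)" if "s \<in> {0..1}" for s
    using seg_deriv [OF t, of s] that unfolding W_def
    by (metis atLeastAtMost_iff vector_derivative_at)
  have W0: "fst (W s) \<noteq> 0" if "s \<in> {0..1}" for s
  proof -
    let ?z = "seg p q s"
    have "0 < u p q / A p ?z + v p q / B p ?z"
      using t AB_pos [OF seg_chart(1) [OF t, of s]] that by (auto simp: timelike_pair_def intro!: add_pos_pos divide_pos_pos)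
    moreover have "W s = ((u p q / A p ?z + v p q / B p ?z) / (2 * h1 ?z), (u p q / A p ?z - v p q / B p ?z) / (2 * h2 ?z))"
      unfolding W_def using seg_deriv [OF t, of s] that by (intro vector_derivative_at) auto
    ultimately show ?thesis using h_pos(1) [of ?z] by simp
  qed
  note max = seg_maximising [OF t]
  have "model_direction K p q (W 0)"
    unfolding model_direction_def
    using max seg_ends [OF t] W [of 0] W0 [of 0] by (auto intro!: exI [of _ ?c] simp: has_vector_derivative_at_within)
  then show "\<exists>w. model_direction K p q w" by blast
  have "((\<lambda>s. ?c (1 + (-1) * s)) has_vector_derivative (-1) *\<^sub>R W 1) (at 0)"
    using W [of 1] by (intro affine_vector_derivative) simp
  then have "((\<lambda>s. ?c (1 - s)) has_vector_derivative - W 1) (at 0 within {0..1})"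
    by (simp add: has_vector_derivative_at_within)
  moreover have "- W 1 \<noteq> 0" using W0 [of 1] by auto
  ultimately have "model_direction K q p (- W 1)"
    unfolding model_direction_def
    using max seg_ends [OF t] by (intro conjI exI [of _ "\<lambda>s. ?c (1 - s)"] disjI2) auto
  then show "\<exists>w. model_direction K q p w" by blast
qed

text \<open>
  Uniqueness of maximising geodesics. With coordinates \<open>(a, b)\<close> of \<open>m\<close> and \<open>(c, d)\<close> of \<open>q\<close>, the
  hypothesis \<open>max\<close> compares the radial parameters of \<open>m q\<close> computed by the Moebius map with the
  one of the difference of lengths. After clearing denominators it reads
  \<open>c b + a d \<le> 2 sqrt (a b c d)\<close>, which by the inequality of the means forces \<open>c b = a d\<close>.
\<close>

lemma collinear:
  assumes t: "timelike_pair p q" and le: "model_le K p m" "model_le K m q"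
    and max: "e p q \<le> e p m + e m q"
  shows "M p m" "u p m * v p q = v p m * u p q" "0 \<le> u p m" "u p m \<le> u p q" "0 \<le> v p m" "v p m \<le> v p q"
proof -
  have Mq: "M p q" and uv2: "0 < u p q" "0 < v p q" using t by (auto simp: timelike_pair_def)
  note g = model_le_null [OF le(1)] model_le_null [OF le(2)]
  show Mm: "M p m" using between [OF Mq] g by blast
  show nn: "0 \<le> u p m" "0 \<le> v p m" using chart_nonneg [OF Mm] g by auto
  show ub: "u p m \<le> u p q" "v p m \<le> v p q"
    using u_le_iff [OF Mm Mq] v_le_iff [OF Mm Mq] g by auto
  define a b c d where "a = u p m" and "b = v p m" and "c = u p q" and "d = v p q"
  have nn': "0 \<le> a" "0 \<le> b" "a \<le> c" "b \<le> d" "0 < c" "0 < d" using nn ub uv2 by (auto simp: a_def b_def c_def d_def)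
  have conf: "0 < 1 + \<kappa> * (c * d)" using conf_pos [OF Mq] by (simp add: c_def d_def)
  have P: "0 < 1 + \<kappa> * (c * b)" "0 < 1 + \<kappa> * (a * d)" "0 < 1 + \<kappa> * (a * b)"
    using nn' by (auto intro!: pos_of_le [OF _ _ conf] mult_mono)
  obtain \<rho> where \<rho>: "0 < \<rho>" "M m q" "u m q = \<rho> * ((c - a) / (1 + \<kappa> * (c * b)))"
      "v m q = (d - b) / (1 + \<kappa> * (a * d)) / \<rho>"
    using chart_change [OF Mm Mq] P(1,2) unfolding a_def b_def c_def d_def by blast
  define X where "X = (c - a) * (d - b) / ((1 + \<kappa> * (c * b)) * (1 + \<kappa> * (a * d)))"
  have X: "u m q * v m q = X" unfolding \<rho>(3,4) X_def using \<rho>(1) by simp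
  have X0: "0 \<le> X" unfolding X_def using nn' P by auto
  define t1 t2 where "t1 = sqrt (a * b)" and "t2 = sqrt (c * d)"
  have t12: "t1\<^sup>2 = a * b" "t2\<^sup>2 = c * d" "0 \<le> t1" "t1 \<le> t2" "0 < t2"
    using nn' by (auto simp: t1_def t2_def intro!: mult_mono)
  have Pt: "0 < 1 + \<kappa> * (t1 * t2)"
    using t12 mult_mono [of t1 t2 t2 t2] by (intro pos_of_le [OF _ _ conf]) (auto simp: power2_eq_square)
  have "ennreal (rl t2) \<le> ennreal (rl t1) + ennreal (rl (sqrt X))"
    using max model_ell_timelike_pair(1) [OF t] model_ell_chart [OF Mm g(1,2)] model_ell_chart [OF \<rho>(2) g(3,4)]
    by (simp add: X a_def b_def c_def d_def t1_def t2_def)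
  moreover have rX: "0 \<le> rl t1" "0 \<le> rl (sqrt X)"
    using radial_length_nonneg [of t1 \<kappa>] radial_length_nonneg [of "sqrt X" \<kappa>] t12 P X0 conf_pos [OF \<rho>(2)] X by auto
  ultimately have "rl t2 - rl t1 \<le> rl (sqrt X)"
    by (simp add: ennreal_le_iff flip: ennreal_plus)
  then have le1: "rl ((t2 - t1) / (1 + \<kappa> * t1 * t2)) \<le> rl (sqrt X)"
    using radial_length_diff [of t1 t2 \<kappa>] t12 conf by simp
  have key: "1 + \<kappa> * ((t2 - t1) / (1 + \<kappa> * t1 * t2))\<^sup>2 = (1 + \<kappa> * (a * b)) * (1 + \<kappa> * (c * d)) / (1 + \<kappa> * t1 * t2)\<^sup>2"
    unfolding t12(1,2) [symmetric] using Pt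
    by (simp add: power_divide field_simps) (simp add: power2_eq_square algebra_simps)
  have "(t2 - t1) / (1 + \<kappa> * t1 * t2) \<le> sqrt X"
  proof (subst radial_length_le_iff [symmetric, of _ _ \<kappa>])
    show "0 < 1 + \<kappa> * ((t2 - t1) / (1 + \<kappa> * t1 * t2))\<^sup>2" unfolding key using P conf Pt by (simp add: mult.assoc)
    show "0 < 1 + \<kappa> * (sqrt X)\<^sup>2" using conf_pos [OF \<rho>(2)] X X0 by simp
    show "0 \<le> (t2 - t1) / (1 + \<kappa> * t1 * t2)" using t12 Pt by (simp add: mult.assoc)
  qed (use X0 le1 in auto)
  then have "((t2 - t1) / (1 + \<kappa> * t1 * t2))\<^sup>2 \<le> (sqrt X)\<^sup>2"
    using t12 Pt by (intro power_mono) (auto simp: mult.assoc)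
  then have "(t2 - t1)\<^sup>2 / (1 + \<kappa> * (t1 * t2))\<^sup>2 \<le> X" using X0 by (simp add: power_divide mult.assoc)
  then have "(t2 - t1)\<^sup>2 * ((1 + \<kappa> * (c * b)) * (1 + \<kappa> * (a * d))) \<le> (c - a) * (d - b) * (1 + \<kappa> * (t1 * t2))\<^sup>2"
    unfolding X_def using P Pt by (simp add: divide_le_eq le_divide_eq mult_ac zero_less_mult_iff)
  moreover have "(c - a) * (d - b) * (1 + \<kappa> * (t1 * t2))\<^sup>2 - (t2 - t1)\<^sup>2 * ((1 + \<kappa> * (c * b)) * (1 + \<kappa> * (a * d)))
     = (2 * (t1 * t2) - (c * b + a * d)) * ((1 + \<kappa> * t1\<^sup>2) * (1 + \<kappa> * t2\<^sup>2))"
  proof -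
    have 1: "(c - a) * (d - b) = t1\<^sup>2 + t2\<^sup>2 - (c * b + a * d)" by (simp add: t12 algebra_simps)
    have 2: "(1 + \<kappa> * (c * b)) * (1 + \<kappa> * (a * d)) = 1 + \<kappa> * (c * b + a * d) + \<kappa>\<^sup>2 * (t1\<^sup>2 * t2\<^sup>2)"
      unfolding t12(1,2) by (simp add: power2_eq_square algebra_simps)
    show ?thesis unfolding 1 2 by (simp add: power2_eq_square algebra_simps)
  qed
  ultimately have "0 \<le> (2 * (t1 * t2) - (c * b + a * d)) * ((1 + \<kappa> * t1\<^sup>2) * (1 + \<kappa> * t2\<^sup>2))" by linarith
  moreover have "0 < (1 + \<kappa> * t1\<^sup>2) * (1 + \<kappa> * t2\<^sup>2)" using P conf t12 by simp
  ultimately have "c * b + a * d \<le> 2 * (t1 * t2)" by (simp add: zero_le_mult_iff)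
  then have "(c * b + a * d)\<^sup>2 \<le> (2 * (t1 * t2))\<^sup>2" using nn' by (intro power_mono) auto
  also have "(2 * (t1 * t2))\<^sup>2 = 4 * (c * b) * (a * d)" by (simp add: power_mult_distrib t12)
  finally have "(c * b - a * d)\<^sup>2 \<le> 0" by (simp add: power2_eq_square algebra_simps)
  then have "c * b = a * d" by simp
  then show "u p m * v p q = v p m * u p q" by (simp add: a_def b_def c_def d_def mult.commute)
qed

abbreviation "Du y w \<equiv> A y y * (h1 y * fst w + h2 y * snd w)"
abbreviation "Dv y w \<equiv> B y y * (h1 y * fst w - h2 y * snd w)"

text \<open>
  At the centre of a chart the metric is \<open>du dv\<close>; \<open>Du\<close> and \<open>Dv\<close> are the components of a tangent
  vector there.
\<close>

lemma metric_centre: "model_metric K y a b = (Du y a * Dv y b + Dv y a * Du y b) / 2"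
proof -
  have "A y y * B y y = 1" using AB_mult [OF centre(1)] by (simp add: centre)
  then have "Du y a * Dv y b + Dv y a * Du y b = (h1 y * fst a + h2 y * snd a) * (h1 y * fst b - h2 y * snd b)
     + (h1 y * fst a - h2 y * snd a) * (h1 y * fst b + h2 y * snd b)"
    by (simp add: mult.assoc [symmetric] mult.commute mult.left_commute)
  then show ?thesis by (simp add: metric power2_eq_square algebra_simps)
qed

text \<open>
  The linear relation between the two coordinates is differentiated at the starting point, which
  is the only place where a side in the definition of a direction has a derivative.
\<close>

lemma direction_of_collinear:
  assumes s: "\<sigma> 0 = y" "(\<sigma> has_vector_derivative w) (at 0 within {0..1})" "w \<noteq> 0"
    and col: "\<And>s. s \<in> {0..1} \<Longrightarrow> u y (\<sigma> s) * b = v y (\<sigma> s) * a" and a: "a \<noteq> 0"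
  obtains l where "l \<noteq> 0" "Du y w = l * a" "Dv y w = l * b"
proof -
  have du: "((\<lambda>s. u y (\<sigma> s)) has_real_derivative Du y w) (at 0 within {0..1})"
    and dv: "((\<lambda>s. v y (\<sigma> s)) has_real_derivative Dv y w) (at 0 within {0..1})"
    using u_deriv [of y \<sigma> 0, OF _ s(2)] v_deriv [of y \<sigma> 0, OF _ s(2)] by (simp_all add: s(1) centre)
  have 1: "((\<lambda>s. u y (\<sigma> s) * b) has_vector_derivative Du y w * b) (at 0 within {0..1})"
    unfolding has_real_derivative_iff_has_vector_derivative [symmetric] by (rule DERIV_cmult_right [OF du])
  have "((\<lambda>s. v y (\<sigma> s) * a) has_vector_derivative Dv y w * a) (at 0 within {0..1})"
    unfolding has_real_derivative_iff_has_vector_derivative [symmetric] by (rule DERIV_cmult_right [OF dv])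
  then have 2: "((\<lambda>s. u y (\<sigma> s) * b) has_vector_derivative Dv y w * a) (at 0 within {0..1})"
    by (rule has_vector_derivative_transform [rotated 2]) (use col in auto)
  have eq: "Du y w * b = Dv y w * a"
    by (rule vector_derivative_unique_within [OF _ 1 2]) (simp add: trivial_limit_within islimpt_Icc)
  define l where "l = Du y w / a"
  have l: "Du y w = l * a" "Dv y w = l * b" using eq a by (auto simp: l_def field_simps)
  have "l \<noteq> 0"
  proof
    assume "l = 0"
    then have "h1 y * fst w + h2 y * snd w = 0" "h1 y * fst w - h2 y * snd w = 0"
      using l AB_pos [OF centre(1), of y] by auto
    then have "h1 y * fst w = 0" "h2 y * snd w = 0" by linarith+
    then have "fst w = 0" "snd w = 0" using h_pos [of y] by auto
    then show False using s(3) by (simp add: prod_eq_iff)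
  qed
  then show ?thesis using that l by blast
qed

lemma maximising_split:
  assumes "maximising_geodesic (model_le K) e \<sigma> 0 1 p q" "0 < s" "s < 1"
  shows "model_le K p (\<sigma> s)" "model_le K (\<sigma> s) q" "e p q \<le> e p (\<sigma> s) + e (\<sigma> s) q"
proof -
  from assms have c: "\<sigma> 0 = p" "\<sigma> 1 = q" "ell_length e \<sigma> 0 1 = e p q"
     "\<And>s t. s \<in> {0..1} \<Longrightarrow> t \<in> {0..1} \<Longrightarrow> s < t \<Longrightarrow> model_le K (\<sigma> s) (\<sigma> t)"
    by (auto simp: maximising_geodesic_def causal_curve_def)
  show "model_le K p (\<sigma> s)" "model_le K (\<sigma> s) q"
    using c(4) [of 0 s] c(4) [of s 1] assms c(1,2) by auto
  let ?t = "\<lambda>i::nat. if i = 0 then 0 else if i = 1 then s else 1"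
  have "interval_partition 0 1 2 ?t" using assms by (auto simp: interval_partition_def)
  then have "ell_length e \<sigma> 0 1 \<le> (\<Sum>i<2. e (\<sigma> (?t i)) (\<sigma> (?t (Suc i))))"
    unfolding ell_length_def by (intro Inf_lower CollectI exI [of _ "2::nat"] exI [of _ ?t] conjI refl)
  then show "e p q \<le> e p (\<sigma> s) + e (\<sigma> s) q" by (simp add: c numeral_2_eq_2)
qed

text \<open>
  Every maximising geodesic lies on the radial ray by collinearity, hence every tangent vector
  permitted as a direction of the side is a multiple of the coordinate vector of the end point.
\<close>

lemma future_direction:
  assumes t: "timelike_pair y q" and d: "model_direction K y q w"
  obtains l where "l \<noteq> 0" "Du y w = l * u y q" "Dv y w = l * v y q"
proof -
  from d obtain \<sigma> where s: "w \<noteq> 0" "\<sigma> 0 = y" "(\<sigma> has_vector_derivative w) (at 0 within {0..1})"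
    "maximising_geodesic (model_le K) e \<sigma> 0 1 y q \<or> maximising_geodesic (model_le K) e (\<lambda>s. \<sigma> (1 - s)) 0 1 q y"
    unfolding model_direction_def by blast
  have tm: "fst y < fst q" using model_le_time [OF timelike_pair_model_le [OF t]] t
    by (auto simp: timelike_pair_def centre)
  have "\<not> maximising_geodesic (model_le K) e (\<lambda>s. \<sigma> (1 - s)) 0 1 q y"
  proof
    assume "maximising_geodesic (model_le K) e (\<lambda>s. \<sigma> (1 - s)) 0 1 q y"
    then have "model_le K q y" unfolding maximising_geodesic_def causal_curve_def
      by (metis atLeastAtMost_iff order_refl zero_le_one zero_less_one)
    then show False using model_le_time [of K q y] tm by auto
  qed
  then have max: "maximising_geodesic (model_le K) e \<sigma> 0 1 y q" using s by blast
  have "u y (\<sigma> r) * v y q = v y (\<sigma> r) * u y q" if r: "r \<in> {0..1}" for r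
  proof -
    consider "r = 0" | "r = 1" | "0 < r" "r < 1" using r by fastforce
    then show ?thesis
    proof cases
      case 1 then show ?thesis by (simp add: s centre)
    next
      case 2 then show ?thesis using max by (simp add: maximising_geodesic_def)
    next
      case 3 show ?thesis by (rule collinear(2) [OF t maximising_split [OF max 3]])
    qed
  qed
  moreover have "u y q \<noteq> 0" using t by (auto simp: timelike_pair_def)
  ultimately show ?thesis using direction_of_collinear [OF s(2,3,1)] that by blast
qed

lemma past_chart:
  assumes t: "timelike_pair p y"
  shows "M y p" "u y p < 0" "v y p < 0" "u y p * v y p = u p y * v p y"
proof -
  obtain \<rho> where "0 < \<rho>" "M y p" "u y p = - \<rho> * u p y" "v y p = - v p y / \<rho>"
    using chart_swap [of p y] t unfolding timelike_pair_def by metis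
  then show "M y p" "u y p < 0" "v y p < 0" "u y p * v y p = u p y * v p y"
    using t by (auto simp: timelike_pair_def)
qed

text \<open>
  The centre of the chart is the later end point, whereas collinearity is known in the chart of
  the earlier one; the Moebius map between the two preserves lines through both centres.
\<close>

lemma past_collinear:
  assumes t: "timelike_pair p y" and le: "model_le K p m" "model_le K m y"
    and max: "e p y \<le> e p m + e m y"
  shows "u y m * v y p = v y m * u y p"
proof -
  note c = collinear [OF t le max]
  have My: "M p y" and uv: "0 < u p y" "0 < v p y" using t by (auto simp: timelike_pair_def)
  have P: "0 < 1 + \<kappa> * (u p m * v p y)" "0 < 1 + \<kappa> * (u p y * v p m)"
    using c(3-6) uv by (auto intro!: pos_of_le [OF _ _ conf_pos [OF My]] mult_mono)
  obtain \<rho> where \<rho>: "0 < \<rho>" "M y p" "u y p = - \<rho> * u p y" "v y p = - v p y / \<rho>"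
    and m: "M p m \<Longrightarrow> 0 < 1 + \<kappa> * (u p m * v p y) \<Longrightarrow> 0 < 1 + \<kappa> * (u p y * v p m) \<Longrightarrow>
        M y m \<and> u y m = \<rho> * ((u p m - u p y) / (1 + \<kappa> * (u p m * v p y)))
              \<and> v y m = (v p m - v p y) / (1 + \<kappa> * (u p y * v p m)) / \<rho>"
    using chart_swap [OF My] by metis
  have eq: "u p y * v p m = u p m * v p y" using c(2) by (simp add: mult.commute)
  have "u y m = \<rho> * ((u p m - u p y) / (1 + \<kappa> * (u p m * v p y)))"
    "v y m = (v p m - v p y) / (1 + \<kappa> * (u p m * v p y)) / \<rho>"
    using m [OF c(1) P] by (auto simp: eq)
  then have "u y m * v y p = - ((u p m - u p y) * v p y / (1 + \<kappa> * (u p m * v p y)))"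
     "v y m * u y p = - ((v p m - v p y) * u p y / (1 + \<kappa> * (u p m * v p y)))"
    using \<rho> by auto
  moreover have "(u p m - u p y) * v p y = (v p m - v p y) * u p y" using c(2) by (simp add: algebra_simps)
  ultimately show ?thesis by simp
qed

lemma past_direction:
  assumes t: "timelike_pair p y" and d: "model_direction K y p w"
  obtains l where "l \<noteq> 0" "Du y w = l * u y p" "Dv y w = l * v y p"
proof -
  from d obtain \<sigma> where s: "w \<noteq> 0" "\<sigma> 0 = y" "(\<sigma> has_vector_derivative w) (at 0 within {0..1})"
    "maximising_geodesic (model_le K) e \<sigma> 0 1 y p \<or> maximising_geodesic (model_le K) e (\<lambda>s. \<sigma> (1 - s)) 0 1 p y"
    unfolding model_direction_def by blast
  have tm: "fst p < fst y" using model_le_time [OF timelike_pair_model_le [OF t]] t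
    by (auto simp: timelike_pair_def centre)
  have "\<not> maximising_geodesic (model_le K) e \<sigma> 0 1 y p"
  proof
    assume "maximising_geodesic (model_le K) e \<sigma> 0 1 y p"
    then have "model_le K y p" unfolding maximising_geodesic_def causal_curve_def
      by (metis atLeastAtMost_iff order_refl zero_le_one zero_less_one)
    then show False using model_le_time [of K y p] tm by auto
  qed
  then have max: "maximising_geodesic (model_le K) e (\<lambda>s. \<sigma> (1 - s)) 0 1 p y" using s by blast
  have "u y (\<sigma> r) * v y p = v y (\<sigma> r) * u y p" if r: "r \<in> {0..1}" for r
  proof -
    consider "r = 0" | "r = 1" | "0 < 1 - r" "1 - r < 1" using r by fastforce
    then show ?thesis
    proof cases
      case 1 then show ?thesis by (simp add: s centre)
    next
      case 2 then show ?thesis using max by (simp add: maximising_geodesic_def)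
    next
      case 3 show ?thesis using past_collinear [OF t maximising_split [OF max 3]] by simp
    qed
  qed
  moreover have "u y p \<noteq> 0" using past_chart [OF t] by auto
  ultimately show ?thesis using direction_of_collinear [OF s(2,3,1)] that by blast
qed

text \<open>
  The law of cosines in null coordinates. The last bracket is twice the inner product of the two
  sides in the chart centred at the vertex \<open>y\<close>. Everything is expressed by the coordinates of \<open>y\<close>
  and \<open>q\<close> in the chart of \<open>p\<close>, where the claim is an identity of rational functions.
\<close>

lemma hinge:
  assumes py: "timelike_pair p y" and yq: "timelike_pair y q" and pq: "timelike_pair p q"
  shows "(u p q * v p q) / (1 + \<kappa> * (u p q * v p q)) * ((1 + \<kappa> * (u p y * v p y)) * (1 + \<kappa> * (u y q * v y q)))
    = u p y * v p y + u y q * v y q - (u y p * v y q + v y p * u y q)"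
proof -
  define a b c d where "a = u p y" and "b = v p y" and "c = u p q" and "d = v p q"
  have My: "M p y" and Mq: "M p q" and pos: "0 < a" "0 < b" "0 < c" "0 < d"
    using py pq by (auto simp: timelike_pair_def a_def b_def c_def d_def)
  note g = model_le_null [OF timelike_pair_model_le [OF yq]]
  have ub: "a \<le> c" "b \<le> d" using u_le_iff [OF My Mq] v_le_iff [OF My Mq] g by (auto simp: a_def b_def c_def d_def)
  have conf: "0 < 1 + \<kappa> * (c * d)" using conf_pos [OF Mq] by (simp add: c_def d_def)
  have P: "0 < 1 + \<kappa> * (c * b)" "0 < 1 + \<kappa> * (a * d)" "0 < 1 + \<kappa> * (a * b)"
    using pos ub by (auto intro!: pos_of_le [OF _ _ conf] mult_mono)
  obtain \<rho> where \<rho>: "0 < \<rho>" "u y p = - \<rho> * a" "v y p = - b / \<rho>"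
    "u y q = \<rho> * ((c - a) / (1 + \<kappa> * (c * b)))" "v y q = (d - b) / (1 + \<kappa> * (a * d)) / \<rho>"
    using chart_swap [OF My] Mq P unfolding a_def b_def c_def d_def by metis
  let ?x = "1 + \<kappa> * (c * b)" and ?y = "1 + \<kappa> * (a * d)"
  have uvq: "u y q * v y q = (c - a) * (d - b) / (?x * ?y)" unfolding \<rho> using \<rho>(1) by simp
  have conf2: "1 + \<kappa> * (u y q * v y q) = (1 + \<kappa> * (a * b)) * (1 + \<kappa> * (c * d)) / (?x * ?y)"
  proof -
    have "1 + \<kappa> * ((c - a) * (d - b) / (?x * ?y)) = (?x * ?y + \<kappa> * ((c - a) * (d - b))) / (?x * ?y)"
      using P by (simp add: add_divide_distrib)
    also have "?x * ?y + \<kappa> * ((c - a) * (d - b)) = (1 + \<kappa> * (a * b)) * (1 + \<kappa> * (c * d))"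
      by (simp add: algebra_simps)
    finally show ?thesis unfolding uvq .
  qed
  have cross: "u y p * v y q = - (a * (d - b) / ?y)" "v y p * u y q = - (b * (c - a) / ?x)"
    unfolding \<rho> using \<rho>(1) by simp_all
  have common: "(r + s / (x * y) + t / y + w / x) * (x * y) = r * (x * y) + s + t * x + w * y"
    if "x \<noteq> 0" "y \<noteq> 0" for r s t w x y :: real
    using that by (simp add: field_simps)
  have "(a * b + (c - a) * (d - b) / (?x * ?y) + a * (d - b) / ?y + b * (c - a) / ?x) * (?x * ?y)
     = a * b * (?x * ?y) + (c - a) * (d - b) + a * (d - b) * ?x + b * (c - a) * ?y"
    by (rule common) (use P in simp_all)
  also have "\<dots> = c * d * (1 + \<kappa> * (a * b))\<^sup>2" by (simp add: power2_eq_square algebra_simps)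
  finally have "a * b + (c - a) * (d - b) / (?x * ?y) + a * (d - b) / ?y + b * (c - a) / ?x
      = c * d * (1 + \<kappa> * (a * b))\<^sup>2 / (?x * ?y)"
    using P by (simp add: eq_divide_eq)
  moreover have "(c * d) / (1 + \<kappa> * (c * d)) * ((1 + \<kappa> * (a * b)) * (1 + \<kappa> * (u y q * v y q)))
      = c * d * (1 + \<kappa> * (a * b))\<^sup>2 / (?x * ?y)"
    unfolding conf2 using conf by (simp add: power2_eq_square)
  ultimately show ?thesis
    unfolding cross uvq a_def [symmetric] b_def [symmetric] c_def [symmetric] d_def [symmetric] conf2
    by (simp add: uvq [symmetric] conf2 [symmetric])
qed

lemma hinge_law_chart:
  assumes py: "timelike_pair p y" and yq: "timelike_pair y q" and pq: "timelike_pair p q"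
    and l: "u p y * v p y = a\<^sup>2" "u y q * v y q = b\<^sup>2" "u p q * v p q = c\<^sup>2" "0 < a" "0 < b"
  shows "hinge_law \<kappa> a b c = - (u y p * v y q + v y p * u y q) / (2 * a * b)"
  using hinge [OF py yq pq] unfolding l hinge_law_def by simp

text \<open>
  The angle is independent of the chosen directions: they are multiples of the coordinate vectors,
  the multipliers cancel in the normalised inner product, and the law of cosines evaluates the
  rest.
\<close>

lemma model_angle:
  assumes ab: "0 < a" "0 < b" "0 < c" "0 < 1 + \<kappa> * a\<^sup>2" "0 < 1 + \<kappa> * b\<^sup>2" "0 < 1 + \<kappa> * c\<^sup>2"
    and l: "e p y = ennreal (rl a)" "e y q = ennreal (rl b)" "e p q = ennreal (rl c)"
    and d: "model_direction K y p w1" "model_direction K y q w2"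
  shows "hyperbolic_angle K y w1 w2 = arcosh (hinge_law \<kappa> a b c)"
proof -
  have pos: "0 < rl a" "0 < rl b" "0 < rl c" using radial_length_strict_mono [of 0 _ \<kappa>] ab by auto
  have t: "timelike_pair p y" "timelike_pair y q" "timelike_pair p q"
    by (rule timelike_pairI; simp add: l pos radial_length_lt_diameter)+
  have uv: "u p y * v p y = a\<^sup>2" "u y q * v y q = b\<^sup>2" "u p q * v p q = c\<^sup>2"
    using timelike_pair_product [OF t(1) l(1)] timelike_pair_product [OF t(2) l(2)] timelike_pair_product [OF t(3) l(3)] ab by auto
  note pc = past_chart [OF t(1)]
  have qc: "0 < u y q" "0 < v y q" using t(2) by (auto simp: timelike_pair_def)
  obtain l1 where l1: "l1 \<noteq> 0" "Du y w1 = l1 * u y p" "Dv y w1 = l1 * v y p" by (rule past_direction [OF t(1) d(1)])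
  obtain l2 where l2: "l2 \<noteq> 0" "Du y w2 = l2 * u y q" "Dv y w2 = l2 * v y q" by (rule future_direction [OF t(2) d(2)])
  have m11: "model_metric K y w1 w1 = (l1 * a)\<^sup>2"
    unfolding metric_centre l1 using pc(4) uv(1) by (simp add: power_mult_distrib) (simp add: power2_eq_square mult_ac)
  have m22: "model_metric K y w2 w2 = (l2 * b)\<^sup>2"
    unfolding metric_centre l2 using uv(2) by (simp add: power_mult_distrib) (simp add: power2_eq_square mult_ac)
  have m12: "model_metric K y w1 w2 = l1 * l2 * ((u y p * v y q + v y p * u y q) / 2)"
    unfolding metric_centre l1 l2 by (simp add: algebra_simps)
  have neg: "u y p * v y q + v y p * u y q < 0" using pc qc by (simp add: add_neg_neg mult_neg_pos)
  have "\<bar>model_metric K y w1 w2\<bar> / (sqrt (model_metric K y w1 w1) * sqrt (model_metric K y w2 w2))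
     = (\<bar>l1\<bar> * \<bar>l2\<bar> * (- (u y p * v y q + v y p * u y q) / 2)) / (\<bar>l1\<bar> * a * (\<bar>l2\<bar> * b))"
    unfolding m11 m22 m12 using neg ab by (simp add: abs_mult)
  also have "\<dots> = hinge_law \<kappa> a b c"
    unfolding hinge_law_chart [OF t uv ab(1,2)] using l1(1) l2(1) ab by (simp add: field_simps)
  finally show ?thesis by (simp add: hyperbolic_angle_def)
qed

text \<open>
  Points on the two sides of a hinge span a hinge with the same angle. In the chart centred at the
  vertex they are obtained by scaling the coordinate vectors of the end points, and the normalised
  inner product is invariant under scaling.
\<close>

lemma hinge_law_scale:
  assumes ab: "0 < a" "0 < b" "0 < c" "0 < 1 + \<kappa> * a\<^sup>2" "0 < 1 + \<kappa> * b\<^sup>2" "0 < 1 + \<kappa> * c\<^sup>2"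
    and l: "e p y = ennreal (rl a)" "e y q = ennreal (rl b)" "e p q = ennreal (rl c)"
    and m: "model_le K p m" "model_le K m y" "e p y \<le> e p m + e m y"
    and n: "model_le K y n" "model_le K n q" "e y q \<le> e y n + e n q"
    and ab': "0 < a'" "0 < b'" "0 < 1 + \<kappa> * a'\<^sup>2" "0 < 1 + \<kappa> * b'\<^sup>2"
    and l': "e m y = ennreal (rl a')" "e y n = ennreal (rl b')"
    and D: "e m n < model_diameter K"
  obtains c' where "0 < c'" "0 < 1 + \<kappa> * c'\<^sup>2" "e m n = ennreal (rl c')"
    "hinge_law \<kappa> a' b' c' = hinge_law \<kappa> a b c"
proof -
  have pos: "0 < rl a" "0 < rl b" "0 < rl c" "0 < rl a'" "0 < rl b'"
    using radial_length_strict_mono [of 0 _ \<kappa>] ab ab' by auto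
  have t: "timelike_pair p y" "timelike_pair y q" "timelike_pair p q" "timelike_pair m y" "timelike_pair y n"
    by (rule timelike_pairI; simp add: l l' pos radial_length_lt_diameter)+
  have "0 < e m y" using l' pos by simp
  also have "e m y \<le> e m n" by (rule model_ell_mono_le [OF n(1)])
  finally have t6: "timelike_pair m n" using D by (rule timelike_pairI)
  define c' where "c' = sqrt (u m n * v m n)"
  have c': "0 < c'" "u m n * v m n = c'\<^sup>2" using t6 by (auto simp: c'_def timelike_pair_def)
  have uv: "u p y * v p y = a\<^sup>2" "u y q * v y q = b\<^sup>2" "u p q * v p q = c\<^sup>2" "u m y * v m y = a'\<^sup>2" "u y n * v y n = b'\<^sup>2"
    using timelike_pair_product [OF t(1) l(1)] timelike_pair_product [OF t(2) l(2)] timelike_pair_product [OF t(3) l(3)]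
      timelike_pair_product [OF t(4) l'(1)] timelike_pair_product [OF t(5) l'(2)] ab ab' by auto
  note pc = past_chart [OF t(1)] and mc = past_chart [OF t(4)]
  have qc: "0 < u y q" "0 < v y q" "0 < u y n" "0 < v y n" using t by (auto simp: timelike_pair_def)
  \<comment> \<open>Both sides are rays through the origin of the chart at \<open>y\<close>, with scaling factors \<open>f\<close> and \<open>g\<close>.\<close>
  define f where "f = u y m / u y p"
  have f: "u y m = f * u y p" "v y m = f * v y p" "0 < f"
    using past_collinear [OF t(1) m] pc mc by (auto simp: f_def field_simps zero_less_divide_iff)
  define g where "g = u y n / u y q"
  have g: "u y n = g * u y q" "v y n = g * v y q" "0 < g"
    using collinear(2) [OF t(2) n] qc by (auto simp: g_def field_simps)
  have "a'\<^sup>2 = (f * a)\<^sup>2" using mc(4) uv(4) pc(4) uv(1) unfolding f by (simp add: power_mult_distrib) (simp add: power2_eq_square mult_ac)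
  then have a': "a' = f * a" using ab ab' f by (simp add: power2_eq_iff_nonneg)
  have "b'\<^sup>2 = (g * b)\<^sup>2" using uv(5) uv(2) unfolding g by (simp add: power_mult_distrib) (simp add: power2_eq_square mult_ac)
  then have b': "b' = g * b" using ab ab' g by (simp add: power2_eq_iff_nonneg)
  have "hinge_law \<kappa> a' b' c' = - (u y m * v y n + v y m * u y n) / (2 * a' * b')"
    by (rule hinge_law_chart [OF t(4,5) t6 uv(4,5) c'(2) ab'(1,2)])
  also have "\<dots> = - (u y p * v y q + v y p * u y q) / (2 * a * b)"
    unfolding f g a' b' using f(3) g(3) ab by (simp add: field_simps)
  also have "\<dots> = hinge_law \<kappa> a b c" by (rule hinge_law_chart [OF t(1-3) uv(1-3) ab(1,2), symmetric])
  finally have "hinge_law \<kappa> a' b' c' = hinge_law \<kappa> a b c" .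
  moreover have "e m n = ennreal (rl c')" unfolding c'_def by (rule model_ell_timelike_pair(1) [OF t6])
  moreover have "0 < 1 + \<kappa> * c'\<^sup>2" using conf_pos [of m n] t6 c' by (auto simp: timelike_pair_def)
  ultimately show ?thesis using that c'(1) by blast
qed

text \<open>
  Small triples with \<open>hinge_law \<kappa> a b c \<ge> 1\<close> are realised by triangles in the model space. The
  vertex is put at the origin, \<open>q\<close> at \<open>(b, b)\<close> and \<open>p\<close> at \<open>(- a r, - a / r)\<close>, where \<open>r\<close> is the
  exponential of the required angle; the law of cosines then shows that the third side is correct.
\<close>

lemma hinge_exists:
  assumes ab: "0 < a" "0 < b" "0 < c"
    and small: "\<bar>\<kappa>\<bar> * a\<^sup>2 \<le> 1/4" "\<bar>\<kappa>\<bar> * b\<^sup>2 \<le> 1/4" "\<bar>\<kappa>\<bar> * c\<^sup>2 \<le> 1/4"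
    and law: "1 \<le> hinge_law \<kappa> a b c"
  obtains p y q where "e p y = ennreal (rl a)" "e y q = ennreal (rl b)" "e p q = ennreal (rl c)"
proof -
  have abs: "- (\<bar>\<kappa>\<bar> * r\<^sup>2) \<le> \<kappa> * r\<^sup>2" "\<kappa> * r\<^sup>2 \<le> \<bar>\<kappa>\<bar> * r\<^sup>2" for r
    using mult_right_mono [of "- \<bar>\<kappa>\<bar>" \<kappa> "r\<^sup>2"] mult_right_mono [of \<kappa> "\<bar>\<kappa>\<bar>" "r\<^sup>2"] by auto
  have conf: "3/4 \<le> 1 + \<kappa> * a\<^sup>2" "3/4 \<le> 1 + \<kappa> * b\<^sup>2" "3/4 \<le> 1 + \<kappa> * c\<^sup>2"
     "1 + \<kappa> * a\<^sup>2 \<le> 5/4" "1 + \<kappa> * b\<^sup>2 \<le> 5/4"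
    using abs [of a] abs [of b] abs [of c] small by linarith+
  define y :: point where "y = (0, 0)"
  define L where "L = hinge_law \<kappa> a b c"
  define r where "r = L + sqrt (L\<^sup>2 - 1)"
  have "1 \<le> L\<^sup>2" using law one_le_power [of L 2] by (simp add: L_def)
  have r: "0 < r" "r + 1 / r = 2 * L"
  proof -
    have s: "(sqrt (L\<^sup>2 - 1))\<^sup>2 = L\<^sup>2 - 1" using \<open>1 \<le> L\<^sup>2\<close> by simp
    have "0 \<le> sqrt (L\<^sup>2 - 1)" using \<open>1 \<le> L\<^sup>2\<close> by simp
    then show "0 < r" using law unfolding r_def L_def by linarith
    moreover have "r * (2 * L - r) = 1" unfolding r_def using s by (simp add: power2_eq_square algebra_simps)
    ultimately show "r + 1 / r = 2 * L" by (simp add: field_simps)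
  qed
  define \<Sigma> where "\<Sigma> = c\<^sup>2 / (1 + \<kappa> * c\<^sup>2)"
  define P where "P = (1 + \<kappa> * a\<^sup>2) * (1 + \<kappa> * b\<^sup>2)"
  have Ppos: "0 < P" unfolding P_def using conf by (intro mult_pos_pos) auto
  have LL: "2 * a * b * L = \<Sigma> * P - a\<^sup>2 - b\<^sup>2"
    using ab by (simp add: L_def hinge_law_def \<Sigma>_def P_def)
  \<comment> \<open>For \<open>\<kappa> > 0\<close> the Moebius map to the chart of \<open>p\<close> needs positive denominators; smallness of \<open>c\<close>
    bounds the angle and thereby both of them.\<close>
  have small_cross: "0 < 1 - \<kappa> * (a * b * x)" if x: "0 < x" "x \<le> 2 * L" for x
  proof (cases "\<kappa> > 0")
    case True
    have "a * b * x \<le> a * b * (2 * L)" using x ab by (intro mult_left_mono) auto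
    also have "\<dots> \<le> \<Sigma> * P" using LL by (simp add: mult_ac)
    also have "\<dots> \<le> c\<^sup>2 * (25/16)"
    proof (rule mult_mono)
      have "1 \<le> 1 + \<kappa> * c\<^sup>2" using True by simp
      then show "\<Sigma> \<le> c\<^sup>2" unfolding \<Sigma>_def using ab by (simp add: divide_le_eq mult_le_cancel_left1)
      have "P \<le> (5/4) * (5/4)" unfolding P_def using conf by (intro mult_mono) auto
      then show "P \<le> 25/16" by simp
    qed (use Ppos in auto)
    finally have "\<kappa> * (a * b * x) \<le> \<kappa> * (c\<^sup>2 * (25/16))" using True by (intro mult_left_mono) auto
    also have "\<dots> < 1" using small(3) True by simp
    finally show ?thesis by simp
  next
    case False
    then have "\<kappa> * (a * b * x) \<le> 0" using ab x by (intro mult_nonpos_nonneg) auto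
    then show ?thesis by simp
  qed
  have ri: "0 < 1 / r" using r(1) by simp
  have rr: "r \<le> 2 * L" "1 / r \<le> 2 * L" using r ri by linarith+
  define q where "q = iv y b b"
  define p where "p = iv y (- (a * r)) (- (a / r))"
  have "0 < 1 + \<kappa> * (b * b)" using conf by (simp add: power2_eq_square)
  from iv [OF this, of y] have q: "M y q" "u y q = b" "v y q = b" by (auto simp: q_def)
  have "(- (a * r)) * (- (a / r)) = a\<^sup>2" using r(1) by (simp add: power2_eq_square)
  then have "0 < 1 + \<kappa> * ((- (a * r)) * (- (a / r)))" using conf by simp
  from iv [OF this, of y] have p: "M y p" "u y p = - (a * r)" "v y p = - (a / r)" by (auto simp: p_def)
  have yq: "timelike_pair y q" using q ab by (simp add: timelike_pair_def)
  obtain \<rho> where \<rho>: "0 < \<rho>" "M p y" "u p y = - \<rho> * u y p" "v p y = - v y p / \<rho>"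
    and n: "M y q \<Longrightarrow> 0 < 1 + \<kappa> * (u y q * v y p) \<Longrightarrow> 0 < 1 + \<kappa> * (u y p * v y q) \<Longrightarrow>
        M p q \<and> u p q = \<rho> * ((u y q - u y p) / (1 + \<kappa> * (u y q * v y p)))
              \<and> v p q = (v y q - v y p) / (1 + \<kappa> * (u y p * v y q)) / \<rho>"
    using chart_swap [OF p(1)] by metis
  have py: "timelike_pair p y" unfolding timelike_pair_def \<rho>(3,4) p(2,3) using \<rho>(1,2) ab r(1) by simp
  have uvp: "u p y * v p y = a\<^sup>2" unfolding \<rho>(3,4) p(2,3) using \<rho>(1) r(1) by (simp add: power2_eq_square)
  have cr: "0 < 1 + \<kappa> * (u y q * v y p)" "0 < 1 + \<kappa> * (u y p * v y q)"
    using small_cross [OF ri rr(2)] small_cross [OF r(1) rr(1)] unfolding p q by (simp_all add: mult_ac)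
  have d: "0 < u y q - u y p" "0 < v y q - v y p" unfolding p q using ab r(1) by (simp_all add: add_pos_pos)
  have pq: "timelike_pair p q"
    using n [OF q(1) cr] \<rho>(1) cr d unfolding timelike_pair_def by simp
  have uvq: "u y q * v y q = b\<^sup>2" by (simp add: q power2_eq_square)
  define X where "X = u p q * v p q"
  have X: "0 < 1 + \<kappa> * X" "0 < X" using conf_pos [of p q] pq by (auto simp: timelike_pair_def X_def)
  have "- (u y p * v y q + v y p * u y q) = a * b * (r + 1 / r)" unfolding p q by (simp add: algebra_simps)
  then have "X / (1 + \<kappa> * X) * P = a\<^sup>2 + b\<^sup>2 + 2 * a * b * L"
    using hinge [OF py yq pq] unfolding uvp uvq X_def [symmetric] P_def [symmetric] r(2) by (simp add: mult_ac)
  then have "X / (1 + \<kappa> * X) * P = \<Sigma> * P" unfolding LL by simp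
  then have "X / (1 + \<kappa> * X) = \<Sigma>" using Ppos by (metis less_numeral_extra(3) mult_right_cancel)
  then have "X / (1 + \<kappa> * X) = c\<^sup>2 / (1 + \<kappa> * c\<^sup>2)" unfolding \<Sigma>_def .
  moreover have "0 < 1 + \<kappa> * c\<^sup>2" using conf by linarith
  ultimately have "X * (1 + \<kappa> * c\<^sup>2) = c\<^sup>2 * (1 + \<kappa> * X)" using X by (simp add: frac_eq_eq)
  then have "X = c\<^sup>2" by (simp add: algebra_simps)
  then show ?thesis
    using that [of p y q] model_ell_timelike_pair(1) [OF py] model_ell_timelike_pair(1) [OF yq] model_ell_timelike_pair(1) [OF pq] ab
    by (simp add: uvp uvq X_def)
qed

end

section \<open>The flat plane\<close>

lemma flat_charts:
  "model_null_charts 0 (\<lambda>y p. True) (\<lambda>y p. (fst p - fst y) + (snd p - snd y))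
     (\<lambda>y p. (fst p - fst y) - (snd p - snd y)) (\<lambda>y p. 1) (\<lambda>y p. 1)
     (\<lambda>y a b. (fst y + (a + b) / 2, snd y + (a - b) / 2)) (\<lambda>p. 1) (\<lambda>p. 1)
     (\<lambda>p. fst p + snd p) (\<lambda>p. fst p - snd p) 0 (\<lambda>p. 1)"
proof -
  have d: "((\<lambda>s. (fst (c s) - fst y) + (snd (c s) - snd y)) has_real_derivative 1 * (1 * fst c' + 1 * snd c')) (at s within T)"
    "((\<lambda>s. (fst (c s) - fst y) - (snd (c s) - snd y)) has_real_derivative 1 * (1 * fst c' - 1 * snd c')) (at s within T)"
    "((\<lambda>s. fst (c s) + snd (c s)) has_real_derivative 1 * (1 * fst c' + 1 * snd c')) (at s within T)"
    "((\<lambda>s. fst (c s) - snd (c s)) has_real_derivative 1 * (1 * fst c' - 1 * snd c')) (at s within T)"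
    if "(c has_vector_derivative c') (at s within T)" for c :: "real \<Rightarrow> point" and c' s T and y :: point
    using has_vector_derivative_fst_snd [OF that]
    by (auto intro!: derivative_eq_intros simp flip: has_real_derivative_iff_has_vector_derivative)
  have m: "\<exists>\<rho>>0. \<forall>q. True \<longrightarrow> 0 < 1 + 0 * (x q * y') \<longrightarrow> 0 < 1 + 0 * (x' * y q) \<longrightarrow>
      True \<and> z q = \<rho> * ((x q - x') / (1 + 0 * (x q * y'))) \<and> w q = (y q - y') / (1 + 0 * (x' * y q)) / \<rho>"
    if "\<And>q. z q = x q - x'" "\<And>q. w q = y q - y'" for x y z w :: "point \<Rightarrow> real" and x' y' :: real
    using that by (intro exI [of _ 1]) auto
  show ?thesis
  proof (unfold_locales, goal_cases)
    case (19 y p) show ?case by (rule m) auto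
  qed (((rule d, assumption) | (simp add: model_metric_def mono_on_def field_simps; fail) | (intro continuous_intros))+)
qed

section \<open>Anti-de Sitter space\<close>

text \<open>
  Used to select the branch: in the chart domains the sign of a cosine determines in which half
  period its argument lies.
\<close>

lemma cos_pos_range:
  fixes x :: real
  assumes "cos x > 0" "\<bar>x\<bar> < 3 * pi / 2"
  shows "\<bar>x\<bar> < pi / 2"
proof (rule ccontr)
  assume "\<not> \<bar>x\<bar> < pi / 2"
  then have "0 \<le> \<bar>x\<bar> - pi / 2" "\<bar>x\<bar> - pi / 2 \<le> pi" using assms by auto
  then have "0 \<le> sin (\<bar>x\<bar> - pi / 2)" by (rule sin_ge_zero)
  then have "cos \<bar>x\<bar> \<le> 0" by (simp add: sin_diff)
  then show False using assms(1) by simp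
qed

lemma cross_sin_cos:
  fixes p q r s :: real
  shows "cos (p - s) * cos (q - r) + sin (p - r) * sin (q - s) = cos (r - s) * cos (p - q)"
proof -
  have "(p - s) + (q - r) = p + q - (r + s)" "(p - s) - (q - r) = (p - q) + (r - s)"
    "(p - r) - (q - s) = (p - q) - (r - s)" "(p - r) + (q - s) = p + q - (r + s)" by simp_all
  then show ?thesis unfolding cos_times_cos sin_times_sin by (simp only:) (simp add: cos_add cos_diff field_simps)
qed

lemma sin_ratio_diff:
  fixes p q r s :: real
  assumes "cos (p - s) \<noteq> 0" "cos (q - s) \<noteq> 0"
  shows "sin (q - r) / cos (q - s) - sin (p - r) / cos (p - s) = cos (r - s) * sin (q - p) / (cos (p - s) * cos (q - s))"
proof -
  have 1: "(q - r) + (p - s) = p + q - (r + s)" "(q - r) - (p - s) = (q - p) - (r - s)"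
    "(p - r) - (q - s) = - ((q - p) + (r - s))" "(p - r) + (q - s) = p + q - (r + s)" by simp_all
  have "sin (q - r) * cos (p - s) - sin (p - r) * cos (q - s) = cos (r - s) * sin (q - p)"
  proof -
    have "(sin x + sin (a - b)) / 2 - (sin x + sin (- (a + b))) / 2 = cos b * sin a" for x a b :: real
      by (simp add: sin_add sin_diff field_simps)
    then show ?thesis unfolding sin_times_cos 1 .
  qed
  then show ?thesis using assms by (simp add: diff_frac_eq mult.commute)
qed

lemma half_diff_bounds:
  fixes a b c d w :: real
  shows "\<bar>a - c\<bar> < w \<Longrightarrow> \<bar>b - d\<bar> < w \<Longrightarrow> \<bar>d - c\<bar> < w \<Longrightarrow> \<bar>a / 2 - b / 2\<bar> < 3 * w / 2"
    and "\<bar>a / 2 - b / 2\<bar> < w / 2 \<Longrightarrow> \<bar>a - b\<bar> < w"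
  by linarith+

lemma arctan_affine_deriv:
  assumes "(f has_real_derivative D) (at s)"
  shows "\<exists>E. ((\<lambda>s. c + 2 * arctan (f s)) has_real_derivative E) (at s)"
proof
  show "((\<lambda>s. c + 2 * arctan (f s)) has_real_derivative 2 * (inverse (1 + (f s)\<^sup>2) * D)) (at s)"
    by (rule derivative_eq_intros refl assms | simp)+
qed

text \<open>
  The universal cover of anti-de Sitter space of curvature \<open>k\<^sup>2\<close>. The Gudermannian \<open>gd\<close> turns
  \<open>cosh\<^sup>2 (k x) dt\<^sup>2 - dx\<^sup>2\<close> into a conformal multiple of \<open>dU dV\<close> with \<open>U, V = k t \<plusminus> gd x\<close> on the
  strip \<open>\<bar>U - V\<bar> < pi\<close>. For a centre on the axis \<open>x = 0\<close> the chart is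
  \<open>2 / k * tan ((U - U y) / 2)\<close> and \<open>2 / k * tan ((V - V y) / 2)\<close>; the general formula is its
  translate by an isometry. The poles of the tangents bound the domain.
\<close>

locale ads =
  fixes k :: real assumes k: "0 < k"
begin

definition gd :: "real \<Rightarrow> real" where "gd x = arctan (sinh (k * x))"
definition U :: "point \<Rightarrow> real" where "U p = k * fst p + gd (snd p)"
definition V :: "point \<Rightarrow> real" where "V p = k * fst p - gd (snd p)"
definition M :: "point \<Rightarrow> point \<Rightarrow> bool" where "M y p \<longleftrightarrow> \<bar>U p - V y\<bar> < pi \<and> \<bar>V p - U y\<bar> < pi"
definition u :: "point \<Rightarrow> point \<Rightarrow> real" where
  "u y p = 2 / k * (sin (U p / 2 - U y / 2) / cos (U p / 2 - V y / 2))"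
definition v :: "point \<Rightarrow> point \<Rightarrow> real" where
  "v y p = 2 / k * (sin (V p / 2 - V y / 2) / cos (V p / 2 - U y / 2))"
definition A :: "point \<Rightarrow> point \<Rightarrow> real" where
  "A y p = cos (U y / 2 - V y / 2) * cos (U p / 2 - V p / 2) / (cos (U p / 2 - V y / 2))\<^sup>2"
definition B :: "point \<Rightarrow> point \<Rightarrow> real" where
  "B y p = cos (U y / 2 - V y / 2) * cos (U p / 2 - V p / 2) / (cos (V p / 2 - U y / 2))\<^sup>2"
definition ivU :: "point \<Rightarrow> real \<Rightarrow> real" where
  "ivU y a = V y + 2 * arctan ((k / 2 * a + sin (U y / 2 - V y / 2)) / cos (U y / 2 - V y / 2))"
definition ivV :: "point \<Rightarrow> real \<Rightarrow> real" where
  "ivV y b = U y + 2 * arctan ((k / 2 * b - sin (U y / 2 - V y / 2)) / cos (U y / 2 - V y / 2))"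
definition pt :: "real \<Rightarrow> real \<Rightarrow> point" where
  "pt r s = ((r + s) / (2 * k), arsinh (tan ((r - s) / 2)) / k)"
definition iv :: "point \<Rightarrow> real \<Rightarrow> real \<Rightarrow> point" where "iv y a b = pt (ivU y a) (ivV y b)"

lemma strip: "\<bar>U p - V p\<bar> < pi"
proof -
  have "- (pi / 2) < gd (snd p)" "gd (snd p) < pi / 2" unfolding gd_def by (rule arctan_lbound arctan_ubound)+
  then show ?thesis by (auto simp: U_def V_def)
qed

lemma cos_half: "\<bar>a - b\<bar> < pi \<Longrightarrow> 0 < cos (a / 2 - b / 2)" for a b :: real
  by (rule cos_gt_zero_pi) auto

lemma cos_UV: "cos (U p / 2 - V p / 2) = 1 / cosh (k * snd p)"
proof -
  have "U p / 2 - V p / 2 = gd (snd p)" by (simp add: U_def V_def field_simps)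
  moreover have "sqrt (1 + (sinh (k * snd p))\<^sup>2) = cosh (k * snd p)"
  proof -
    have "1 + (sinh (k * snd p))\<^sup>2 = (cosh (k * snd p))\<^sup>2" by (simp add: cosh_square_eq)
    then show ?thesis using cosh_real_pos [of "k * snd p"] by (simp only: real_sqrt_abs abs_of_pos)
  qed
  ultimately show ?thesis by (simp add: gd_def cos_arctan)
qed

lemma U_deriv:
  assumes "(c has_vector_derivative c') (at s within T)"
  shows "((\<lambda>s. U (c s)) has_real_derivative k * cos (U (c s) / 2 - V (c s) / 2) * (cosh (k * snd (c s)) * fst c' + 1 * snd c')) (at s within T)"
    "((\<lambda>s. V (c s)) has_real_derivative k * cos (U (c s) / 2 - V (c s) / 2) * (cosh (k * snd (c s)) * fst c' - 1 * snd c')) (at s within T)"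
proof -
  note d = has_vector_derivative_fst_snd [OF assms, folded has_real_derivative_iff_has_vector_derivative]
  have ch: "cosh (k * snd (c s)) > 0" "1 + (sinh (k * snd (c s)))\<^sup>2 = (cosh (k * snd (c s)))\<^sup>2"
    by (auto simp: cosh_square_eq)
  have "((\<lambda>s. sinh (k * snd (c s))) has_real_derivative cosh (k * snd (c s)) * (k * snd c')) (at s within T)"
    by (auto intro!: derivative_eq_intros d)
  from DERIV_chain2 [OF DERIV_arctan this]
  have g: "((\<lambda>s. gd (snd (c s))) has_real_derivative k * cos (U (c s) / 2 - V (c s) / 2) * snd c') (at s within T)"
    unfolding gd_def cos_UV ch(2) using ch(1) by (simp add: power2_eq_square field_simps)
  have "((\<lambda>s. k * fst (c s)) has_real_derivative k * fst c') (at s within T)"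
    by (rule DERIV_cmult [OF d(1)])
  moreover have "k * fst c' = k * cos (U (c s) / 2 - V (c s) / 2) * (cosh (k * snd (c s)) * fst c')"
    unfolding cos_UV using ch(1) by simp
  ultimately have t: "((\<lambda>s. k * fst (c s)) has_real_derivative k * cos (U (c s) / 2 - V (c s) / 2) * (cosh (k * snd (c s)) * fst c')) (at s within T)"
    by simp
  show "((\<lambda>s. U (c s)) has_real_derivative k * cos (U (c s) / 2 - V (c s) / 2) * (cosh (k * snd (c s)) * fst c' + 1 * snd c')) (at s within T)"
    using DERIV_add [OF t g] by (simp add: U_def [abs_def] distrib_left)
  show "((\<lambda>s. V (c s)) has_real_derivative k * cos (U (c s) / 2 - V (c s) / 2) * (cosh (k * snd (c s)) * fst c' - 1 * snd c')) (at s within T)"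
    using DERIV_diff [OF t g] by (simp add: V_def [abs_def] right_diff_distrib)
qed

lemma UV_cont: "continuous_on T U" "continuous_on T V"
  unfolding U_def [abs_def] V_def [abs_def] gd_def
  by (intro continuous_intros; simp)+

lemma chart_cos: 
  assumes "M y p"
  shows "0 < cos (U p / 2 - V y / 2)" "0 < cos (V p / 2 - U y / 2)" "0 < cos (U y / 2 - V y / 2)" "0 < cos (U p / 2 - V p / 2)"
  using assms strip [of y] strip [of p] unfolding M_def by (auto intro!: cos_half)

text \<open>
  The polarised conformal factor, which contains the conformal factor itself as the case \<open>p = q\<close>
  and the denominators of the Moebius map.
\<close>

lemma conf:
  assumes "M y p" "M y q"
  shows "1 + k\<^sup>2 / 4 * (u y q * v y p) = cos (U y / 2 - V y / 2) * cos (U q / 2 - V p / 2) / (cos (U q / 2 - V y / 2) * cos (V p / 2 - U y / 2))"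
proof -
  have gen: "k\<^sup>2 / 4 * ((2 / k * (a / b)) * (2 / k * (c / d))) = a * c / (b * d)" for a b c d :: real
    using k by (simp add: power2_eq_square)
  have 1: "k\<^sup>2 / 4 * (u y q * v y p) = sin (U q / 2 - U y / 2) * sin (V p / 2 - V y / 2) / (cos (U q / 2 - V y / 2) * cos (V p / 2 - U y / 2))"
    unfolding u_def v_def by (rule gen)
  have "1 + a / b = (b + a) / b" if "b \<noteq> 0" for a b :: real using that by (simp add: add_divide_distrib)
  moreover have "cos (U q / 2 - V y / 2) * cos (V p / 2 - U y / 2) \<noteq> 0"
    using chart_cos(2) [OF assms(1)] chart_cos(1) [OF assms(2)] by simp
  ultimately show ?thesis unfolding 1 by (metis cross_sin_cos)
qed

lemma u_deriv:
  assumes m: "M y (c s)" and c: "(c has_vector_derivative c') (at s within T)"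
  shows "((\<lambda>s. u y (c s)) has_real_derivative A y (c s) * (cosh (k * snd (c s)) * fst c' + 1 * snd c')) (at s within T)"
    "((\<lambda>s. v y (c s)) has_real_derivative B y (c s) * (cosh (k * snd (c s)) * fst c' - 1 * snd c')) (at s within T)"
proof -
  have q: "((\<lambda>x. 2 / k * (sin (x / 2 - a / 2) / cos (x / 2 - b / 2))) has_real_derivative
       cos (a / 2 - b / 2) / (k * (cos (x / 2 - b / 2))\<^sup>2)) (at x)" if "cos (x / 2 - b / 2) \<noteq> 0" for x a b
  proof -
    have e: "cos (x / 2 - a / 2) * cos (x / 2 - b / 2) + sin (x / 2 - a / 2) * sin (x / 2 - b / 2) = cos (a / 2 - b / 2)"
      using cos_diff [of "x / 2 - b / 2" "x / 2 - a / 2"] by (simp add: mult.commute)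
    have S: "((\<lambda>x. sin (x / 2 - a / 2)) has_real_derivative cos (x / 2 - a / 2) * (1 / 2)) (at x)"
      and C: "((\<lambda>x. cos (x / 2 - b / 2)) has_real_derivative - sin (x / 2 - b / 2) * (1 / 2)) (at x)"
      by (auto intro!: derivative_eq_intros)
    have f: "2 / k * ((r * (1 / 2) * t - m * (- w * (1 / 2))) / (t * t)) = (r * t + m * w) / (k * t\<^sup>2)" if "t \<noteq> 0" for r t m w :: real
      using k that by (simp add: power2_eq_square field_simps)
    show ?thesis using DERIV_cmult [OF DERIV_divide [OF S C that], of "2 / k"] unfolding f [OF that] e .
  qed
  have sym: "cos (V y / 2 - U y / 2) = cos (U y / 2 - V y / 2)" by (subst cos_minus [symmetric]) simp
  have nz: "cos (U (c s) / 2 - V y / 2) \<noteq> 0" "cos (V (c s) / 2 - U y / 2) \<noteq> 0" using chart_cos [OF m] by auto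
  show "((\<lambda>s. u y (c s)) has_real_derivative A y (c s) * (cosh (k * snd (c s)) * fst c' + 1 * snd c')) (at s within T)"
    using DERIV_chain2 [OF q [OF nz(1), of "U y"] U_deriv(1) [OF c]] k
    by (simp add: u_def A_def mult_ac)
  show "((\<lambda>s. v y (c s)) has_real_derivative B y (c s) * (cosh (k * snd (c s)) * fst c' - 1 * snd c')) (at s within T)"
    using DERIV_chain2 [OF q [OF nz(2), of "V y"] U_deriv(2) [OF c]] k
    by (simp add: v_def B_def mult_ac sym)
qed

lemma chart_cont:
  "continuous_on {p. M y p} (u y)" "continuous_on {p. M y p} (v y)"
  "continuous_on {p. M y p} (A y)" "continuous_on {p. M y p} (B y)"
proof -
  have c: "continuous_on {p. M y p} (\<lambda>p. U p / 2)" "continuous_on {p. M y p} (\<lambda>p. V p / 2)"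
    by (intro continuous_on_divide UV_cont continuous_on_const; simp)+
  have s1: "continuous_on {p. M y p} (\<lambda>p. sin (U p / 2 - U y / 2))"
    and s2: "continuous_on {p. M y p} (\<lambda>p. sin (V p / 2 - V y / 2))"
    and c1: "continuous_on {p. M y p} (\<lambda>p. cos (U p / 2 - V y / 2))"
    and c2: "continuous_on {p. M y p} (\<lambda>p. cos (V p / 2 - U y / 2))"
    and c3: "continuous_on {p. M y p} (\<lambda>p. cos (U p / 2 - V p / 2))"
    by (intro continuous_on_sin continuous_on_cos continuous_on_diff c continuous_on_const)+
  have nz: "cos (U p / 2 - V y / 2) \<noteq> 0" "cos (V p / 2 - U y / 2) \<noteq> 0" if "M y p" for p
    using chart_cos(1,2) [OF that] by simp_all
  show "continuous_on {p. M y p} (u y)" unfolding u_def [abs_def]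
    by (rule continuous_on_mult [OF continuous_on_const continuous_on_divide [OF s1 c1]]) (use nz in blast)
  show "continuous_on {p. M y p} (v y)" unfolding v_def [abs_def]
    by (rule continuous_on_mult [OF continuous_on_const continuous_on_divide [OF s2 c2]]) (use nz in blast)
  show "continuous_on {p. M y p} (A y)" unfolding A_def [abs_def]
    by (rule continuous_on_divide [OF continuous_on_mult [OF continuous_on_const c3] continuous_on_power [OF c1]]) (use nz in simp)
  show "continuous_on {p. M y p} (B y)" unfolding B_def [abs_def]
    by (rule continuous_on_divide [OF continuous_on_mult [OF continuous_on_const c3] continuous_on_power [OF c2]]) (use nz in simp)
qed

lemma u_diff:
  assumes "M y p" "M y q"
  shows "u y q - u y p = 2 / k * (cos (U y / 2 - V y / 2) * sin (U q / 2 - U p / 2) / (cos (U p / 2 - V y / 2) * cos (U q / 2 - V y / 2)))"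
    "v y q - v y p = 2 / k * (cos (U y / 2 - V y / 2) * sin (V q / 2 - V p / 2) / (cos (V p / 2 - U y / 2) * cos (V q / 2 - U y / 2)))"
proof -
  have sym: "cos (V y / 2 - U y / 2) = cos (U y / 2 - V y / 2)" by (subst cos_minus [symmetric]) simp
  have nz: "cos (U p / 2 - V y / 2) \<noteq> 0" "cos (U q / 2 - V y / 2) \<noteq> 0" "cos (V p / 2 - U y / 2) \<noteq> 0" "cos (V q / 2 - U y / 2) \<noteq> 0"
    using chart_cos [OF assms(1)] chart_cos [OF assms(2)] by auto
  show "u y q - u y p = 2 / k * (cos (U y / 2 - V y / 2) * sin (U q / 2 - U p / 2) / (cos (U p / 2 - V y / 2) * cos (U q / 2 - V y / 2)))"
    unfolding u_def right_diff_distrib [symmetric] sin_ratio_diff [OF nz(1,2)] ..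
  show "v y q - v y p = 2 / k * (cos (U y / 2 - V y / 2) * sin (V q / 2 - V p / 2) / (cos (V p / 2 - U y / 2) * cos (V q / 2 - U y / 2)))"
    unfolding v_def right_diff_distrib [symmetric] sin_ratio_diff [OF nz(3,4)] sym ..
qed

text \<open>
  The numerators of the Moebius map are computed by the addition theorem for \<open>sin\<close> and its
  denominators are polarised conformal factors. Their positivity confines the mixed differences of
  the null coordinates of \<open>p\<close> and \<open>q\<close> to one half period, so that \<open>q\<close> lies in the chart of \<open>p\<close>.
\<close>

lemma moebius:
  assumes p: "M y p"
  shows "\<exists>\<rho>>0. \<forall>q. M y q \<longrightarrow> 0 < 1 + k\<^sup>2 / 4 * (u y q * v y p) \<longrightarrow> 0 < 1 + k\<^sup>2 / 4 * (u y p * v y q) \<longrightarrow>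
        M p q \<and> u p q = \<rho> * ((u y q - u y p) / (1 + k\<^sup>2 / 4 * (u y q * v y p)))
              \<and> v p q = (v y q - v y p) / (1 + k\<^sup>2 / 4 * (u y p * v y q)) / \<rho>"
proof (intro exI conjI allI impI)
  note P = chart_cos [OF p]
  show "0 < cos (U p / 2 - V y / 2) / cos (V p / 2 - U y / 2)" using P by simp
  fix q assume q: "M y q" and c: "0 < 1 + k\<^sup>2 / 4 * (u y q * v y p)" "0 < 1 + k\<^sup>2 / 4 * (u y p * v y q)"
  note Q = chart_cos [OF q]
  have 1: "0 < cos (U q / 2 - V p / 2)" "0 < cos (U p / 2 - V q / 2)"
  proof -
    have gen: "0 < C" if "0 < d * C / (a * b)" "0 < d" "0 < a" "0 < b" for a b C d :: real
    proof -
      have "0 < d * C / (a * b) * (a * b)" using that by (intro mult_pos_pos) auto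
      then have "0 < d * C" using that by simp
      then show ?thesis using that(2) by (rule zero_less_mult_pos)
    qed
    show "0 < cos (U q / 2 - V p / 2)" by (rule gen [OF c(1) [unfolded conf [OF p q]] P(3) Q(1) P(2)])
    show "0 < cos (U p / 2 - V q / 2)" by (rule gen [OF c(2) [unfolded conf [OF q p]] P(3) P(1) Q(2)])
  qed
  have "\<bar>U q / 2 - V p / 2\<bar> < 3 * pi / 2" "\<bar>U p / 2 - V q / 2\<bar> < 3 * pi / 2"
    using half_diff_bounds(1) [OF _ _ strip [of y]] p q unfolding M_def by blast+
  then have "\<bar>U q / 2 - V p / 2\<bar> < pi / 2" "\<bar>U p / 2 - V q / 2\<bar> < pi / 2" using 1 cos_pos_range by blast+
  then have "\<bar>U q - V p\<bar> < pi" "\<bar>U p - V q\<bar> < pi" using half_diff_bounds(2) by blast+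
  then show "M p q" unfolding M_def by (simp add: abs_minus_commute)
  have s: "cos (V q / 2 - U p / 2) = cos (U p / 2 - V q / 2)" by (subst cos_minus [symmetric]) simp
  have gen1: "2 / k * (S / C) = a / b * (2 / k * (d * S / (a * e)) / (d * C / (e * b)))"
    if "0 < a" "0 < b" "0 < d" "0 < e" "0 < C" for S C a b d e :: real
  proof -
    have "d * S / (a * e) / (d * C / (e * b)) = S / C * (b / a)" using that by simp
    then have "2 / k * (d * S / (a * e) / (d * C / (e * b))) = 2 / k * (S / C * (b / a))" by (rule arg_cong)
    then show ?thesis using that by simp
  qed
  have gen2: "2 / k * (S / C) = 2 / k * (d * S / (b * f)) / (d * C / (a * f)) / (a / b)"
    if "0 < a" "0 < b" "0 < d" "0 < f" "0 < C" for S C a b d f :: real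
  proof -
    have "d * S / (b * f) / (d * C / (a * f)) = S / C * (a / b)" using that by simp
    then have "2 / k * (d * S / (b * f) / (d * C / (a * f))) = 2 / k * (S / C * (a / b))" by (rule arg_cong)
    then show ?thesis using that by simp
  qed
  show "u p q = cos (U p / 2 - V y / 2) / cos (V p / 2 - U y / 2) * ((u y q - u y p) / (1 + k\<^sup>2 / 4 * (u y q * v y p)))"
    unfolding u_diff(1) [OF p q] conf [OF p q] u_def [of p q] by (rule gen1 [OF P(1,2,3) Q(1) 1(1)])
  show "v p q = (v y q - v y p) / (1 + k\<^sup>2 / 4 * (u y p * v y q)) / (cos (U p / 2 - V y / 2) / cos (V p / 2 - U y / 2))"
    unfolding u_diff(2) [OF p q] conf [OF q p] v_def [of p q] s by (rule gen2 [OF P(1,2,3) Q(2) 1(2)])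
qed

lemma sin_half_nonneg_iff:
  fixes a b :: real
  assumes "\<bar>a - b\<bar> < 2 * pi"
  shows "0 \<le> sin (a / 2 - b / 2) \<longleftrightarrow> b \<le> a"
proof
  show "b \<le> a" if "0 \<le> sin (a / 2 - b / 2)"
  proof (rule ccontr)
    assume "\<not> b \<le> a"
    then have "0 < sin (b / 2 - a / 2)" using assms by (intro sin_gt_zero) auto
    then show False using that sin_minus [of "a / 2 - b / 2"] by simp
  qed
  show "0 \<le> sin (a / 2 - b / 2)" if "b \<le> a" using that assms by (intro sin_ge_zero) auto
qed

lemma u_le_iff:
  assumes "M y p" "M y q"
  shows "u y p \<le> u y q \<longleftrightarrow> U p \<le> U q" "v y p \<le> v y q \<longleftrightarrow> V p \<le> V q"
proof -
  note P = chart_cos [OF assms(1)] and Q = chart_cos [OF assms(2)]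
  have r: "\<bar>U q - U p\<bar> < 2 * pi" "\<bar>V q - V p\<bar> < 2 * pi"
    using assms unfolding M_def by (auto simp: abs_less_iff)
  have gen: "0 \<le> 2 / k * (d * S / (a * b)) \<longleftrightarrow> 0 \<le> S" if "0 < d" "0 < a" "0 < b" for S a b d :: real
  proof -
    have "0 < 2 / k * (d / (a * b))" using that k by simp
    moreover have "2 / k * (d * S / (a * b)) = S * (2 / k * (d / (a * b)))" by simp
    ultimately show ?thesis by (metis zero_le_mult_iff less_imp_le not_le)
  qed
  have "u y p \<le> u y q \<longleftrightarrow> 0 \<le> u y q - u y p" by simp
  also have "\<dots> \<longleftrightarrow> 0 \<le> sin (U q / 2 - U p / 2)"
    unfolding u_diff(1) [OF assms] by (rule gen [OF P(3,1) Q(1)])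
  also have "\<dots> \<longleftrightarrow> U p \<le> U q" by (rule sin_half_nonneg_iff [OF r(1)])
  finally show "u y p \<le> u y q \<longleftrightarrow> U p \<le> U q" .
  have "v y p \<le> v y q \<longleftrightarrow> 0 \<le> v y q - v y p" by simp
  also have "\<dots> \<longleftrightarrow> 0 \<le> sin (V q / 2 - V p / 2)"
    unfolding u_diff(2) [OF assms] by (rule gen [OF P(3,2) Q(2)])
  also have "\<dots> \<longleftrightarrow> V p \<le> V q" by (rule sin_half_nonneg_iff [OF r(2)])
  finally show "v y p \<le> v y q \<longleftrightarrow> V p \<le> V q" .
qed

lemma pt: 
  assumes "\<bar>r - s\<bar> < pi"
  shows "U (pt r s) = r" "V (pt r s) = s"
proof -
  have "arctan (tan ((r - s) / 2)) = (r - s) / 2" using assms by (intro arctan_tan) auto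
  then have "gd (snd (pt r s)) = (r - s) / 2" "k * fst (pt r s) = (r + s) / 2"
    using k by (simp_all add: gd_def pt_def)
  then show "U (pt r s) = r" "V (pt r s) = s" by (simp_all add: U_def V_def field_simps)
qed

lemma pt_UV: "pt (U p) (V p) = p"
  using k by (simp add: pt_def U_def V_def gd_def tan_arctan arsinh_sinh_real)

lemma iv_range: "\<bar>ivU y a - V y\<bar> < pi" "\<bar>ivV y b - U y\<bar> < pi"
proof -
  have "\<bar>2 * arctan x\<bar> < pi" for x
    using arctan_lbound [of x] arctan_ubound [of x] by (simp add: abs_less_iff)
  then show "\<bar>ivU y a - V y\<bar> < pi" "\<bar>ivV y b - U y\<bar> < pi"
    unfolding ivU_def ivV_def by (simp_all only: add_diff_cancel_left')
qed

lemma tan_shift: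
  fixes \<psi> d :: real
  assumes "cos \<psi> \<noteq> 0"
  shows "sin (\<psi> - d) / cos \<psi> = tan \<psi> * cos d - sin d"
  using assms by (simp add: sin_diff tan_def field_simps)

lemma ivU:
  "2 / k * (sin (ivU y a / 2 - U y / 2) / cos (ivU y a / 2 - V y / 2)) = a"
  "2 / k * (sin (ivV y b / 2 - V y / 2) / cos (ivV y b / 2 - U y / 2)) = b"
proof -
  define d where "d = U y / 2 - V y / 2"
  have c: "cos d \<noteq> 0" using cos_half [OF strip [of y]] by (simp add: d_def)
  have gen: "2 / k * (sin (arctan ((k / 2 * a + sin d) / cos d) - d) / cos (arctan ((k / 2 * a + sin d) / cos d))) = a"
    if "cos d \<noteq> 0" for a d
    using k that by (simp add: tan_shift tan_arctan)
  have "ivU y a / 2 - U y / 2 = arctan ((k / 2 * a + sin d) / cos d) - d"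
    "ivU y a / 2 - V y / 2 = arctan ((k / 2 * a + sin d) / cos d)"
    unfolding ivU_def d_def [symmetric] by (simp_all add: d_def field_simps)
  then show "2 / k * (sin (ivU y a / 2 - U y / 2) / cos (ivU y a / 2 - V y / 2)) = a"
    using gen [OF c] by simp
  have "ivV y b / 2 - V y / 2 = arctan ((k / 2 * b + sin (- d)) / cos (- d)) - (- d)"
    "ivV y b / 2 - U y / 2 = arctan ((k / 2 * b + sin (- d)) / cos (- d))"
    unfolding ivV_def d_def [symmetric] sin_minus cos_minus by (simp_all add: d_def field_simps)
  then show "2 / k * (sin (ivV y b / 2 - V y / 2) / cos (ivV y b / 2 - U y / 2)) = b"
    using gen [of "- d" b] c by simp
qed

text \<open>
  The strip is where the conformal factor is positive: by the addition theorem
  \<open>1 + k\<^sup>2 / 4 * a * b\<close> is a positive multiple of the cosine of half the difference of the null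
  coordinates.
\<close>

lemma iv_strip:
  assumes "0 < 1 + k\<^sup>2 / 4 * (a * b)"
  shows "\<bar>ivU y a - ivV y b\<bar> < pi"
proof -
  let ?r = "ivU y a" and ?s = "ivV y b"
  have P: "0 < cos (U y / 2 - V y / 2)" "0 < cos (?r / 2 - V y / 2)" "0 < cos (?s / 2 - U y / 2)"
    using cos_half [OF strip [of y]] cos_half [OF iv_range(1)] cos_half [OF iv_range(2)] by auto
  have "a * b = (2 / k * (sin (?r / 2 - U y / 2) / cos (?r / 2 - V y / 2))) * (2 / k * (sin (?s / 2 - V y / 2) / cos (?s / 2 - U y / 2)))"
    unfolding ivU ..
  then have 1: "k\<^sup>2 / 4 * (a * b) = sin (?r / 2 - U y / 2) * sin (?s / 2 - V y / 2) / (cos (?r / 2 - V y / 2) * cos (?s / 2 - U y / 2))"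
    using k by (simp add: power2_eq_square)
  have "0 < (1 + k\<^sup>2 / 4 * (a * b)) * (cos (?r / 2 - V y / 2) * cos (?s / 2 - U y / 2))"
    using assms P by simp
  also have "\<dots> = cos (U y / 2 - V y / 2) * cos (?r / 2 - ?s / 2)"
  proof -
    have gen: "(1 + x / y) * y = y + x" if "y \<noteq> 0" for x y :: real using that by (simp add: distrib_right)
    have nz: "cos (?r / 2 - V y / 2) * cos (?s / 2 - U y / 2) \<noteq> 0" using P by simp
    show ?thesis unfolding 1 gen [OF nz] by (rule cross_sin_cos)
  qed
  finally have "0 < cos (?r / 2 - ?s / 2)" using P(1) by (rule zero_less_mult_pos)
  moreover have "\<bar>?r / 2 - ?s / 2\<bar> < 3 * pi / 2"
    by (rule half_diff_bounds(1) [OF iv_range strip [of y]])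
  ultimately have "\<bar>?r / 2 - ?s / 2\<bar> < pi / 2" by (rule cos_pos_range)
  then show ?thesis by (rule half_diff_bounds(2))
qed

lemma iv:
  assumes "0 < 1 + k\<^sup>2 / 4 * (a * b)"
  shows "M y (iv y a b)" "u y (iv y a b) = a" "v y (iv y a b) = b"
  using pt [OF iv_strip [OF assms, of y]] iv_range [of y] ivU [of y]
  by (simp_all add: iv_def M_def u_def v_def)

lemma iv_uv:
  assumes "M y p"
  shows "iv y (u y p) (v y p) = p"
proof -
  let ?d = "U y / 2 - V y / 2"
  note P = chart_cos [OF assms]
  define d where "d = ?d"
  have d: "U p / 2 - U y / 2 = (U p / 2 - V y / 2) - d" "V p / 2 - V y / 2 = (V p / 2 - U y / 2) - (- d)" by (simp_all add: d_def)
  have "k / 2 * u y p = sin (U p / 2 - U y / 2) / cos (U p / 2 - V y / 2)"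
    "k / 2 * v y p = sin (V p / 2 - V y / 2) / cos (V p / 2 - U y / 2)"
    unfolding u_def v_def using k by simp_all
  then have 1: "k / 2 * u y p + sin ?d = tan (U p / 2 - V y / 2) * cos ?d"
    "k / 2 * v y p - sin ?d = tan (V p / 2 - U y / 2) * cos ?d"
    unfolding d d_def [symmetric] using tan_shift [of "U p / 2 - V y / 2" d] tan_shift [of "V p / 2 - U y / 2" "- d"] P
    by (simp_all only: sin_minus cos_minus less_imp_neq [symmetric] simp_thms)
  have "arctan (tan (U p / 2 - V y / 2)) = U p / 2 - V y / 2" "arctan (tan (V p / 2 - U y / 2)) = V p / 2 - U y / 2"
    using assms unfolding M_def by (intro arctan_tan; auto simp: abs_less_iff)+
  then have "ivU y (u y p) = U p" "ivV y (v y p) = V p"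
    unfolding ivU_def ivV_def 1 using P by simp_all
  then show ?thesis by (simp add: iv_def pt_UV)
qed

lemma iv_diff:
  assumes "0 < 1 + k\<^sup>2 / 4 * ((s * a) * (s * b))"
  shows "(\<lambda>s. iv y (s * a) (s * b)) differentiable (at s)"
proof -
  let ?d = "U y / 2 - V y / 2"
  have c: "cos ?d \<noteq> 0" using cos_half [OF strip [of y]] by simp
  have d1: "\<exists>D. ((\<lambda>s. ivU y (s * a)) has_real_derivative D) (at s)"
  proof -
    have "((\<lambda>s. (k / 2 * (s * a) + sin ?d) / cos ?d) has_real_derivative k / 2 * a / cos ?d) (at s)"
      using c by (auto intro!: derivative_eq_intros)
    then show ?thesis unfolding ivU_def by (rule arctan_affine_deriv)
  qed
  have d2: "\<exists>D. ((\<lambda>s. ivV y (s * b)) has_real_derivative D) (at s)"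
  proof -
    have "((\<lambda>s. (k / 2 * (s * b) - sin ?d) / cos ?d) has_real_derivative k / 2 * b / cos ?d) (at s)"
      using c by (auto intro!: derivative_eq_intros)
    then show ?thesis unfolding ivV_def by (rule arctan_affine_deriv)
  qed
  obtain D1 D2 where D: "((\<lambda>s. ivU y (s * a)) has_real_derivative D1) (at s)" "((\<lambda>s. ivV y (s * b)) has_real_derivative D2) (at s)"
    using d1 d2 by blast
  have "0 < cos (ivU y (s * a) / 2 - ivV y (s * b) / 2)" by (rule cos_half [OF iv_strip [OF assms]])
  then have nz: "cos ((ivU y (s * a) - ivV y (s * b)) / 2) \<noteq> 0" by (simp add: diff_divide_distrib)
  have "((\<lambda>s. (ivU y (s * a) - ivV y (s * b)) / 2) has_real_derivative (D1 - D2) / 2) (at s)"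
    by (intro DERIV_cdivide DERIV_diff D)
  from DERIV_cdivide [OF DERIV_chain2 [OF arsinh_real_has_field_derivative DERIV_chain2 [OF DERIV_tan [OF nz] this]], of k]
  have "\<exists>D. ((\<lambda>s. arsinh (tan ((ivU y (s * a) - ivV y (s * b)) / 2)) / k) has_real_derivative D) (at s)"
    by (rule exI)
  moreover have "((\<lambda>s. (ivU y (s * a) + ivV y (s * b)) / (2 * k)) has_real_derivative (D1 + D2) / (2 * k)) (at s)"
    by (intro DERIV_cdivide DERIV_add D)
  ultimately show ?thesis
    unfolding iv_def pt_def
    by (intro differentiable_Pair) (auto simp: real_differentiable_def)
qed

lemma charts: "null_charts (k\<^sup>2 / 4) M u v A B iv (\<lambda>p. cosh (k * snd p)) (\<lambda>p. 1) U V"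
proof (unfold_locales, goal_cases)
  case (3) show ?case by (intro continuous_intros)
next
  case 4 show ?case by (intro continuous_intros)
next
  case (5 y) show ?case using strip [of y] by (auto simp: M_def)
next
  case (8 y p) show ?case unfolding conf [OF 8 8] using chart_cos [OF 8] by simp
next
  case (9 y p) show ?case unfolding A_def using chart_cos [OF 9] by simp
next
  case (10 y p) show ?case unfolding B_def using chart_cos [OF 10] by simp
next
  case (11 y p) show ?case unfolding conf [OF 11 11] A_def B_def using chart_cos [OF 11]
    by (simp add: power2_eq_square)
next
  case (23 y p) then show ?case by (rule moebius)
qed (use chart_cont u_deriv iv iv_uv iv_diff moebius u_le_iff in \<open>auto simp: u_def v_def\<close>)

end

lemma continuous_on_tendsto_left:
  fixes X :: "real \<Rightarrow> real"
  assumes "continuous_on {0..1} X" "0 < s0" "s0 \<le> 1"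
  shows "(X \<longlongrightarrow> X s0) (at s0 within {0..<s0})"
proof (rule tendsto_within_subset)
  show "(X \<longlongrightarrow> X s0) (at s0 within {0..1})" using assms by (simp add: continuous_on_def)
qed (use assms in auto)

text \<open>
  At the first exit \<open>X s0 - q = pi\<close> the tangent in one null coordinate has a pole. The other
  factor of the product stays bounded away from zero, since \<open>\<bar>p - q\<bar> < pi\<close> and \<open>X s0 - Y s0 < pi\<close>
  force \<open>q < Y s0\<close>. Hence the product of the null coordinates is unbounded before \<open>s0\<close>.
\<close>

lemma chart_exit_aux:
  fixes X Y :: "real \<Rightarrow> real"
  assumes cont: "continuous_on {0..1} X" "continuous_on {0..1} Y"
    and s0: "0 < s0" "s0 \<le> 1"
    and strip: "X s0 - Y s0 < pi" "\<bar>p - q\<bar> < pi"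
    and exit: "X s0 - q = pi" "Y s0 - p \<le> pi"
    and before: "\<And>s. 0 \<le> s \<Longrightarrow> s < s0 \<Longrightarrow> \<bar>X s - q\<bar> < pi \<and> \<bar>Y s - p\<bar> < pi \<and> p \<le> X s \<and> q \<le> Y s"
  shows "\<exists>s. 0 \<le> s \<and> s < s0 \<and> R < sin (X s / 2 - p / 2) / cos (X s / 2 - q / 2) * (sin (Y s / 2 - q / 2) / cos (Y s / 2 - p / 2))"
proof -
  define F where "F = at s0 within {0..<s0}"
  have "s0 islimpt {0..<s0}" using s0 by (simp add: islimpt_Ico)
  then have F: "F \<noteq> bot" by (simp add: F_def trivial_limit_within)
  have lim: "(X \<longlongrightarrow> X s0) F" "(Y \<longlongrightarrow> Y s0) F"
    unfolding F_def by (rule continuous_on_tendsto_left [OF cont(1) s0] continuous_on_tendsto_left [OF cont(2) s0])+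
  have ev: "eventually (\<lambda>s. 0 \<le> s \<and> s < s0) F"
    unfolding F_def eventually_at_filter by (auto intro: always_eventually)
  let ?n = "\<lambda>s. sin (X s / 2 - p / 2) * sin (Y s / 2 - q / 2)"
  let ?d = "\<lambda>s. cos (X s / 2 - q / 2)"
  have n: "(?n \<longlongrightarrow> ?n s0) F" by (intro tendsto_intros lim) auto
  have "(?d \<longlongrightarrow> ?d s0) F" by (intro tendsto_intros lim) auto
  moreover have "X s0 / 2 - q / 2 = pi / 2" using exit by simp
  ultimately have d: "(?d \<longlongrightarrow> 0) F" by simp
  have "0 < sin (X s0 / 2 - p / 2)" "0 < sin (Y s0 / 2 - q / 2)"
    using exit strip by (auto intro!: sin_gt_zero simp: abs_less_iff)
  then have n0: "0 < ?n s0" by simp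
  have dpos: "eventually (\<lambda>s. 0 < ?d s) F"
    using ev
  proof eventually_elim
    case (elim s)
    then have "\<bar>X s - q\<bar> < pi" using before by blast
    then show ?case by (intro cos_gt_zero_pi) (auto simp: abs_less_iff)
  qed
  have "LIM s F. ?n s / ?d s :> at_top"
    by (rule LIM_at_top_divide [OF n n0 d dpos])
  then have "eventually (\<lambda>s. \<bar>R\<bar> < ?n s / ?d s) F" by (simp add: filterlim_at_top_dense)
  then have "eventually (\<lambda>s. 0 \<le> s \<and> s < s0 \<and> \<bar>R\<bar> < ?n s / ?d s) F" using ev by eventually_elim auto
  then obtain s where s: "0 \<le> s" "s < s0" "\<bar>R\<bar> < ?n s / ?d s"
    using eventually_happens F by blast
  have c: "0 < cos (Y s / 2 - p / 2)" "cos (Y s / 2 - p / 2) \<le> 1"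
    using before [OF s(1,2)] by (auto intro!: cos_gt_zero_pi simp: abs_less_iff)
  define w where "w = ?n s / ?d s"
  have w: "\<bar>R\<bar> < w" using s(3) by (simp only: w_def)
  then have "0 \<le> w" using abs_ge_zero [of R] by linarith
  with c(2) have "w * cos (Y s / 2 - p / 2) \<le> w" by (rule mult_left_le)
  then have "w \<le> w / cos (Y s / 2 - p / 2)" using c(1) by (simp only: pos_le_divide_eq)
  then have "R < w / cos (Y s / 2 - p / 2)" using w abs_ge_self [of R] by linarith
  also have "\<dots> = sin (X s / 2 - p / 2) / cos (X s / 2 - q / 2) * (sin (Y s / 2 - q / 2) / cos (Y s / 2 - p / 2))"
    unfolding w_def by (simp only: times_divide_times_eq divide_divide_eq_left)
  finally show ?thesis using s(1,2) by blast
qed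

context ads
begin

lemma between:
  assumes "M p q" "U p \<le> U m" "U m \<le> U q" "V p \<le> V m" "V m \<le> V q"
  shows "M p m"
  using assms strip [of p] unfolding M_def by (auto simp: abs_less_iff)

text \<open>
  A future-directed causal curve can cross only the future boundary of the chart. It does so
  through one of the two null sides, and both cases are symmetric in \<open>U\<close> and \<open>V\<close>.
\<close>

lemma exit:
  fixes c :: "real \<Rightarrow> point"
  assumes c: "continuous_on {0..1} c" "c 0 = p"
    and mono: "mono_on {0..1} (\<lambda>s. U (c s))" "mono_on {0..1} (\<lambda>s. V (c s))"
    and out: "\<not> M p (c 1)"
  shows "\<exists>s\<in>{0..1}. M p (c s) \<and> R < u p (c s) * v p (c s)"
proof -
  define X where "X s = U (c s)" for s
  define Y where "Y s = V (c s)" for s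
  have X: "continuous_on {0..1} X" and Y: "continuous_on {0..1} Y"
    unfolding X_def [abs_def] Y_def [abs_def]
    by (rule continuous_on_compose2 [OF UV_cont(1) [of UNIV] c(1)] continuous_on_compose2 [OF UV_cont(2) [of UNIV] c(1)], simp)+
  have ge: "U p \<le> X s" "V p \<le> Y s" if "s \<in> {0..1}" for s
    using mono_onD [OF mono(1), of 0 s] mono_onD [OF mono(2), of 0 s] that c(2) by (auto simp: X_def Y_def)
  have strp: "\<bar>X s - Y s\<bar> < pi" "\<bar>U p - V p\<bar> < pi" for s using strip unfolding X_def Y_def by auto
  have Miff: "M p (c s) \<longleftrightarrow> X s - V p < pi \<and> Y s - U p < pi" if "s \<in> {0..1}" for s
    using ge [OF that] strp(2) unfolding M_def X_def Y_def by (auto simp: abs_less_iff)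
  define Z where "Z = {s \<in> {0..1}. pi \<le> max (X s - V p) (Y s - U p)}"
  have "Z = {0..1} \<inter> {s \<in> {0..1}. pi \<le> max (X s - V p) (Y s - U p)}" by (auto simp: Z_def)
  moreover have "closed {s \<in> {0..1}. pi \<le> max (X s - V p) (Y s - U p)}"
    by (intro continuous_on_closed_Collect_le continuous_on_const continuous_on_max continuous_on_diff X Y) auto
  ultimately have "compact Z" by (metis compact_Int_closed compact_Icc)
  moreover have "1 \<in> Z" using out Miff [of 1] by (auto simp: Z_def)
  ultimately obtain s0 where s0: "s0 \<in> Z" "\<And>s. s \<in> Z \<Longrightarrow> s0 \<le> s"
    using compact_attains_inf [of Z] by blast
  have M0: "M p (c s)" if "0 \<le> s" "s < s0" for s
  proof -
    have "s \<notin> Z" using s0(2) [of s] that by auto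
    then show ?thesis using Miff [of s] s0(1) that by (auto simp: Z_def)
  qed
  have s01: "0 \<le> s0" "s0 \<le> 1" "pi \<le> X s0 - V p \<or> pi \<le> Y s0 - U p" using s0(1) by (auto simp: Z_def)
  have "X 0 = U p" "Y 0 = V p" by (simp_all add: X_def Y_def c)
  then have "s0 \<noteq> 0" using s01(3) strp(2) by (auto simp: abs_less_iff)
  then have s0pos: "0 < s0" using s01 by simp
  \<comment> \<open>The bounds of the chart persist in the limit, though not strictly, so the exit is through equality.\<close>
  define F where "F = at s0 within {0..<s0}"
  have "s0 islimpt {0..<s0}" using s0pos by (simp add: islimpt_Ico)
  then have F: "F \<noteq> bot" by (simp add: F_def trivial_limit_within)
  have lim: "(X \<longlongrightarrow> X s0) F" "(Y \<longlongrightarrow> Y s0) F"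
    unfolding F_def
    by (rule continuous_on_tendsto_left [OF X s0pos s01(2)] continuous_on_tendsto_left [OF Y s0pos s01(2)])+
  have ev: "eventually (\<lambda>s. 0 \<le> s \<and> s < s0) F"
    unfolding F_def eventually_at_filter by (auto intro: always_eventually)
  have "eventually (\<lambda>s. X s \<le> V p + pi) F" "eventually (\<lambda>s. Y s \<le> U p + pi) F"
    using ev by (eventually_elim; use M0 Miff s01 in force)+
  then have le: "X s0 \<le> V p + pi" "Y s0 \<le> U p + pi"
    using tendsto_upperbound [OF lim(1) _ F] tendsto_upperbound [OF lim(2) _ F] by auto
  have before: "\<bar>X s - V p\<bar> < pi \<and> \<bar>Y s - U p\<bar> < pi \<and> U p \<le> X s \<and> V p \<le> Y s" if "0 \<le> s" "s < s0" for s
    using M0 [OF that] ge [of s] that s01 by (auto simp: M_def X_def Y_def)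
  have "\<exists>s. 0 \<le> s \<and> s < s0 \<and> R * k\<^sup>2 / 4 < sin (X s / 2 - U p / 2) / cos (X s / 2 - V p / 2) * (sin (Y s / 2 - V p / 2) / cos (Y s / 2 - U p / 2))"
  proof (cases "pi \<le> X s0 - V p")
    case True
    show ?thesis
      by (rule chart_exit_aux [OF X Y s0pos s01(2)]) (use True le strp before in \<open>auto simp: abs_less_iff\<close>)
  next
    case False
    have "\<exists>s. 0 \<le> s \<and> s < s0 \<and> R * k\<^sup>2 / 4 < sin (Y s / 2 - V p / 2) / cos (Y s / 2 - U p / 2) * (sin (X s / 2 - U p / 2) / cos (X s / 2 - V p / 2))"
      by (rule chart_exit_aux [OF Y X s0pos s01(2)]) (use False s01(3) le strp(1) [of s0] strp(2) before in \<open>auto simp: abs_less_iff\<close>)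
    then show ?thesis by (simp add: mult.commute)
  qed
  then obtain s where s: "0 \<le> s" "s < s0"
    "R * k\<^sup>2 / 4 < sin (X s / 2 - U p / 2) / cos (X s / 2 - V p / 2) * (sin (Y s / 2 - V p / 2) / cos (Y s / 2 - U p / 2))" by blast
  have eq: "u p (c s) * v p (c s) = 4 / k\<^sup>2 * (sin (X s / 2 - U p / 2) / cos (X s / 2 - V p / 2) * (sin (Y s / 2 - V p / 2) / cos (Y s / 2 - U p / 2)))"
    by (simp add: u_def v_def X_def Y_def power2_eq_square)
  have "0 < 4 / k\<^sup>2" using k by simp
  from mult_strict_left_mono [OF s(3) this] have "R < u p (c s) * v p (c s)" unfolding eq using k by simp
  moreover have "s \<in> {0..1}" using s(1,2) s01(2) by simp
  ultimately show ?thesis using M0 [OF s(1,2)] by blast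
qed

lemma model_charts:
  "model_null_charts (k\<^sup>2 / 4) M u v A B iv (\<lambda>p. cosh (k * snd p)) (\<lambda>p. 1) U V (k\<^sup>2) (\<lambda>p. k * cos (U p / 2 - V p / 2))"
proof (intro model_null_charts.intro charts model_null_charts_axioms.intro, goal_cases)
  case (2 p a b) show ?case using k by (simp add: model_metric_def)
next
  case (3 p) show ?case using k cos_half [OF strip [of p]] by simp
next
  case 4 show ?case by (rule UV_cont)
next
  case 5 show ?case by (rule UV_cont)
next
  case 6 then show ?case by (rule U_deriv)
next
  case 7 then show ?case by (rule U_deriv)
next
  case 8 then show ?case by (rule between)
next
  case (9 c p) then show ?case using exit [of c p] k by simp
qed simp

end

section \<open>De Sitter space by exchanging time and space\<close>

abbreviation (input) sw :: "point \<Rightarrow> point" where "sw p \<equiv> (snd p, fst p)"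

lemma has_vector_derivative_swap:
  assumes "(c has_vector_derivative c') (at s within T)"
  shows "((\<lambda>s. sw (c s)) has_vector_derivative sw c') (at s within T)"
  using has_vector_derivative_Pair [OF has_vector_derivative_fst_snd(2) [OF assms] has_vector_derivative_fst_snd(1) [OF assms]] .

lemma continuous_on_swap: "continuous_on S f \<Longrightarrow> (\<And>p. p \<in> T \<Longrightarrow> sw p \<in> S) \<Longrightarrow> continuous_on T (\<lambda>p. f (sw p))"
  for f :: "point \<Rightarrow> real"
  by (rule continuous_on_compose2 [of S f T sw]) (auto intro!: continuous_on_Pair continuous_on_fst continuous_on_snd continuous_on_id)

text \<open>
  Exchanging the coordinates changes the sign of the metric and of the curvature. Changing in
  addition the sign of \<open>v\<close> restores the form \<open>du dv / (1 + \<kappa> u v)\<^sup>2\<close> with \<open>- \<kappa>\<close> for \<open>\<kappa>\<close>, and the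
  Moebius map is unaffected. Only the causal axioms of the charts distinguish time from space.
\<close>

lemma null_charts_swap:
  assumes "null_charts \<kappa> M u v A B iv h1 h2 gU gV"
  shows "null_charts (- \<kappa>) (\<lambda>y p. M (sw y) (sw p)) (\<lambda>y p. u (sw y) (sw p)) (\<lambda>y p. - v (sw y) (sw p))
     (\<lambda>y p. A (sw y) (sw p)) (\<lambda>y p. B (sw y) (sw p)) (\<lambda>y a b. sw (iv (sw y) a (- b)))
     (\<lambda>p. h2 (sw p)) (\<lambda>p. h1 (sw p)) (\<lambda>p. gU (sw p)) (\<lambda>p. - gV (sw p))"
proof -
  interpret null_charts \<kappa> M u v A B iv h1 h2 gU gV by fact
  show ?thesis
  proof (unfold_locales, goal_cases)
    case 3 show ?case by (rule continuous_on_swap [OF h_cont(2)]) simp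
  next
    case 4 show ?case by (rule continuous_on_swap [OF h_cont(1)]) simp
  next
    case (8 y p) then show ?case using conf_pos by simp
  next
    case (11 y p) then show ?case using AB_mult by simp
  next
    case 12 show ?case by (rule continuous_on_swap [OF AB_cont(1)]) simp
  next
    case 13 show ?case by (rule continuous_on_swap [OF AB_cont(2)]) simp
  next
    case 14 show ?case by (rule continuous_on_swap [OF uv_cont(1)]) simp
  next
    case 15 show ?case by (intro continuous_on_minus continuous_on_swap [OF uv_cont(2)]) simp
  next
    case (16 y c s c' T)
    from u_deriv [of "sw y" "\<lambda>s. sw (c s)", OF 16(1) has_vector_derivative_swap [OF 16(2)]]
    show ?case by (simp add: add.commute)
  next
    case (17 y c s c' T)
    from DERIV_minus [OF v_deriv [of "sw y" "\<lambda>s. sw (c s)", OF 17(1) has_vector_derivative_swap [OF 17(2)]]]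
    show ?case by (simp add: right_diff_distrib)
  next
    case (18 a b y) then show ?case using iv(1) [of a "- b" "sw y"] by simp
  next
    case (19 a b y) then show ?case using iv(2) [of a "- b" "sw y"] by simp
  next
    case (20 a b y) then show ?case using iv(3) [of a "- b" "sw y"] by simp
  next
    case (21 y p) then show ?case using iv_uv [of "sw y" "sw p"] by simp
  next
    case (22 s a b y)
    from 22 have "0 < 1 + \<kappa> * ((s * a) * (s * - b))" by simp
    from iv_diff [OF this, of "sw y"] obtain D where "((\<lambda>s. iv (sw y) (s * a) (s * - b)) has_vector_derivative D) (at s)"
      using vector_derivative_works by blast
    from has_vector_derivative_swap [OF this] show ?case
      by (simp add: differentiableI_vector)
  next
    case (23 y p)
    from moebius [OF 23] obtain \<rho> where \<rho>: "0 < \<rho>" "\<And>q. M (sw y) q \<Longrightarrow> 0 < 1 + \<kappa> * (u (sw y) q * v (sw y) (sw p)) \<Longrightarrow> 0 < 1 + \<kappa> * (u (sw y) (sw p) * v (sw y) q) \<Longrightarrow>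
        M (sw p) q \<and> u (sw p) q = \<rho> * ((u (sw y) q - u (sw y) (sw p)) / (1 + \<kappa> * (u (sw y) q * v (sw y) (sw p))))
              \<and> v (sw p) q = (v (sw y) q - v (sw y) (sw p)) / (1 + \<kappa> * (u (sw y) (sw p) * v (sw y) q)) / \<rho>"
      by blast
    show ?case
      by (intro exI [of _ \<rho>] conjI allI impI \<rho>(1)) (use \<rho>(2) in \<open>auto simp: minus_divide_left [symmetric] diff_divide_distrib\<close>)
  next
    case (24 y p q) then show ?case by (simp add: u_le_iff)
  next
    case (25 y p q) then show ?case by (simp add: v_le_iff)
  qed (use h_pos centre AB_pos in auto)
qed

context ads
begin

text \<open>
  Causal futures in de Sitter space stay in the chart: to the future the first null coordinate of
  the exchanged plane increases and the second decreases, and then the strip conditions at both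
  points imply those that define the domain.
\<close>

lemma swapped_model_charts:
  "model_null_charts (- (k\<^sup>2 / 4)) (\<lambda>y p. M (sw y) (sw p)) (\<lambda>y p. u (sw y) (sw p)) (\<lambda>y p. - v (sw y) (sw p))
     (\<lambda>y p. A (sw y) (sw p)) (\<lambda>y p. B (sw y) (sw p)) (\<lambda>y a b. sw (iv (sw y) a (- b)))
     (\<lambda>p. 1) (\<lambda>p. cosh (k * fst p)) (\<lambda>p. U (sw p)) (\<lambda>p. - V (sw p)) (- (k\<^sup>2))
     (\<lambda>p. k * cos (U (sw p) / 2 - V (sw p) / 2))"
proof (intro model_null_charts.intro model_null_charts_axioms.intro, goal_cases)
  case 1 show ?case using null_charts_swap [OF charts] by simp
next
  case (3 p a b) show ?case using k by (simp add: model_metric_def)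
next
  case (4 p) show ?case using k cos_half [OF strip [of "sw p"]] by simp
next
  case 5 show ?case by (rule continuous_on_swap [OF UV_cont(1) [of UNIV]]) simp
next
  case 6 show ?case by (intro continuous_on_minus continuous_on_swap [OF UV_cont(2) [of UNIV]]) simp
next
  case (7 c c' s)
  from U_deriv(1) [OF has_vector_derivative_swap [OF 7]] show ?case by (simp add: add.commute)
next
  case (8 c c' s)
  from DERIV_minus [OF U_deriv(2) [OF has_vector_derivative_swap [OF 8]]] show ?case by (simp add: right_diff_distrib)
next
  case (9 p q m)
  then show ?case using strip [of "sw p"] strip [of "sw m"] unfolding M_def by (auto simp: abs_less_iff)
next
  case (10 c p)
  have "U (sw p) \<le> U (sw (c 1))" "- V (sw p) \<le> - V (sw (c 1))"
    using 10(2,3,4) unfolding mono_on_def by (metis atLeastAtMost_iff order_refl zero_le_one)+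
  then have "M (sw p) (sw (c 1))"
    using strip [of "sw p"] strip [of "sw (c 1)"] unfolding M_def by (auto simp: abs_less_iff)
  then show ?case using 10(5) by blast
qed simp

end

lemma model_charts_exist:
  obtains M u v A B iv h1 h2 gU gV G where "model_null_charts (K / 4) M u v A B iv h1 h2 gU gV K G"
proof -
  consider "K = 0" | "K > 0" | "K < 0" by linarith
  then show ?thesis
  proof cases
    case 1 show ?thesis using that [unfolded 1] flat_charts by simp
  next
    case 2
    then interpret ads "sqrt K" by unfold_locales simp
    show ?thesis using that model_charts 2 by simp
  next
    case 3
    then interpret ads "sqrt (- K)" by unfold_locales simp
    show ?thesis using that swapped_model_charts 3 by simp
  qed
qed

section \<open>Hinges of small angle\<close>

lemma radial_length_surj:
  assumes "0 < a" "0 < 1 + k * a\<^sup>2" "0 < d" "d \<le> radial_length k a"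
  obtains r where "0 < r" "r \<le> a" "radial_length k r = d" "0 < 1 + k * r\<^sup>2"
proof -
  have conf: "0 < 1 + k * r\<^sup>2" if "0 \<le> r" "r \<le> a" for r
    using that assms by (intro pos_of_le [OF _ _ assms(2)] power_mono) auto
  have "continuous_on {0..a} (radial_length k)"
    using conf by (intro continuous_at_imp_continuous_on ballI DERIV_isCont [OF radial_length_deriv]) auto
  then obtain r where r: "0 \<le> r" "r \<le> a" "radial_length k r = d"
    using IVT' [of "radial_length k" 0 d a] assms by auto
  then have "r \<noteq> 0" using assms by auto
  then show ?thesis using that [of r] r conf by auto
qed

lemma small_conformal_factor:
  fixes k a :: real
  assumes "\<bar>k\<bar> * a\<^sup>2 \<le> 1/4"
  shows "3/4 \<le> 1 + k * a\<^sup>2" "1 + k * a\<^sup>2 \<le> 5/4"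
proof -
  have "\<bar>k * a\<^sup>2\<bar> \<le> 1/4" using assms by (simp add: abs_mult)
  then show "3/4 \<le> 1 + k * a\<^sup>2" "1 + k * a\<^sup>2 \<le> 5/4" by linarith+
qed

text \<open>
  For small \<open>k r\<^sup>2\<close> the derivative of the radial length lies between \<open>4/5\<close> and \<open>4/3\<close>.
\<close>

lemma radial_length_diff_bounds:
  assumes "0 \<le> x" "x \<le> y" "\<bar>k\<bar> * y\<^sup>2 \<le> 1/4"
  shows "4/5 * (y - x) \<le> radial_length k y - radial_length k x"
    "radial_length k y - radial_length k x \<le> 4/3 * (y - x)"
proof -
  have sm: "\<bar>k\<bar> * z\<^sup>2 \<le> 1/4" if "x \<le> z" "z \<le> y" for z
  proof -
    have "z\<^sup>2 \<le> y\<^sup>2" using that assms(1) by (intro power_mono) auto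
    then have "\<bar>k\<bar> * z\<^sup>2 \<le> \<bar>k\<bar> * y\<^sup>2" by (rule mult_left_mono) simp
    then show ?thesis using assms(3) by linarith
  qed
  show "4/5 * (y - x) \<le> radial_length k y - radial_length k x"
    "radial_length k y - radial_length k x \<le> 4/3 * (y - x)"
  proof (atomize (full), cases "x = y")
    case False
    then have "x < y" using assms by simp
    then obtain z where z: "x < z" "z < y" "radial_length k y - radial_length k x = (y - x) * (1 / (1 + k * z\<^sup>2))"
      using MVT2 [OF _ radial_length_deriv, of x y k] small_conformal_factor(1) [OF sm] by fastforce
    have b: "3/4 \<le> 1 + k * z\<^sup>2" "1 + k * z\<^sup>2 \<le> 5/4" using small_conformal_factor [OF sm, of z] z by auto
    then have "4/5 \<le> 1 / (1 + k * z\<^sup>2)" "1 / (1 + k * z\<^sup>2) \<le> 4/3" by (auto simp: field_simps)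
    then have "(y - x) * (4/5) \<le> (y - x) * (1 / (1 + k * z\<^sup>2))" "(y - x) * (1 / (1 + k * z\<^sup>2)) \<le> (y - x) * (4/3)"
      using \<open>x < y\<close> by (intro mult_left_mono; simp)+
    then show "4/5 * (y - x) \<le> radial_length k y - radial_length k x \<and> radial_length k y - radial_length k x \<le> 4/3 * (y - x)"
      unfolding z(3) by (simp add: mult.commute)
  qed simp
qed

lemma hinge_law_mono:
  assumes "0 < a" "0 < b" "0 < 1 + k * a\<^sup>2" "0 < 1 + k * b\<^sup>2" "0 \<le> c" "c \<le> d" "0 < 1 + k * d\<^sup>2"
  shows "hinge_law k a b c \<le> hinge_law k a b d"
proof -
  have "c\<^sup>2 \<le> d\<^sup>2" using assms by (intro power_mono)
  then have "0 < 1 + k * c\<^sup>2" using assms by (intro pos_of_le [OF _ _ assms(7)]) auto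
  then have "c\<^sup>2 / (1 + k * c\<^sup>2) \<le> d\<^sup>2 / (1 + k * d\<^sup>2)"
    using assms(7) \<open>c\<^sup>2 \<le> d\<^sup>2\<close> by (simp add: divide_le_eq pos_le_divide_eq field_simps)
  then have "c\<^sup>2 / (1 + k * c\<^sup>2) * ((1 + k * a\<^sup>2) * (1 + k * b\<^sup>2)) \<le> d\<^sup>2 / (1 + k * d\<^sup>2) * ((1 + k * a\<^sup>2) * (1 + k * b\<^sup>2))"
    using assms by (intro mult_right_mono) auto
  then show ?thesis
    unfolding hinge_law_def using assms by (intro divide_right_mono diff_right_mono) auto
qed

text \<open>
  A straight hinge has third side of length \<open>a + b\<close>, measured by radial length, and angle zero.
  Its radial parameter is the sum \<open>t\<close> of \<open>a\<close> and \<open>b\<close> under the addition theorem. The law of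
  cosines equates \<open>2 a b (hinge_law - 1)\<close> with a multiple, bounded below, of \<open>c\<^sup>2 - t\<^sup>2\<close>. As
  \<open>2 a b\<close> is at most of the order of \<open>c\<^sup>2\<close>, the defect \<open>c - t\<close> is controlled by
  \<open>(hinge_law - 1) c\<close>; this linear dependence on \<open>c\<close> is what makes the estimate summable.
\<close>

lemma hinge_law_bounds:
  assumes ab: "0 < a" "0 < b" "0 < c"
    and small: "\<bar>k\<bar> * a\<^sup>2 \<le> 1/4" "\<bar>k\<bar> * b\<^sup>2 \<le> 1/4" "\<bar>k\<bar> * c\<^sup>2 \<le> 1/4"
    and tri: "radial_length k a + radial_length k b \<le> radial_length k c"
  shows "1 \<le> hinge_law k a b c"
    "radial_length k c - (radial_length k a + radial_length k b) \<le> 4 * (hinge_law k a b c - 1) * radial_length k c"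
proof -
  note ca = small_conformal_factor [OF small(1)] and cb = small_conformal_factor [OF small(2)]
    and cc = small_conformal_factor [OF small(3)]
  define P where "P = (1 + k * a\<^sup>2) * (1 + k * b\<^sup>2)"
  have P0: "0 < P" unfolding P_def using ca cb by (intro mult_pos_pos) auto
  have "2 * (a * b) \<le> a\<^sup>2 + b\<^sup>2" using zero_le_power2 [of "a - b"] by (simp add: power2_eq_square algebra_simps)
  then have "\<bar>k\<bar> * (2 * (a * b)) \<le> \<bar>k\<bar> * (a\<^sup>2 + b\<^sup>2)" by (rule mult_left_mono) simp
  then have "\<bar>k\<bar> * (a * b) \<le> 1/4" using small by (simp add: distrib_left)
  moreover have "\<bar>k * (a * b)\<bar> = \<bar>k\<bar> * (a * b)" using ab by (simp add: abs_mult)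
  ultimately have kab: "3/4 \<le> 1 - k * (a * b)" "1 - k * (a * b) \<le> 5/4" by linarith+
  \<comment> \<open>\<open>t\<close> is the radial parameter of the straight concatenation of the two sides.\<close>
  define t where "t = (a + b) / (1 - k * (a * b))"
  have t0: "0 < t" unfolding t_def using ab kab by simp
  have tP: "1 + k * t\<^sup>2 = P / (1 - k * (a * b))\<^sup>2"
  proof -
    have "1 + k * t\<^sup>2 = ((1 - k * (a * b))\<^sup>2 + k * (a + b)\<^sup>2) / (1 - k * (a * b))\<^sup>2"
      unfolding t_def power_divide using kab by (simp add: add_divide_distrib)
    also have "(1 - k * (a * b))\<^sup>2 + k * (a + b)\<^sup>2 = P"
      by (simp add: P_def power2_eq_square algebra_simps)
    finally show ?thesis .
  qed
  have t1: "0 < 1 + k * t\<^sup>2" unfolding tP using P0 kab by simp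
  have at: "a \<le> t"
  proof -
    have "0 \<le> b * (1 + k * a\<^sup>2)" using ab ca by simp
    then have "a * (1 - k * (a * b)) \<le> a + b" by (simp add: power2_eq_square algebra_simps)
    then show ?thesis unfolding t_def using kab by (simp add: pos_le_divide_eq)
  qed
  have "(t - a) / (1 + k * a * t) = b"
  proof -
    have d: "1 + k * a * t = (1 + k * a\<^sup>2) / (1 - k * (a * b))"
      unfolding t_def using kab by (simp add: power2_eq_square field_simps)
    have n: "t - a = b * (1 + k * a\<^sup>2) / (1 - k * (a * b))"
      unfolding t_def using kab by (simp add: power2_eq_square field_simps)
    show ?thesis unfolding d n using kab ca by simp
  qed
  then have rt: "radial_length k t = radial_length k a + radial_length k b"
    using radial_length_diff [OF less_imp_le [OF ab(1)] at t1] by simp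
  then have tc: "t \<le> c"
    using tri ab t0 t1 cc by (subst radial_length_le_iff [of t c k, symmetric]) auto
  have "(a + b)\<^sup>2 = t\<^sup>2 * (1 - k * (a * b))\<^sup>2" unfolding t_def using kab by (simp add: power_divide)
  also have "\<dots> = t\<^sup>2 / (1 + k * t\<^sup>2) * P" unfolding tP using P0 kab by simp
  finally have sq: "(a + b)\<^sup>2 = t\<^sup>2 / (1 + k * t\<^sup>2) * P" .
  have "2 * a * b * (hinge_law k a b c - 1) = c\<^sup>2 / (1 + k * c\<^sup>2) * P - (a + b)\<^sup>2"
  proof -
    have gen: "2 * a * b * (x / (2 * a * b) - 1) = x - 2 * a * b" for x
      using ab by (simp add: right_diff_distrib)
    show ?thesis unfolding hinge_law_def P_def [symmetric] gen by (simp add: power2_eq_square algebra_simps)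
  qed
  also have "\<dots> = (c\<^sup>2 / (1 + k * c\<^sup>2) - t\<^sup>2 / (1 + k * t\<^sup>2)) * P" unfolding sq by (simp add: left_diff_distrib)
  also have "c\<^sup>2 / (1 + k * c\<^sup>2) - t\<^sup>2 / (1 + k * t\<^sup>2) = (c\<^sup>2 - t\<^sup>2) / ((1 + k * c\<^sup>2) * (1 + k * t\<^sup>2))"
    using cc t1 by (simp add: diff_frac_eq) (simp add: algebra_simps)
  also have "\<dots> * P = (c\<^sup>2 - t\<^sup>2) * ((1 - k * (a * b))\<^sup>2 / (1 + k * c\<^sup>2))"
    unfolding tP using P0 kab by simp
  finally have law: "2 * a * b * (hinge_law k a b c - 1) = (c\<^sup>2 - t\<^sup>2) * ((1 - k * (a * b))\<^sup>2 / (1 + k * c\<^sup>2))" .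
  have ct: "0 \<le> c\<^sup>2 - t\<^sup>2" using tc t0 by (simp add: power_mono)
  have "0 \<le> 2 * a * b * (hinge_law k a b c - 1)" unfolding law using ct cc by (intro mult_nonneg_nonneg divide_nonneg_nonneg) auto
  moreover have "0 < 2 * a * b" using ab by simp
  moreover have "0 \<le> x" if "0 \<le> p * x" "0 < p" for p x :: real using that by (simp add: zero_le_mult_iff)
  ultimately have "0 \<le> hinge_law k a b c - 1" by blast
  then show h1: "1 \<le> hinge_law k a b c" by simp
  have "(3/4)\<^sup>2 \<le> (1 - k * (a * b))\<^sup>2" using kab by (intro power_mono) auto
  then have "(3/4)\<^sup>2 / (5/4) \<le> (1 - k * (a * b))\<^sup>2 / (1 + k * c\<^sup>2)" using cc by (intro frac_le) auto
  then have "(c\<^sup>2 - t\<^sup>2) * (9/20) \<le> 2 * a * b * (hinge_law k a b c - 1)"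
    unfolding law by (intro mult_left_mono [OF _ ct]) (simp add: power2_eq_square)
  moreover have "2 * a * b * (hinge_law k a b c - 1) \<le> 25/32 * c\<^sup>2 * (hinge_law k a b c - 1)"
  proof (rule mult_right_mono)
    have "a + b \<le> 5/4 * t"
    proof -
      have "a + b = t * (1 - k * (a * b))" unfolding t_def using kab by simp
      also have "\<dots> \<le> t * (5/4)" using t0 kab by (intro mult_left_mono) auto
      finally show ?thesis by simp
    qed
    then have "a + b \<le> 5/4 * c" using tc by simp
    then have "(a + b)\<^sup>2 \<le> (5/4 * c)\<^sup>2" using ab by (intro power_mono) auto
    moreover have "4 * (a * b) \<le> (a + b)\<^sup>2" using zero_le_power2 [of "a - b"] by (simp add: power2_eq_square algebra_simps)
    ultimately show "2 * a * b \<le> 25/32 * c\<^sup>2" by (simp add: power2_eq_square)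
  qed (use h1 in simp)
  ultimately have c2: "c\<^sup>2 - t\<^sup>2 \<le> 2 * (hinge_law k a b c - 1) * c\<^sup>2"
  proof -
    assume 1: "(c\<^sup>2 - t\<^sup>2) * (9/20) \<le> 2 * a * b * (hinge_law k a b c - 1)"
      and 2: "2 * a * b * (hinge_law k a b c - 1) \<le> 25/32 * c\<^sup>2 * (hinge_law k a b c - 1)"
    define Q where "Q = c\<^sup>2 * (hinge_law k a b c - 1)"
    have "0 \<le> Q" using h1 by (simp add: Q_def)
    moreover have "(c\<^sup>2 - t\<^sup>2) * (9/20) \<le> 25/32 * Q" using order.trans [OF 1 2] by (simp only: Q_def mult.assoc)
    ultimately have "c\<^sup>2 - t\<^sup>2 \<le> 2 * Q" by argo
    then show ?thesis by (simp only: Q_def mult_ac)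
  qed
  have "(c - t) * c \<le> (c - t) * (c + t)" using tc t0 by (intro mult_left_mono) auto
  also have "\<dots> = c\<^sup>2 - t\<^sup>2" by (simp add: power2_eq_square algebra_simps)
  finally have "(c - t) * c \<le> (2 * (hinge_law k a b c - 1) * c) * c" using c2 by (simp add: power2_eq_square mult.assoc)
  from mult_right_le_imp_le [OF this ab(3)]
  have 1: "c - t \<le> 2 * ((hinge_law k a b c - 1) * c)" by (simp only: mult.assoc)
  have 2: "radial_length k c - radial_length k t \<le> 4/3 * (c - t)"
    by (rule radial_length_diff_bounds(2)) (use t0 tc small in auto)
  have "(hinge_law k a b c - 1) * (4/5 * (c - 0)) \<le> (hinge_law k a b c - 1) * (radial_length k c - radial_length k 0)"
    by (intro mult_left_mono radial_length_diff_bounds(1)) (use ab small h1 in auto)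
  then have 3: "4/5 * ((hinge_law k a b c - 1) * c) \<le> (hinge_law k a b c - 1) * radial_length k c" by simp
  have "0 \<le> (hinge_law k a b c - 1) * radial_length k c"
    using h1 radial_length_nonneg [of c k] ab cc by simp
  with 1 2 3 have "radial_length k c - radial_length k t \<le> 4 * ((hinge_law k a b c - 1) * radial_length k c)" by argo
  then show "radial_length k c - (radial_length k a + radial_length k b) \<le> 4 * (hinge_law k a b c - 1) * radial_length k c"
    unfolding rt by (simp only: mult.assoc)
qed

lemma cosh_minus_one_le:
  fixes x :: real
  assumes "0 \<le> x" "x \<le> 1"
  shows "cosh x - 1 \<le> x"
proof -
  have "exp x \<le> 1 + x + x\<^sup>2" by (rule exp_bound [OF assms])
  moreover have "exp (- x) \<le> 1" using assms by simp
  moreover have "x\<^sup>2 \<le> x" using assms mult_left_mono [of x 1 x] by (simp add: power2_eq_square)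
  moreover have "2 * cosh x = exp x + exp (- x)" by (simp add: cosh_def)
  ultimately show ?thesis by linarith
qed

section \<open>Almost additive separations\<close>

text \<open>
  An almost additive \<open>d\<close> is bounded by its sums, although the number of summands is arbitrary. The
  interval is cut into the part up to the last point at distance at most \<open>D / 2\<close> from its
  beginning, where \<open>D\<close> is the value of \<open>d\<close> on the whole interval, the next single step, and the
  rest, which also has distance at most \<open>D / 2\<close> by the reverse triangle inequality. Two
  applications of \<open>key\<close> cost \<open>2 c R D\<close>. By induction the two long parts cost
  \<open>4 c (D / 2) (R1 + R2) \<le> 2 c R D\<close>, because \<open>R\<close> is superadditive. The factor \<open>1 / 2\<close> gained by
  halving makes the total \<open>4 c R D\<close> close the induction.
\<close>

lemma halving_bound:
  fixes d R :: "real \<Rightarrow> real \<Rightarrow> real" and w :: "nat \<Rightarrow> real"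
  assumes c: "0 \<le> c"
    and d: "\<And>s t. s \<in> S \<Longrightarrow> t \<in> S \<Longrightarrow> 0 \<le> d s t" "\<And>s. s \<in> S \<Longrightarrow> d s s = 0"
    and tri: "\<And>s m t. s \<in> S \<Longrightarrow> m \<in> S \<Longrightarrow> t \<in> S \<Longrightarrow> s \<le> m \<Longrightarrow> m \<le> t \<Longrightarrow> d s m + d m t \<le> d s t"
    and R: "\<And>s t. s \<in> S \<Longrightarrow> t \<in> S \<Longrightarrow> 0 \<le> R s t"
    and super: "\<And>s m t. s \<in> S \<Longrightarrow> m \<in> S \<Longrightarrow> t \<in> S \<Longrightarrow> s \<le> m \<Longrightarrow> m \<le> t \<Longrightarrow> R s m + R m t \<le> R s t"
    and key: "\<And>s m t. s \<in> S \<Longrightarrow> m \<in> S \<Longrightarrow> t \<in> S \<Longrightarrow> s < m \<Longrightarrow> m < t \<Longrightarrow> d s t \<le> d s m + d m t + c * R s t * d s t"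
    and w: "\<And>i. w i \<in> S" "mono w"
  shows "i \<le> j \<Longrightarrow> d (w i) (w j) * (1 - 4 * c * R (w i) (w j)) \<le> (\<Sum>l=i..<j. d (w l) (w (Suc l)))"
proof (induction "j - i" arbitrary: i j rule: less_induct)
  case less
  note wle = monoD [OF w(2)]
  let ?D = "d (w i) (w j)" and ?R = "R (w i) (w j)"
  have D0: "0 \<le> ?D" and R0: "0 \<le> ?R" using d R w by auto
  have key': "d (w p) (w r) \<le> d (w p) (w q) + d (w q) (w r) + c * R (w p) (w r) * d (w p) (w r)" if pq: "p \<le> q" "q \<le> r" for p q r
  proof -
    have "0 \<le> c * R (w p) (w r) * d (w p) (w r)" using c d R w by auto
    consider "w p = w q" | "w q = w r" | "w p < w q" "w q < w r"
      using wle [OF pq(1)] wle [OF pq(2)] by linarith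
    then show ?thesis
    proof cases
      case 1 then show ?thesis using d(2) [OF w(1), of q] \<open>0 \<le> c * R (w p) (w r) * d (w p) (w r)\<close> by simp
    next
      case 2 then show ?thesis using d(2) [OF w(1), of r] \<open>0 \<le> c * R (w p) (w r) * d (w p) (w r)\<close> by simp
    next
      case 3 then show ?thesis by (rule key [OF w(1) w(1) w(1)])
    qed
  qed
  show ?case
  proof (cases "?D = 0")
    case True
    have "0 \<le> (\<Sum>l=i..<j. d (w l) (w (Suc l)))" using d w by (intro sum_nonneg) auto
    then show ?thesis using True by simp
  next
    case False
    then have Dpos: "0 < ?D" using D0 by simp
    then have ij: "i < j" using less.prems d(2) [OF w(1)] by (metis le_neq_implies_less less_numeral_extra(3))
    \<comment> \<open>\<open>m\<close> is the last index whose point is at most half way from \<open>w i\<close>.\<close>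
    define A where "A = {l \<in> {i..j}. d (w i) (w l) \<le> ?D / 2}"
    have A: "finite A" "i \<in> A" using d(2) [OF w(1)] Dpos less.prems by (auto simp: A_def)
    define m where "m = Max A"
    have "m \<in> A" unfolding m_def using A by (intro Max_in) auto
    then have m: "i \<le> m" "m \<le> j" "d (w i) (w m) \<le> ?D / 2" by (auto simp: A_def)
    have "j \<notin> A" using Dpos by (auto simp: A_def)
    then have mj: "m < j" using m \<open>m \<in> A\<close> by (metis le_neq_implies_less)
    have "Suc m \<notin> A" using Max_ge [OF A(1), of "Suc m"] by (auto simp: m_def)
    then have far: "?D / 2 < d (w i) (w (Suc m))" using m mj by (auto simp: A_def)
    let ?d1 = "d (w i) (w m)" and ?dm = "d (w m) (w (Suc m))" and ?d2 = "d (w (Suc m)) (w j)"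
    let ?R1 = "R (w i) (w m)" and ?R2 = "R (w (Suc m)) (w j)"
    have ord: "w i \<le> w m" "w m \<le> w (Suc m)" "w (Suc m) \<le> w j" "w m \<le> w j" "w i \<le> w (Suc m)"
      using m mj by (auto intro!: wle)
    have "d (w i) (w (Suc m)) + ?d2 \<le> ?D" using tri [OF w(1) w(1) w(1)] ord by blast
    then have d2: "?d2 \<le> ?D / 2" using far by linarith
    have Rs: "?R1 + R (w m) (w j) \<le> ?R" "R (w m) (w (Suc m)) + ?R2 \<le> R (w m) (w j)"
      using super [OF w(1) w(1) w(1)] ord by blast+
    have R1: "0 \<le> ?R1" "0 \<le> ?R2" "0 \<le> R (w m) (w (Suc m))" "0 \<le> R (w m) (w j)" using R w by auto
    have dn: "0 \<le> ?d1" "0 \<le> ?d2" "0 \<le> ?dm" "0 \<le> d (w m) (w j)" using d w by auto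
    have "d (w m) (w j) \<le> ?D" using tri [OF w(1) w(1) w(1) ord(1,4)] dn by linarith
    then have "R (w m) (w j) * d (w m) (w j) \<le> ?R * ?D"
      using Rs R1 dn R0 by (intro mult_mono) auto
    then have "c * R (w m) (w j) * d (w m) (w j) \<le> c * ?R * ?D"
      using mult_left_mono [OF _ c] by (simp add: mult.assoc)
    then have split: "?D \<le> ?d1 + ?dm + ?d2 + 2 * (c * ?R * ?D)"
      using key' [OF m(1,2)] key' [of m "Suc m" j] mj by linarith
    have IH1: "?d1 * (1 - 4 * c * ?R1) \<le> (\<Sum>l=i..<m. d (w l) (w (Suc l)))"
      using mj m by (intro less.hyps) auto
    have IH2: "?d2 * (1 - 4 * c * ?R2) \<le> (\<Sum>l=Suc m..<j. d (w l) (w (Suc l)))"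
      using mj m by (intro less.hyps) auto
    have "{i..<j} = {i..<m} \<union> insert m {Suc m..<j}" using m mj by auto
    then have S: "(\<Sum>l=i..<j. d (w l) (w (Suc l))) = (\<Sum>l=i..<m. d (w l) (w (Suc l))) + (?dm + (\<Sum>l=Suc m..<j. d (w l) (w (Suc l))))"
      by (simp add: sum.union_disjoint)
    have "?d1 * ?R1 \<le> ?D / 2 * ?R1" "?d2 * ?R2 \<le> ?D / 2 * ?R2"
      by (rule mult_right_mono [OF m(3) R1(1)] mult_right_mono [OF d2 R1(2)])+
    moreover have "?D / 2 * (?R1 + ?R2) \<le> ?D / 2 * ?R" using Rs R1 D0 by (intro mult_left_mono) auto
    ultimately have "?d1 * ?R1 + ?d2 * ?R2 \<le> ?D / 2 * ?R" by (simp add: distrib_left)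
    then have "4 * c * (?d1 * ?R1 + ?d2 * ?R2) \<le> 4 * c * (?D / 2 * ?R)" using c by (intro mult_left_mono) auto
    then have "4 * c * (?d1 * ?R1) + 4 * c * (?d2 * ?R2) \<le> 2 * (c * ?R * ?D)" by (simp add: distrib_left mult_ac)
    moreover have "?d1 * (1 - 4 * c * ?R1) = ?d1 - 4 * c * (?d1 * ?R1)" "?d2 * (1 - 4 * c * ?R2) = ?d2 - 4 * c * (?d2 * ?R2)"
      "?D * (1 - 4 * c * ?R) = ?D - 4 * (c * ?R * ?D)" by (simp_all add: right_diff_distrib mult_ac)
    ultimately show ?thesis unfolding S using split IH1 IH2 by linarith
  qed
qed

section \<open>Rotation over partitions\<close>

definition join_partition :: "nat \<Rightarrow> (nat \<Rightarrow> real) \<Rightarrow> (nat \<Rightarrow> real) \<Rightarrow> nat \<Rightarrow> real" where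
  "join_partition n s t i = (if i \<le> n then s i else t (i - n))"

text \<open>
  The total rotation of an inscribed polygon, with the angle at a break point abstracted to a
  function \<open>A s m t\<close> of the break point \<open>m\<close> and its neighbours.
\<close>

definition rotation_sum :: "(real \<Rightarrow> real \<Rightarrow> real \<Rightarrow> ennreal) \<Rightarrow> nat \<Rightarrow> (nat \<Rightarrow> real) \<Rightarrow> ennreal" where
  "rotation_sum A n t = (\<Sum>i=1..<n. A (t (i - 1)) (t i) (t (Suc i)))"

lemma join_partition_right:
  assumes "interval_partition a b n s" "interval_partition b c m t"
  shows "join_partition n s t (n + j) = t j"
  using assms by (cases j) (auto simp: join_partition_def interval_partition_def)

lemma join_partition_steps:
  assumes "interval_partition a b n s" "interval_partition b c m t"
    and "\<And>i. i < n \<Longrightarrow> P (s i) (s (Suc i))" "\<And>i. i < m \<Longrightarrow> P (t i) (t (Suc i))" "i < n + m"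
  shows "P (join_partition n s t i) (join_partition n s t (Suc i))"
proof (cases "i < n")
  case True then show ?thesis using assms(3) by (simp add: join_partition_def)
next
  case False
  then have "P (t (i - n)) (t (Suc (i - n)))" using assms(4,5) by auto
  then show ?thesis
    using False join_partition_right [OF assms(1,2), of "i - n"] join_partition_right [OF assms(1,2), of "Suc (i - n)"] by simp
qed

lemma interval_partition_join:
  assumes "interval_partition a b n s" "interval_partition b c m t"
  shows "interval_partition a c (n + m) (join_partition n s t)"
  unfolding interval_partition_def
proof (intro conjI allI impI)
  show "join_partition n s t 0 = a" using assms by (auto simp: join_partition_def interval_partition_def)
  show "join_partition n s t (n + m) = c" using join_partition_right [OF assms, of m] assms(2) by (simp add: interval_partition_def)
  fix i assume "i < n + m"
  then show "join_partition n s t i < join_partition n s t (Suc i)"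
    using assms by (intro join_partition_steps [OF assms, of "(<)"]) (auto simp: interval_partition_def)
qed

text \<open>
  At the junction the joined partition may gain a break point, which contributes a nonnegative
  term.
\<close>

lemma rotation_sum_join:
  assumes "interval_partition a b n s" "interval_partition b c m t"
  shows "rotation_sum A n s + rotation_sum A m t \<le> rotation_sum A (n + m) (join_partition n s t)"
proof -
  let ?j = "join_partition n s t"
  let ?g = "\<lambda>i. A (?j (i - 1)) (?j i) (?j (Suc i))"
  have 1: "rotation_sum A n s = sum ?g {1..<n}"
    unfolding rotation_sum_def by (intro sum.cong) (auto simp: join_partition_def)
  have "rotation_sum A m t = (\<Sum>i=1..<m. ?g (i + n))"
    unfolding rotation_sum_def
  proof (intro sum.cong refl)
    fix i assume "i \<in> {1..<m}"
    then have "?j (i + n - 1) = t (i - 1)" "?j (i + n) = t i" "?j (Suc (i + n)) = t (Suc i)"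
      using join_partition_right [OF assms, of "i - 1"] join_partition_right [OF assms, of i] join_partition_right [OF assms, of "Suc i"]
      by (auto simp: add.commute)
    then show "A (t (i - 1)) (t i) (t (Suc i)) = ?g (i + n)" by simp
  qed
  also have "\<dots> = sum ?g {1 + n..<m + n}" by (rule sum.shift_bounds_nat_ivl [symmetric])
  finally have 2: "rotation_sum A m t = sum ?g {1 + n..<m + n}" .
  have "rotation_sum A n s + rotation_sum A m t = sum ?g ({1..<n} \<union> {1 + n..<m + n})"
    unfolding 1 2 by (rule sum.union_disjoint [symmetric]) auto
  also have "\<dots> \<le> sum ?g {1..<n + m}" by (rule sum_mono2) auto
  finally show ?thesis unfolding rotation_sum_def .
qed

lemma fine_partition_exists:
  fixes a b \<epsilon> :: real
  assumes "a < b" "0 < \<epsilon>"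
  obtains n t where "interval_partition a b n t" "\<And>i. i < n \<Longrightarrow> t (Suc i) - t i < \<epsilon>"
proof -
  obtain n :: nat where n: "(b - a) / \<epsilon> < real n" using reals_Archimedean2 by blast
  have "0 < (b - a) / \<epsilon>" using assms by simp
  then have n0: "0 < real n" using n by linarith
  define q where "q = (b - a) / real n"
  define t where "t i = a + real i * q" for i :: nat
  have step: "t (Suc i) - t i = q" for i by (simp add: t_def algebra_simps)
  have pos: "0 < q" using assms n0 by (simp add: q_def)
  have "q < \<epsilon>" using n n0 assms by (simp add: q_def field_simps)
  moreover have "interval_partition a b n t"
    unfolding interval_partition_def
  proof (intro conjI allI impI)
    show "t 0 = a" "t n = b" using n0 by (simp_all add: t_def q_def)
    show "t i < t (Suc i)" for i using step [of i] pos by linarith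
  qed
  ultimately show ?thesis using that [of n t] step by auto
qed

text \<open>
  The supremum is over all partitions, not only over fine ones. This makes it superadditive, but
  whether it is finite depends on the interval.
\<close>

definition rotation :: "(real \<Rightarrow> real \<Rightarrow> real \<Rightarrow> ennreal) \<Rightarrow> real \<Rightarrow> real \<Rightarrow> ennreal" where
  "rotation A s t = (SUP (n, \<tau>)\<in>{(n, \<tau>). interval_partition s t n \<tau>}. rotation_sum A n \<tau>)"

lemma partition_exists: "s \<le> t \<Longrightarrow> \<exists>n \<tau>. interval_partition s t n \<tau>"
proof (cases "s = t")
  case True
  then have "interval_partition s t 0 (\<lambda>_. s)" by (simp add: interval_partition_def)
  then show ?thesis by blast
next
  case False
  moreover assume "s \<le> t"
  ultimately have "interval_partition s t 1 (\<lambda>i. if i = 0 then s else t)" by (simp add: interval_partition_def)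
  then show ?thesis by blast
qed

lemma rotation_upper: "interval_partition s t n \<tau> \<Longrightarrow> rotation_sum A n \<tau> \<le> rotation A s t"
  unfolding rotation_def by (rule SUP_upper2 [of "(n, \<tau>)"]) auto

lemma rotation_superadditive:
  assumes "s \<le> m" "m \<le> t"
  shows "rotation A s m + rotation A m t \<le> rotation A s t"
proof -
  let ?P = "\<lambda>s t. {(n, \<tau>). interval_partition s t n \<tau>}"
  have ne: "?P s m \<noteq> {}" "?P m t \<noteq> {}" using partition_exists assms by auto
  have "rotation A s m + rotation A m t = (SUP x\<in>?P s m. (case x of (n, \<tau>) \<Rightarrow> rotation_sum A n \<tau>) + rotation A m t)"
    unfolding rotation_def [of A s m] by (rule ennreal_SUP_add_left [symmetric, OF ne(1)])
  also have "\<dots> \<le> rotation A s t"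
  proof (rule SUP_least, clarify)
    fix n \<tau> assume p: "interval_partition s m n \<tau>"
    have "rotation_sum A n \<tau> + rotation A m t = (SUP x\<in>?P m t. rotation_sum A n \<tau> + (case x of (n, \<tau>) \<Rightarrow> rotation_sum A n \<tau>))"
      unfolding rotation_def [of A m t] by (rule ennreal_SUP_add_right [OF ne(2)])
    also have "\<dots> \<le> rotation A s t"
    proof (rule SUP_least, clarify)
      fix n' \<tau>' assume p': "interval_partition m t n' \<tau>'"
      show "rotation_sum A n \<tau> + rotation_sum A n' \<tau>' \<le> rotation A s t"
        using rotation_sum_join [OF p p', of A] rotation_upper [OF interval_partition_join [OF p p'], of A] by (rule order.trans)
    qed
    finally show "rotation_sum A n \<tau> + rotation A m t \<le> rotation A s t" .
  qed
  finally show ?thesis .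
qed

lemma rotation_triple:
  assumes "s < m" "m < t"
  shows "A s m t \<le> rotation A s t"
proof -
  let ?\<tau> = "\<lambda>i::nat. if i = 0 then s else if i = 1 then m else t"
  have "interval_partition s t 2 ?\<tau>" using assms by (simp add: interval_partition_def)
  then have "rotation_sum A 2 ?\<tau> \<le> rotation A s t" by (rule rotation_upper)
  then show ?thesis by (simp add: rotation_sum_def)
qed

text \<open>
  By superadditivity, one of the two halves of an interval carries at most half of its rotation;
  repeated bisection makes the rotation arbitrarily small.
\<close>

lemma rotation_small_interval:
  assumes "s < t" "rotation A s t \<le> ennreal C" "0 \<le> C" "0 < \<delta>"
  obtains s' t' where "s \<le> s'" "s' < t'" "t' \<le> t" "rotation A s' t' \<le> ennreal \<delta>"
proof -
  have ex: "\<exists>s' t'. s \<le> s' \<and> s' < t' \<and> t' \<le> t \<and> rotation A s' t' \<le> ennreal (C / 2 ^ n)" for n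
  proof (induction n)
    case 0 then show ?case using assms by (intro exI [of _ s] exI [of _ t]) auto
  next
    case (Suc n)
    then obtain s' t' where st: "s \<le> s'" "s' < t'" "t' \<le> t" "rotation A s' t' \<le> ennreal (C / 2 ^ n)" by blast
    define m where "m = (s' + t') / 2"
    have m: "s' < m" "m < t'" using st by (auto simp: m_def)
    let ?h = "ennreal (C / 2 ^ Suc n)"
    have "rotation A s' m \<le> ?h \<or> rotation A m t' \<le> ?h"
    proof (rule ccontr)
      assume "\<not> ?thesis"
      then have "?h + ?h < rotation A s' m + rotation A m t'" by (auto intro: add_strict_mono)
      also have "\<dots> \<le> rotation A s' t'" using m by (intro rotation_superadditive) auto
      also note st(4)
      finally show False using assms(3) by (simp add: ennreal_plus [symmetric] del: ennreal_plus)
    qed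
    then show ?case
    proof
      assume "rotation A s' m \<le> ?h" then show ?case using st m by (intro exI [of _ s'] exI [of _ m]) auto
    next
      assume "rotation A m t' \<le> ?h" then show ?case using st m by (intro exI [of _ m] exI [of _ t']) auto
    qed
  qed
  obtain n :: nat where "C / \<delta> < 2 ^ n" using real_arch_pow [of 2 "C / \<delta>"] by auto
  then have "C / 2 ^ n \<le> \<delta>" using assms by (simp add: field_simps)
  then show ?thesis using ex [of n] that by (meson ennreal_leI order.trans)
qed

section \<open>Comparison angles\<close>

context model_null_charts
begin

lemma timelike_pair_time: "timelike_pair p q \<Longrightarrow> fst p < fst q"
  using model_le_time [OF timelike_pair_model_le] by (fastforce simp: timelike_pair_def centre)

lemma timelike_pair_of_length:
  assumes "e p q = ennreal (rl r)" "0 < r" "0 < 1 + \<kappa> * r\<^sup>2"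
  shows "timelike_pair p q"
  using radial_length_strict_mono [of 0 r \<kappa>] assms radial_length_lt_diameter by (intro timelike_pairI) auto

text \<open>
  The description defining the comparison angle denotes: a comparison triangle exists, and the law
  of cosines yields the same angle for every comparison triangle and all directions of its sides.
  The vanishing separations encode the chronological order \<open>p, y, q\<close>.
\<close>

lemma comparison_angle_eq:
  fixes ell :: "'b \<Rightarrow> 'b \<Rightarrow> ennreal"
  assumes ab: "0 < a" "0 < b" "0 < c"
    and small: "\<bar>\<kappa>\<bar> * a\<^sup>2 \<le> 1/4" "\<bar>\<kappa>\<bar> * b\<^sup>2 \<le> 1/4" "\<bar>\<kappa>\<bar> * c\<^sup>2 \<le> 1/4"
    and law: "1 \<le> hinge_law \<kappa> a b c"
    and l: "ell p y = ennreal (rl a)" "ell y q = ennreal (rl b)" "ell p q = ennreal (rl c)"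
    and z: "ell p p = 0" "ell y y = 0" "ell q q = 0" "ell y p = 0" "ell q y = 0" "ell q p = 0"
  shows "comparison_angle K ell y p q = arcosh (hinge_law \<kappa> a b c)"
proof -
  have conf: "0 < 1 + \<kappa> * a\<^sup>2" "0 < 1 + \<kappa> * b\<^sup>2" "0 < 1 + \<kappa> * c\<^sup>2"
    using small_conformal_factor(1) [OF small(1)] small_conformal_factor(1) [OF small(2)] small_conformal_factor(1) [OF small(3)] by auto
  show ?thesis
    unfolding comparison_angle_def
  proof (rule the_equality)
    obtain p' y' q' where e': "e p' y' = ennreal (rl a)" "e y' q' = ennreal (rl b)" "e p' q' = ennreal (rl c)"
      by (rule hinge_exists [OF ab small law])
    have t: "timelike_pair p' y'" "timelike_pair y' q'" "timelike_pair p' q'"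
      using timelike_pair_of_length [OF e'(1)] timelike_pair_of_length [OF e'(2)] timelike_pair_of_length [OF e'(3)] ab conf by auto
    note tm = timelike_pair_time [OF t(1)] timelike_pair_time [OF t(2)]
    have v: "comparison_vertices K ell y p q y' p' q'"
      unfolding comparison_vertices_def using tm by (simp add: e' l z model_ell_eq_0)
    obtain w1 w2 where w: "model_direction K y' p' w1" "model_direction K y' q' w2"
      using seg_directions(2) [OF t(1)] seg_directions(1) [OF t(2)] by blast
    show "\<exists>y' p' q' w1 w2. comparison_vertices K ell y p q y' p' q' \<and> model_direction K y' p' w1 \<and>
        model_direction K y' q' w2 \<and> arcosh (hinge_law \<kappa> a b c) = hyperbolic_angle K y' w1 w2"
      using v w model_angle [OF ab conf e' w] by (metis (no_types))
  next
    fix \<omega> assume "\<exists>y' p' q' w1 w2. comparison_vertices K ell y p q y' p' q' \<and> model_direction K y' p' w1 \<and>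
        model_direction K y' q' w2 \<and> \<omega> = hyperbolic_angle K y' w1 w2"
    then obtain y' p' q' w1 w2 where c: "comparison_vertices K ell y p q y' p' q'" and w: "model_direction K y' p' w1"
        "model_direction K y' q' w2" and \<omega>: "\<omega> = hyperbolic_angle K y' w1 w2" by blast
    have e': "e p' y' = ennreal (rl a)" "e y' q' = ennreal (rl b)" "e p' q' = ennreal (rl c)"
      using c unfolding comparison_vertices_def by (simp_all add: l)
    show "\<omega> = arcosh (hinge_law \<kappa> a b c)" unfolding \<omega> by (rule model_angle [OF ab conf e' w])
  qed
qed

lemma seg_point:
  assumes l: "e p q = ennreal (rl r)" "0 < r" "0 < 1 + \<kappa> * r\<^sup>2" and d: "0 < d" "d < rl r"
  obtains m where "m \<in> seg p q ` {0..1}" "e p m = ennreal d" "e m q = ennreal (rl r - d)"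
    "model_le K p m" "model_le K m q"
proof -
  note t = timelike_pair_of_length [OF l]
  have r: "sqrt (u p q * v p q) = r" using timelike_pair_product [OF t l] l(2) by simp
  obtain x where x: "0 < x" "x \<le> r" "rl x = d"
    using radial_length_surj [OF l(2,3) d(1) less_imp_le [OF d(2)]] by blast
  have "x \<noteq> r" using x d by auto
  then have s: "0 < x / r" "x / r < 1" using x l(2) by auto
  have 1: "timelike_pair (seg p q 0) (seg p q (x / r))" "e (seg p q 0) (seg p q (x / r)) = ennreal (rl (x / r * r) - rl (0 * r))"
    using seg_pair [OF t, of 0 "x / r"] s unfolding r by auto
  have 2: "timelike_pair (seg p q (x / r)) (seg p q 1)" "e (seg p q (x / r)) (seg p q 1) = ennreal (rl (1 * r) - rl (x / r * r))"
    using seg_pair [OF t, of "x / r" 1] s unfolding r by auto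
  show ?thesis
  proof (rule that [of "seg p q (x / r)"])
    show "seg p q (x / r) \<in> seg p q ` {0..1}" using s by auto
  qed (use 1 2 l(2) x(3) timelike_pair_model_le in \<open>auto simp: seg_ends [OF t]\<close>)
qed

end

section \<open>Geodesics in a comparison neighbourhood\<close>

locale comparison_space = lorentzian_pre_length_space ll le ell
  for ll le :: "'a::metric_space \<Rightarrow> 'a \<Rightarrow> bool" and ell :: "'a \<Rightarrow> 'a \<Rightarrow> ennreal" +
  fixes K :: real and U :: "'a set"
  assumes regular: "regular_lorentzian ll le ell"
    and nbhd: "le_comparison_neighbourhood K ll le ell U"
begin

lemma diameter_le_top: "r < model_diameter K \<Longrightarrow> r < top"
  by (rule less_le_trans) auto

text \<open>
  If \<open>ell x x\<close> were positive, the reverse triangle inequality would give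
  \<open>ell x x + ell x y \<le> ell x y\<close> with \<open>ell x y\<close> finite.
\<close>

lemma ell_self:
  assumes "ll x y" "ell x y < top"
  shows "ell x x = 0" "ell y y = 0"
proof -
  have zero: "a = 0" if "a + b \<le> b" "b < top" for a b :: ennreal
    using that by (cases a; cases b) (auto simp flip: ennreal_plus simp: ennreal_le_iff2 top_unique)
  have "ell x x + ell x y \<le> ell x y" by (rule reverse_triangle [OF le_refl ll_imp_le [OF assms(1)]])
  then show "ell x x = 0" using assms(2) by (rule zero)
  have "ell y y + ell x y \<le> ell x y"
    using reverse_triangle [OF ll_imp_le [OF assms(1)] le_refl] by (simp add: add.commute)
  then show "ell y y = 0" using assms(2) by (rule zero)
qed

lemma ell_mono:
  assumes "le x y" "le y z"
  shows "ell x y \<le> ell x z" "ell y z \<le> ell x z"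
proof -
  note t = reverse_triangle [OF assms]
  show "ell x y \<le> ell x z" by (rule order.trans [OF _ t]) simp
  show "ell y z \<le> ell x z" by (rule order.trans [OF _ t]) simp
qed

lemma maximising_le_sum:
  assumes "maximising_geodesic le ell \<sigma> p q x y" "interval_partition p q n w"
  shows "ell x y \<le> (\<Sum>i<n. ell (\<sigma> (w i)) (\<sigma> (w (Suc i))))"
proof -
  have "ell_length ell \<sigma> p q \<le> (\<Sum>i<n. ell (\<sigma> (w i)) (\<sigma> (w (Suc i))))"
    unfolding ell_length_def using assms(2) by (intro Inf_lower) blast
  then show ?thesis using assms(1) by (simp add: maximising_geodesic_def)
qed

lemma maximising_split3:
  assumes m: "maximising_geodesic le ell \<sigma> p q x y" and r: "p \<le> r" "r < r'" "r' \<le> q"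
  shows "ell x y \<le> ell x (\<sigma> r) + ell (\<sigma> r) (\<sigma> r') + ell (\<sigma> r') y"
proof -
  have ends: "\<sigma> p = x" "\<sigma> q = y" using m by (auto simp: maximising_geodesic_def)
  consider "p = r" "r' = q" | "p = r" "r' < q" | "p < r" "r' = q" | "p < r" "r' < q" using r by linarith
  then show ?thesis
  proof cases
    case 1 then show ?thesis using ends by (simp add: add_increasing add_increasing2)
  next
    case 2
    have "interval_partition p q 2 (\<lambda>i. if i = 0 then p else if i = 1 then r' else q)"
      using r 2 by (simp add: interval_partition_def)
    from maximising_le_sum [OF m this] show ?thesis
      using ends 2 by (simp add: numeral_2_eq_2 add_increasing add.assoc)
  next
    case 3
    have "interval_partition p q 2 (\<lambda>i. if i = 0 then p else if i = 1 then r else q)"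
      using r 3 by (simp add: interval_partition_def)
    from maximising_le_sum [OF m this] show ?thesis
      using ends 3 by (simp add: numeral_2_eq_2 add_increasing2)
  next
    case 4
    have "interval_partition p q 3 (\<lambda>i. if i = 0 then p else if i = 1 then r else if i = 2 then r' else q)"
      using r 4 by (auto simp: interval_partition_def)
    from maximising_le_sum [OF m this] show ?thesis
      using ends by (simp add: numeral_3_eq_3 numeral_2_eq_2 add.assoc)
  qed
qed

text \<open>
  Maximising geodesics in the comparison neighbourhood that are parametrised without pausing, so
  that they are timelike curves and can serve as sides of polygons.
\<close>

definition geo :: "(real \<Rightarrow> 'a) \<Rightarrow> real \<Rightarrow> real \<Rightarrow> 'a \<Rightarrow> 'a \<Rightarrow> bool" where
  "geo G s t x y \<longleftrightarrow> timelike_curve ll G s t \<and> maximising_geodesic le ell G s t x y \<and> G ` {s..t} \<subseteq> U"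

lemma ell_continuous_from:
  assumes x: "x \<in> U" and \<sigma>: "continuous_on T \<sigma>" "\<sigma> ` T \<subseteq> U" "\<And>r. r \<in> T \<Longrightarrow> ell x (\<sigma> r) < model_diameter K"
  shows "continuous_on T (\<lambda>r. enn2real (ell x (\<sigma> r)))"
proof -
  let ?D = "{(x, y) \<in> U \<times> U. ell x y < model_diameter K}"
  have "continuous_on ?D (\<lambda>(x, y). ell x y)"
    using nbhd unfolding le_comparison_neighbourhood_def Let_def by blast
  moreover have "continuous_on T (\<lambda>r. (x, \<sigma> r))" by (intro continuous_on_Pair continuous_on_const \<sigma>(1))
  moreover have "(\<lambda>r. (x, \<sigma> r)) ` T \<subseteq> ?D" using x \<sigma>(2,3) by auto
  ultimately have "continuous_on T (\<lambda>r. (\<lambda>(x, y). ell x y) (x, \<sigma> r))" by (rule continuous_on_compose2)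
  then have c: "continuous_on T (\<lambda>r. ell x (\<sigma> r))" by simp
  show ?thesis
    unfolding continuous_on_def
  proof
    fix r assume r: "r \<in> T"
    have "ell x (\<sigma> r) = ennreal (enn2real (ell x (\<sigma> r)))" using diameter_le_top [OF \<sigma>(3) [OF r]] by simp
    then show "((\<lambda>r. enn2real (ell x (\<sigma> r))) \<longlongrightarrow> enn2real (ell x (\<sigma> r))) (at r within T)"
      using c r unfolding continuous_on_def by (intro tendsto_enn2real) auto
  qed
qed

text \<open>
  A maximising geodesic may be constant on subintervals. By regularity this is the only way in
  which the separation \<open>\<tau>\<close> from its starting point can fail to be strictly increasing, so the
  curve factors through \<open>\<tau>\<close> and can be reparametrised proportionally to \<open>\<tau>\<close>.
\<close>

lemma geo_exists:
  assumes U: "x \<in> U" "y \<in> U" and xy: "ll x y" "ell x y < model_diameter K" and st: "s < t"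
  obtains G where "geo G s t x y"
proof -
  obtain S where S: "maximising_segment le ell x y S" "S \<subseteq> U"
    using nbhd U xy unfolding le_comparison_neighbourhood_def by meson
  then obtain \<sigma> p q where m: "maximising_geodesic le ell \<sigma> p q x y" and im: "\<sigma> ` {p..q} \<subseteq> U"
    unfolding maximising_segment_def by blast
  have ends: "\<sigma> p = x" "\<sigma> q = y" and pq: "p < q" and cont: "continuous_on {p..q} \<sigma>"
    and caus: "\<And>r r'. r \<in> {p..q} \<Longrightarrow> r' \<in> {p..q} \<Longrightarrow> r < r' \<Longrightarrow> le (\<sigma> r) (\<sigma> r')"
    using m by (auto simp: maximising_geodesic_def causal_curve_def)
  have caus': "le (\<sigma> r) (\<sigma> r')" if "p \<le> r" "r \<le> r'" "r' \<le> q" for r r'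
    using caus [of r r'] that le_refl by (cases "r = r'") auto
  have fin: "ell x y < top" by (rule diameter_le_top [OF xy(2)])
  have xx: "ell x x = 0" "ell y y = 0"
    by (rule ell_self [OF xy(1) fin])+
  have tri: "ell x (\<sigma> r) + ell (\<sigma> r) y \<le> ell x y" if "p \<le> r" "r \<le> q" for r
    using reverse_triangle [of x "\<sigma> r" y] caus' [of p r] caus' [of r q] that ends pq by auto
  have le_xy: "ell x (\<sigma> r) \<le> ell x y" "ell (\<sigma> r) y \<le> ell x y" if "p \<le> r" "r \<le> q" for r
    using ell_mono [of x "\<sigma> r" y] caus' [of p r] caus' [of r q] that ends pq by auto
  define L where "L = enn2real (ell x y)"
  have L: "ell x y = ennreal L" "0 < L" using fin xy(1) ell_pos_iff [of x y] by (auto simp: L_def enn2real_positive_iff)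
  define \<tau> where "\<tau> r = enn2real (ell x (\<sigma> r))" for r
  have \<tau>: "ell x (\<sigma> r) = ennreal (\<tau> r)" "0 \<le> \<tau> r" if "p \<le> r" "r \<le> q" for r
    using le_less_trans [OF le_xy(1) [OF that] fin] by (auto simp: \<tau>_def)
  have \<tau>0: "\<tau> p = 0" "\<tau> q = L" by (auto simp: \<tau>_def ends xx L_def)
  have add: "\<tau> r \<le> \<tau> r'" "ell (\<sigma> r) (\<sigma> r') = ennreal (\<tau> r' - \<tau> r)" if r: "p \<le> r" "r < r'" "r' \<le> q" for r r'
  proof -
    have rr: "p \<le> r'" "r \<le> q" using r by auto
    have 1: "ell x (\<sigma> r) + ell (\<sigma> r) (\<sigma> r') \<le> ell x (\<sigma> r')"
      using caus' [of p r] caus' [of r r'] r ends by (intro reverse_triangle) auto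
    have "le x (\<sigma> r)" "le (\<sigma> r) (\<sigma> r')" using caus' [of p r] caus' [of r r'] r ends by auto
    then have "ell (\<sigma> r) (\<sigma> r') \<le> ell x (\<sigma> r')" by (rule ell_mono(2))
    then have fin2: "ell (\<sigma> r) (\<sigma> r') < top" "ell (\<sigma> r') y < top"
      using le_xy(1) [OF rr(1) r(3)] le_xy(2) [OF rr(1) r(3)] fin by (meson le_less_trans)+
    define f g where "f = enn2real (ell (\<sigma> r) (\<sigma> r'))" and "g = enn2real (ell (\<sigma> r') y)"
    have fg: "ell (\<sigma> r) (\<sigma> r') = ennreal f" "ell (\<sigma> r') y = ennreal g" "0 \<le> f" "0 \<le> g"
      using fin2 by (auto simp: f_def g_def)
    have "\<tau> r + f \<le> \<tau> r'"
      using 1 \<tau> [OF r(1) rr(2)] \<tau> [OF rr(1) r(3)] fg by (simp add: ennreal_plus [symmetric] del: ennreal_plus)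
    moreover have "\<tau> r' + g \<le> L"
      using tri [OF rr(1) r(3)] \<tau> [OF rr(1) r(3)] fg L by (simp add: ennreal_plus [symmetric] del: ennreal_plus)
    moreover have "L \<le> \<tau> r + f + g"
      using maximising_split3 [OF m r] \<tau> [OF r(1) rr(2)] fg L by (simp add: ennreal_plus [symmetric] del: ennreal_plus)
    ultimately have feq: "f = \<tau> r' - \<tau> r" by linarith
    show "\<tau> r \<le> \<tau> r'" using feq fg(3) by linarith
    show "ell (\<sigma> r) (\<sigma> r') = ennreal (\<tau> r' - \<tau> r)" unfolding fg(1) feq ..
  qed
  have reg: "\<forall>r\<in>{p..q}. \<forall>r'\<in>{p..q}. r < r' \<and> \<sigma> r \<noteq> \<sigma> r' \<longrightarrow> ll (\<sigma> r) (\<sigma> r')"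
    using regular [unfolded regular_lorentzian_def, rule_format, of x y \<sigma> p q] m xy(1) by (simp add: ell_pos_iff)
  have inj: "\<sigma> r = \<sigma> r'" if r: "p \<le> r" "r \<le> q" "p \<le> r'" "r' \<le> q" "\<tau> r = \<tau> r'" for r r'
  proof -
    have lt: "\<sigma> r = \<sigma> r'" if r: "p \<le> r" "r < r'" "r' \<le> q" "\<tau> r = \<tau> r'" for r r'
    proof (rule ccontr)
      assume "\<sigma> r \<noteq> \<sigma> r'"
      then have "ll (\<sigma> r) (\<sigma> r')"
        using reg r by simp
      then have "0 < ell (\<sigma> r) (\<sigma> r')" by (simp add: ell_pos_iff)
      then show False using add [OF r(1-3)] r(4) by simp
    qed
    consider "r < r'" | "r = r'" | "r' < r" by linarith
    then show ?thesis
    proof cases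
      case 1 then show ?thesis using lt [of r r'] r by blast
    next
      case 3 then show ?thesis using lt [of r' r, symmetric] r by simp
    qed simp
  qed
  have c\<tau>: "continuous_on {p..q} \<tau>"
    unfolding \<tau>_def
  proof (rule ell_continuous_from [OF U(1) cont im])
    show "ell x (\<sigma> r) < model_diameter K" if "r \<in> {p..q}" for r
      using le_xy(1) [of r] that xy(2) by (meson atLeastAtMost_iff le_less_trans)
  qed
  \<comment> \<open>\<open>g\<close> is the affine separation profile of the new parametrisation.\<close>
  define g where "g r = (r - s) / (t - s) * L" for r
  have g01: "0 \<le> g r" "g r \<le> L" if "r \<in> {s..t}" for r
  proof -
    have "0 \<le> (r - s) / (t - s)" "(r - s) / (t - s) \<le> 1" using that st by auto
    then show "0 \<le> g r" "g r \<le> L"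
      using mult_nonneg_nonneg [of "(r - s) / (t - s)" L] mult_right_mono [of "(r - s) / (t - s)" 1 L] L(2)
      by (simp_all only: g_def mult_1 less_imp_le)
  qed
  have gmono: "g r < g r'" if "r < r'" for r r'
    using that st L by (simp add: g_def divide_strict_right_mono)
  have "\<exists>w\<in>{p..q}. \<tau> w = g r" if "r \<in> {s..t}" for r
    using IVT' [of \<tau> p "g r" q] g01 [OF that] c\<tau> pq by (auto simp: \<tau>0)
  then obtain w where w: "\<And>r. r \<in> {s..t} \<Longrightarrow> w r \<in> {p..q}" "\<And>r. r \<in> {s..t} \<Longrightarrow> \<tau> (w r) = g r"
    by metis
  define G where "G r = \<sigma> (w r)" for r
  have Gadd: "ell (G r) (G r') = ennreal (g r' - g r)" if r: "s \<le> r" "r < r'" "r' \<le> t" for r r'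
  proof -
    have rr: "r \<in> {s..t}" "r' \<in> {s..t}" using r by auto
    have "w r < w r'"
    proof (rule ccontr)
      assume "\<not> w r < w r'"
      then have "\<tau> (w r') \<le> \<tau> (w r)" using add(1) [of "w r'" "w r"] w(1) [OF rr(1)] w(1) [OF rr(2)] by (cases "w r = w r'") auto
      then show False using w(2) [OF rr(1)] w(2) [OF rr(2)] gmono [OF r(2)] by simp
    qed
    then show ?thesis using add(2) [of "w r" "w r'"] w(1) [OF rr(1)] w(1) [OF rr(2)] w(2) [OF rr(1)] w(2) [OF rr(2)]
      by (simp add: G_def)
  qed
  have Gll: "ll (G r) (G r')" if r: "s \<le> r" "r < r'" "r' \<le> t" for r r'
    using Gadd [OF r] gmono [OF r(2)] by (simp add: ell_pos_iff [symmetric])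
  have st': "s \<in> {s..t}" "t \<in> {s..t}" using st by auto
  have "\<tau> (w s) = \<tau> p" using w(2) [OF st'(1)] by (simp add: g_def \<tau>0)
  then have "G s = \<sigma> p" unfolding G_def using w(1) [OF st'(1)] pq by (intro inj) auto
  then have Gs: "G s = x" by (simp add: ends)
  have "\<tau> (w t) = \<tau> q" using w(2) [OF st'(2)] st by (simp add: g_def \<tau>0)
  then have "G t = \<sigma> q" unfolding G_def using w(1) [OF st'(2)] pq by (intro inj) auto
  then have Gt: "G t = y" by (simp add: ends)
  \<comment> \<open>\<open>w\<close> is an arbitrary section of \<open>\<tau>\<close> and may jump; continuity of \<open>G\<close> follows because \<open>\<tau>\<close> is a
    closed map on the compact interval and \<open>G\<close> is the quotient of \<open>\<sigma>\<close> by it.\<close>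
  have Gc: "continuous_on {s..t} G"
    unfolding continuous_on_closed_vimage [OF closed_atLeastAtMost]
  proof (intro allI impI)
    fix B :: "'a set" assume B: "closed B"
    have "closed ({p..q} \<inter> \<sigma> -` B)" using continuous_closed_preimage [OF cont _ B] by simp
    then have "compact ({p..q} \<inter> \<sigma> -` B)" using compact_Int_closed [OF compact_Icc, of _ p q] by (metis Int_left_absorb)
    then have "compact (\<tau> ` ({p..q} \<inter> \<sigma> -` B))"
      by (intro compact_continuous_image continuous_on_subset [OF c\<tau>]) auto
    then have cl: "closed (\<tau> ` ({p..q} \<inter> \<sigma> -` B))" by (rule compact_imp_closed)
    have "continuous_on {s..t} g" unfolding g_def
      by (intro continuous_on_mult continuous_on_divide continuous_on_diff continuous_on_id continuous_on_const) (use st in auto)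
    then have "closed ({s..t} \<inter> g -` (\<tau> ` ({p..q} \<inter> \<sigma> -` B)))"
      by (rule continuous_closed_preimage [OF _ closed_atLeastAtMost cl])
    moreover have "G -` B \<inter> {s..t} = {s..t} \<inter> g -` (\<tau> ` ({p..q} \<inter> \<sigma> -` B))"
    proof (intro equalityI subsetI)
      fix r assume r: "r \<in> G -` B \<inter> {s..t}"
      then have "w r \<in> {p..q} \<inter> \<sigma> -` B" "\<tau> (w r) = g r" using w [of r] by (auto simp: G_def)
      then show "r \<in> {s..t} \<inter> g -` (\<tau> ` ({p..q} \<inter> \<sigma> -` B))" using r by (metis IntD2 IntI imageI vimageI)
    next
      fix r assume r: "r \<in> {s..t} \<inter> g -` (\<tau> ` ({p..q} \<inter> \<sigma> -` B))"
      then obtain z where z: "z \<in> {p..q}" "\<sigma> z \<in> B" "g r = \<tau> z" by auto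
      have "\<sigma> (w r) = \<sigma> z" using w [of r] r z by (intro inj) auto
      then show "r \<in> G -` B \<inter> {s..t}" using r z by (simp add: G_def)
    qed
    ultimately show "closed (G -` B \<inter> {s..t})" by simp
  qed
  have "ell_length ell G s t = ell (G s) (G t)"
    using Gadd gmono by (intro ell_length_additive [OF st, of g]) (auto intro: less_imp_le)
  then have "maximising_geodesic le ell G s t x y"
    unfolding maximising_geodesic_def causal_curve_def using st Gc Gs Gt Gll ll_imp_le by auto
  moreover have "G ` {s..t} \<subseteq> U" using w(1) im by (auto simp: G_def)
  ultimately have "geo G s t x y"
    unfolding geo_def timelike_curve_def using st Gc Gll by auto
  then show ?thesis by (rule that)
qed

lemma geo_split:
  assumes g: "geo G s t x y" and r: "s < r" "r < t"
  shows "ll x (G r)" "ll (G r) y" "ell x y = ell x (G r) + ell (G r) y"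
proof -
  have ends: "G s = x" "G t = y" and m: "maximising_geodesic le ell G s t x y" and tl: "timelike_curve ll G s t"
    using g by (auto simp: geo_def maximising_geodesic_def)
  show ll: "ll x (G r)" "ll (G r) y" using tl ends r unfolding timelike_curve_def by (metis atLeastAtMost_iff less_imp_le less_trans order_refl)+
  have "interval_partition s t 2 (\<lambda>i. if i = 0 then s else if i = 1 then r else t)"
    using r by (simp add: interval_partition_def)
  from maximising_le_sum [OF m this] have "ell x y \<le> ell x (G r) + ell (G r) y"
    using ends by (simp add: numeral_2_eq_2)
  then show "ell x y = ell x (G r) + ell (G r) y"
    using reverse_triangle ll ll_imp_le by (metis order_antisym)
qed

end

section \<open>Angles in a comparison neighbourhood\<close>

lemma arcosh_real_mono: "1 \<le> x \<Longrightarrow> x \<le> y \<Longrightarrow> arcosh x \<le> arcosh (y::real)"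
  by (cases "x = y") (auto intro!: less_imp_le arcosh_real_strict_mono)

context comparison_space
begin

abbreviation "rlen \<equiv> radial_length (K / 4)"

lemma ell_no_return:
  assumes "ll x y" "ell x y < top"
  shows "ell y x = 0"
proof (rule ccontr)
  assume "ell y x \<noteq> 0"
  then have "0 < ell y x" by (simp add: zero_less_iff_neq_zero)
  then have "ll y x" using ell_pos_iff by blast
  then have "ll y y" using assms(1) by (rule ll_trans)
  then have "0 < ell y y" using ell_pos_iff by blast
  then show False using ell_self(2) [OF assms] by simp
qed

lemma size_boundsI:
  assumes "ll x y" "ll y z" "ell x z < model_diameter K"
  shows "size_bounds K ell x y z" "size_bounds K ell y x z"
proof -
  have xz: "ll x z" using assms ll_trans by blast
  have le: "ell x y \<le> ell x z" "ell y z \<le> ell x z" using ell_mono [of x y z] assms ll_imp_le by auto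
  have b: "ell x y < model_diameter K" "ell y z < model_diameter K" using le assms(3) by (meson le_less_trans)+
  note t = diameter_le_top [OF b(1)] diameter_le_top [OF b(2)] diameter_le_top [OF assms(3)]
  have D: "0 < model_diameter K" using b(1) by (rule le_less_trans [OF zero_le])
  show "size_bounds K ell x y z" "size_bounds K ell y x z"
    unfolding size_bounds_def
    using b assms(3) D ell_self [OF assms(1) t(1)] ell_self [OF assms(2) t(2)]
      ell_no_return [OF assms(1) t(1)] ell_no_return [OF assms(2) t(2)] ell_no_return [OF xz t(3)] by simp_all
qed

lemma geo_ends:
  assumes "geo G s t x y"
  shows "G s = x" "G t = y" "s < t" "ll x y" "maximising_geodesic le ell G s t x y" "G ` {s..t} \<subseteq> U" "x \<in> U" "y \<in> U"
proof -
  show 1: "G s = x" "G t = y" "s < t" "maximising_geodesic le ell G s t x y" "G ` {s..t} \<subseteq> U"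
    using assms by (auto simp: geo_def maximising_geodesic_def timelike_curve_def)
  have "ll (G s) (G t)" using assms 1(3) by (auto simp: geo_def timelike_curve_def)
  then show "ll x y" using 1(1,2) by simp
  have "G s \<in> G ` {s..t}" "G t \<in> G ` {s..t}" using 1(3) by auto
  then show "x \<in> U" "y \<in> U" using 1 by auto
qed

lemma small_mono:
  fixes k a b :: real
  assumes "0 \<le> a" "a \<le> b" "\<bar>k\<bar> * b\<^sup>2 \<le> 1/4"
  shows "\<bar>k\<bar> * a\<^sup>2 \<le> 1/4"
proof -
  have "a\<^sup>2 \<le> b\<^sup>2" using assms by (intro power_mono)
  then have "\<bar>k\<bar> * a\<^sup>2 \<le> \<bar>k\<bar> * b\<^sup>2" by (rule mult_left_mono) simp
  then show ?thesis using assms(3) by linarith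
qed

text \<open>
  The curvature bound says that the comparison points of \<open>G1 r\<close> and \<open>G2 r'\<close> in the comparison
  triangle of \<open>x, y, z\<close> are at most as far apart as the points themselves. The hinge spanned by
  the comparison points has the angle of the whole comparison triangle. The comparison triangle of
  \<open>G1 r, y, G2 r'\<close> has the same adjacent sides and a third side that is at least as long, hence a
  larger angle.
\<close>

lemma comparison_angle_ge:
  assumes G1: "geo G1 s m x y" and G2: "geo G2 m t y z"
    and abc: "0 < a" "0 < b" "0 < c"
    and small: "\<bar>K / 4\<bar> * a\<^sup>2 \<le> 1/4" "\<bar>K / 4\<bar> * b\<^sup>2 \<le> 1/4" "\<bar>K / 4\<bar> * c\<^sup>2 \<le> 1/4"
    and l: "ell x y = ennreal (rlen a)" "ell y z = ennreal (rlen b)" "ell x z = ennreal (rlen c)"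
    and r: "s < r" "r < m" and r': "m < r'" "r' < t"
  shows "1 \<le> hinge_law (K / 4) a b c"
    "ll (G1 r) (G2 r')" "size_bounds K ell y (G1 r) (G2 r')"
    "arcosh (hinge_law (K / 4) a b c) \<le> comparison_angle K ell y (G1 r) (G2 r')"
proof -
  obtain M u v A B iv h1 h2 gU gV G where "model_null_charts (K / 4) M u v A B iv h1 h2 gU gV K G"
    by (rule model_charts_exist)
  then interpret model_null_charts "K / 4" M u v A B iv h1 h2 gU gV K G .
  define p q where "p = G1 r" and "q = G2 r'"
  note g1 = geo_ends [OF G1] and g2 = geo_ends [OF G2]
  have conf: "0 < 1 + K / 4 * a\<^sup>2" "0 < 1 + K / 4 * b\<^sup>2" "0 < 1 + K / 4 * c\<^sup>2"
    using small_conformal_factor(1) [OF small(1)] small_conformal_factor(1) [OF small(2)] small_conformal_factor(1) [OF small(3)] by linarith+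
  have pos: "0 < rlen a" "0 < rlen b" "0 < rlen c" using radial_length_strict_mono [of 0 _ "K / 4"] abc conf by auto
  have D: "ell x y < model_diameter K" "ell y z < model_diameter K" "ell x z < model_diameter K"
    unfolding l by (rule radial_length_lt_diameter)+
  have xz: "ll x z" using g1(4) g2(4) by (rule ll_trans)
  have "ell x y + ell y z \<le> ell x z" using g1(4) g2(4) by (intro reverse_triangle ll_imp_le)
  then have tri: "rlen a + rlen b \<le> rlen c" unfolding l using pos by (simp add: ennreal_plus [symmetric] del: ennreal_plus)
  show law: "1 \<le> hinge_law (K / 4) a b c" by (rule hinge_law_bounds(1) [OF abc small tri])
  \<comment> \<open>The two geodesics and a third side form a triangle in \<open>U\<close>, realised in the model space by a hinge.\<close>
  obtain S where S: "maximising_segment le ell x z S" "S \<subseteq> U"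
    using nbhd g1(7) g2(8) xz D(3) unfolding le_comparison_neighbourhood_def by meson
  have seg1: "maximising_segment le ell x y (G1 ` {s..m})" "maximising_segment le ell y z (G2 ` {m..t})"
    unfolding maximising_segment_def using g1(5) g2(5) by blast+
  have tt: "timelike_triangle K ll le ell x y z (G1 ` {s..m}) (G2 ` {m..t}) S"
    unfolding timelike_triangle_def using g1(4) g2(4) size_boundsI(1) [OF g1(4) g2(4) D(3)] seg1 S(1) by blast
  have sub: "G1 ` {s..m} \<union> G2 ` {m..t} \<union> S \<subseteq> U" using g1(6) g2(6) S(2) by blast
  obtain x' y' z' where e': "e x' y' = ennreal (rlen a)" "e y' z' = ennreal (rlen b)" "e x' z' = ennreal (rlen c)"
    by (rule hinge_exists [OF abc small law])
  have t: "timelike_pair x' y'" "timelike_pair y' z'" "timelike_pair x' z'"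
    using timelike_pair_of_length [OF e'(1) abc(1) conf(1)] timelike_pair_of_length [OF e'(2) abc(2) conf(2)]
      timelike_pair_of_length [OF e'(3) abc(3) conf(3)] .
  note tm = timelike_pair_time [OF t(1)] timelike_pair_time [OF t(2)]
  note fin = diameter_le_top [OF D(1)] diameter_le_top [OF D(2)] diameter_le_top [OF D(3)]
  have zeros: "ell x x = 0" "ell y y = 0" "ell z z = 0" "ell y x = 0" "ell z y = 0" "ell z x = 0"
    using ell_self [OF g1(4) fin(1)] ell_self [OF g2(4) fin(2)] ell_no_return [OF g1(4) fin(1)]
      ell_no_return [OF g2(4) fin(2)] ell_no_return [OF xz fin(3)] by simp_all
  have cv: "comparison_vertices K ell x y z x' y' z'"
    unfolding comparison_vertices_def using tm by (simp add: e' l zeros model_ell_eq_0)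
  have ct: "comparison_triangle K ell x y z x' y' z' (seg x' y' ` {0..1}) (seg y' z' ` {0..1}) (seg x' z' ` {0..1})"
    unfolding comparison_triangle_def maximising_segment_def
    using cv seg_maximising [OF t(1)] seg_maximising [OF t(2)] seg_maximising [OF t(3)] by blast
  have comparison: "model_ell K p' q' \<le> ell p q"
    if "comparison_point K ell x y (G1 ` {s..m}) x' y' (seg x' y' ` {0..1}) p p'"
      "comparison_point K ell y z (G2 ` {m..t}) y' z' (seg y' z' ` {0..1}) q q'" for p q p' q'
    using nbhd tt sub ct that unfolding le_comparison_neighbourhood_def Let_def by blast
  \<comment> \<open>Separations along a maximising side add up, which transfers positions to the comparison side.\<close>
  note sp = geo_split [OF G1 r, folded p_def] and sq = geo_split [OF G2 r', folded q_def]
  have le_p: "ell x p \<le> ell x y" "ell p y \<le> ell x y" and le_q: "ell y q \<le> ell y z" "ell q z \<le> ell y z"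
    unfolding sp(3) sq(3) by simp_all
  define d1 f1 d2 f2 where "d1 = enn2real (ell x p)" and "f1 = enn2real (ell p y)"
    and "d2 = enn2real (ell y q)" and "f2 = enn2real (ell q z)"
  have ft: "ell x p < top" "ell p y < top" "ell y q < top" "ell q z < top"
    using le_p le_q fin by (meson le_less_trans)+
  have real: "ell x p = ennreal d1" "ell p y = ennreal f1" "ell y q = ennreal d2" "ell q z = ennreal f2"
    using ft by (simp_all add: d1_def f1_def d2_def f2_def)
  have dpos: "0 < d1" "0 < f1" "0 < d2" "0 < f2"
    using sp sq ft by (simp_all add: d1_def f1_def d2_def f2_def enn2real_positive_iff ell_pos_iff)
  have sums: "rlen a = d1 + f1" "rlen b = d2 + f2"
    using sp(3) sq(3) dpos pos unfolding l real by (simp_all add: ennreal_plus [symmetric] del: ennreal_plus)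
  obtain a' where a': "0 < a'" "a' \<le> a" "rlen a' = f1" "0 < 1 + K / 4 * a'\<^sup>2"
    by (rule radial_length_surj [OF abc(1) conf(1) dpos(2)]) (use sums dpos in auto)
  obtain b' where b': "0 < b'" "b' \<le> b" "rlen b' = d2" "0 < 1 + K / 4 * b'\<^sup>2"
    by (rule radial_length_surj [OF abc(2) conf(2) dpos(3)]) (use sums dpos in auto)
  obtain p' where p': "p' \<in> seg x' y' ` {0..1}" "e x' p' = ennreal d1" "e p' y' = ennreal (rlen a - d1)" "model_le K x' p'" "model_le K p' y'"
    by (rule seg_point [OF e'(1) abc(1) conf(1) dpos(1)]) (use sums dpos in auto)
  obtain q' where q': "q' \<in> seg y' z' ` {0..1}" "e y' q' = ennreal d2" "e q' z' = ennreal (rlen b - d2)" "model_le K y' q'" "model_le K q' z'"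
    by (rule seg_point [OF e'(2) abc(2) conf(2) dpos(3)]) (use sums dpos in auto)
  have "comparison_point K ell x y (G1 ` {s..m}) x' y' (seg x' y' ` {0..1}) p p'"
    unfolding comparison_point_def using p' real sums r by (auto simp: p_def)
  moreover have "comparison_point K ell y z (G2 ` {m..t}) y' z' (seg y' z' ` {0..1}) q q'"
    unfolding comparison_point_def using q' real sums r' by (auto simp: q_def)
  ultimately have cmp: "e p' q' \<le> ell p q" by (rule comparison)
  have llpq: "ll p q" using sp(2) sq(1) by (rule ll_trans)
  then show "ll (G1 r) (G2 r')" by (simp add: p_def q_def)
  have "ell p q \<le> ell p z" using ell_mono(1) [of p q z] llpq sq(2) ll_imp_le by blast
  also have "ell p z \<le> ell x z" using ell_mono(2) [of x p z] sp g2(4) ll_trans ll_imp_le by blast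
  finally have pq: "ell p q \<le> ell x z" .
  then have pqD: "ell p q < model_diameter K" using D(3) by (rule le_less_trans)
  show "size_bounds K ell y (G1 r) (G2 r')" using size_boundsI(2) [OF sp(2) sq(1) pqD] by (simp add: p_def q_def)
  have pqt: "ell p q < top" by (rule diameter_le_top [OF pqD])
  have pq0: "0 < enn2real (ell p q)" using llpq pqt by (simp add: enn2real_positive_iff ell_pos_iff)
  have pqc: "enn2real (ell p q) \<le> rlen c" using pq pos unfolding l by (intro enn2real_leI) auto
  obtain c' where c': "0 < c'" "c' \<le> c" "rlen c' = enn2real (ell p q)" "0 < 1 + K / 4 * c'\<^sup>2"
    by (rule radial_length_surj [OF abc(3) conf(3) pq0 pqc])
  have lpq: "ell p q = ennreal (rlen c')" using pqt c' by simp
  have m1: "e x' y' \<le> e x' p' + e p' y'" "e y' z' \<le> e y' q' + e q' z'"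
    unfolding e' p' q' using sums dpos by (simp_all add: ennreal_plus [symmetric] del: ennreal_plus)
  have l': "e p' y' = ennreal (rlen a')" "e y' q' = ennreal (rlen b')" using p' q' sums a' b' by auto
  obtain c'' where c'': "0 < c''" "0 < 1 + K / 4 * c''\<^sup>2" "e p' q' = ennreal (rlen c'')"
    "hinge_law (K / 4) a' b' c'' = hinge_law (K / 4) a b c"
    by (rule hinge_law_scale [OF abc conf e' p'(4,5) m1(1) q'(4,5) m1(2) a'(1) b'(1) a'(4) b'(4) l' le_less_trans [OF cmp pqD]])
  have "0 < rlen c'" using pq0 by (simp only: c'(3))
  then have "rlen c'' \<le> rlen c'" using cmp [unfolded c''(3) lpq] by (simp add: ennreal_le_iff)
  then have "c'' \<le> c'" using c' c'' by (subst radial_length_le_iff [of c'' c' "K / 4", symmetric]) auto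
  then have mono: "hinge_law (K / 4) a b c \<le> hinge_law (K / 4) a' b' c'"
    unfolding c''(4) [symmetric] using a' b' c' c'' by (intro hinge_law_mono) auto
  have small': "\<bar>K / 4\<bar> * a'\<^sup>2 \<le> 1/4" "\<bar>K / 4\<bar> * b'\<^sup>2 \<le> 1/4" "\<bar>K / 4\<bar> * c'\<^sup>2 \<le> 1/4"
    using small_mono [OF less_imp_le [OF a'(1)] a'(2) small(1)] small_mono [OF less_imp_le [OF b'(1)] b'(2) small(2)]
      small_mono [OF less_imp_le [OF c'(1)] c'(2) small(3)] .
  have "comparison_angle K ell y p q = arcosh (hinge_law (K / 4) a' b' c')"
  proof (rule comparison_angle_eq [OF a'(1) b'(1) c'(1) small' order.trans [OF law mono]])
    show "ell p y = ennreal (rlen a')" "ell y q = ennreal (rlen b')" using real a' b' by auto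
    show "ell p p = 0" "ell y p = 0" using ell_self(1) [OF sp(2) ft(2)] ell_no_return [OF sp(2) ft(2)] .
    show "ell q q = 0" "ell q y = 0" using ell_self(2) [OF sq(1) ft(3)] ell_no_return [OF sq(1) ft(3)] .
    show "ell q p = 0" by (rule ell_no_return [OF llpq pqt])
  qed (rule lpq zeros(2))+
  then show "arcosh (hinge_law (K / 4) a b c) \<le> comparison_angle K ell y (G1 r) (G2 r')"
    using arcosh_real_mono [OF law mono] by (simp add: p_def q_def)
qed

text \<open>
  All small parameters are admissible in the upper limit defining the angle, and each comparison
  angle there is bounded below by the one of the whole triangle.
\<close>

lemma angle_ge:
  assumes G1: "geo G1 s m x y" and G2: "geo G2 m t y z"
    and abc: "0 < a" "0 < b" "0 < c"
    and small: "\<bar>K / 4\<bar> * a\<^sup>2 \<le> 1/4" "\<bar>K / 4\<bar> * b\<^sup>2 \<le> 1/4" "\<bar>K / 4\<bar> * c\<^sup>2 \<le> 1/4"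
    and l: "ell x y = ennreal (rlen a)" "ell y z = ennreal (rlen b)" "ell x z = ennreal (rlen c)"
  shows "ennreal (arcosh (hinge_law (K / 4) a b c)) \<le> angle K ll ell (\<lambda>r. G1 (m - r)) (\<lambda>r. G2 (m + r))"
proof -
  note key = comparison_angle_ge [OF G1 G2 abc small l]
  define F where "F = at_right (0::real) \<times>\<^sub>F at_right (0::real)"
  define P where "P = {(r, r'). (ll (G1 (m - r)) (G2 (m + r')) \<or> ll (G2 (m + r')) (G1 (m - r))) \<and>
            size_bounds K ell (G1 (m - 0)) (G1 (m - r)) (G2 (m + r'))}"
  have y: "G1 (m - 0) = y" using geo_ends(2) [OF G1] by simp
  have "eventually (\<lambda>r. 0 < r \<and> r < m - s) (at_right 0)" "eventually (\<lambda>r. 0 < r \<and> r < t - m) (at_right 0)"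
    using geo_ends(3) [OF G1] geo_ends(3) [OF G2] unfolding eventually_at_right_field
    by (intro exI [of _ "m - s"] exI [of _ "t - m"]; simp)+
  then have "eventually (\<lambda>x. (0 < fst x \<and> fst x < m - s) \<and> (0 < snd x \<and> snd x < t - m)) F"
    unfolding F_def by (rule eventually_prodI)
  then have ev: "eventually (\<lambda>(r, r'). 0 < r \<and> r < m - s \<and> 0 < r' \<and> r' < t - m) F"
    by (rule eventually_mono) auto
  have "eventually (\<lambda>x. x \<in> P) F"
    using ev
  proof (rule eventually_mono, clarify)
    fix r r' assume "0 < r" "r < m - s" "0 < r'" "r' < t - m"
    then have "s < m - r" "m - r < m" "m < m + r'" "m + r' < t" by auto
    from key(2,3) [OF this] show "(r, r') \<in> P" unfolding P_def y by simp
  qed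
  then have inf: "inf F (principal P) = F" by (simp add: inf_absorb1 le_principal)
  have ge: "eventually (\<lambda>x. ennreal (arcosh (hinge_law (K / 4) a b c)) \<le> (case x of (r, r') \<Rightarrow> ennreal (comparison_angle K ell (G1 (m - 0)) (G1 (m - r)) (G2 (m + r'))))) F"
    using ev
  proof (rule eventually_mono, clarify)
    fix r r' assume "0 < r" "r < m - s" "0 < r'" "r' < t - m"
    then have "s < m - r" "m - r < m" "m < m + r'" "m + r' < t" by auto
    from key(4) [OF this]
    show "ennreal (arcosh (hinge_law (K / 4) a b c)) \<le> ennreal (comparison_angle K ell (G1 (m - 0)) (G1 (m - r)) (G2 (m + r')))"
      unfolding y by (rule ennreal_leI)
  qed
  have "F \<noteq> bot" unfolding F_def by (simp add: prod_filter_eq_bot)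
  from le_Limsup [OF this ge] show ?thesis
    unfolding angle_def F_def [symmetric] P_def [symmetric] inf .
qed

text \<open>
  The defect in the reverse triangle inequality is governed by the angle at the middle vertex:
  that angle is at least the comparison angle, and a comparison triangle with a small angle is
  nearly degenerate.
\<close>

lemma almost_additive:
  assumes G1: "geo G1 s m x y" and G2: "geo G2 m t y z"
    and r0: "0 < r0" "\<bar>K / 4\<bar> * r0\<^sup>2 \<le> 1/4" and xz: "ell x z \<le> ennreal (rlen r0)"
    and ang: "angle K ll ell (\<lambda>r. G1 (m - r)) (\<lambda>r. G2 (m + r)) \<le> ennreal \<theta>" "0 \<le> \<theta>" "\<theta> \<le> 1"
  shows "enn2real (ell x z) \<le> enn2real (ell x y) + enn2real (ell y z) + 4 * \<theta> * enn2real (ell x z)"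
proof -
  note g1 = geo_ends [OF G1] and g2 = geo_ends [OF G2]
  have llxz: "ll x z" using g1(4) g2(4) by (rule ll_trans)
  have tri: "ell x y + ell y z \<le> ell x z" using g1(4) g2(4) by (intro reverse_triangle ll_imp_le)
  have le: "ell x y \<le> ell x z" "ell y z \<le> ell x z" using ell_mono g1(4) g2(4) ll_imp_le by blast+
  have fxz: "ell x z < top" using xz by (rule le_less_trans) simp
  then have fin: "ell x y < top" "ell y z < top" using le by (meson le_less_trans)+
  have conf: "0 < 1 + K / 4 * r0\<^sup>2" using small_conformal_factor(1) [OF r0(2)] by linarith
  have r0n: "0 \<le> rlen r0" using radial_length_nonneg [of r0 "K / 4"] r0 conf by simp
  have le': "ell x y \<le> ennreal (rlen r0)" "ell y z \<le> ennreal (rlen r0)" using le xz by (meson order.trans)+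
  have ub: "enn2real (ell x y) \<le> rlen r0" "enn2real (ell y z) \<le> rlen r0" "enn2real (ell x z) \<le> rlen r0"
    using le' xz r0n by (auto intro: enn2real_leI)
  have pos: "0 < enn2real (ell x y)" "0 < enn2real (ell y z)" "0 < enn2real (ell x z)"
    using g1(4) g2(4) llxz fin fxz by (auto simp: enn2real_positive_iff ell_pos_iff)
  obtain a where a: "0 < a" "a \<le> r0" "rlen a = enn2real (ell x y)" by (rule radial_length_surj [OF r0(1) conf pos(1) ub(1)])
  obtain b where b: "0 < b" "b \<le> r0" "rlen b = enn2real (ell y z)" by (rule radial_length_surj [OF r0(1) conf pos(2) ub(2)])
  obtain c where c: "0 < c" "c \<le> r0" "rlen c = enn2real (ell x z)" by (rule radial_length_surj [OF r0(1) conf pos(3) ub(3)])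
  have l: "ell x y = ennreal (rlen a)" "ell y z = ennreal (rlen b)" "ell x z = ennreal (rlen c)"
    using fin fxz by (simp_all add: a b c)
  have small: "\<bar>K / 4\<bar> * a\<^sup>2 \<le> 1/4" "\<bar>K / 4\<bar> * b\<^sup>2 \<le> 1/4" "\<bar>K / 4\<bar> * c\<^sup>2 \<le> 1/4"
    using small_mono [OF less_imp_le [OF a(1)] a(2) r0(2)] small_mono [OF less_imp_le [OF b(1)] b(2) r0(2)]
      small_mono [OF less_imp_le [OF c(1)] c(2) r0(2)] .
  have tri': "rlen a + rlen b \<le> rlen c"
  proof -
    have "0 < rlen a" "0 < rlen b" "0 < rlen c" using pos by (simp_all only: a(3) b(3) c(3))
    then show ?thesis using tri [unfolded l] by (simp add: ennreal_plus [symmetric] del: ennreal_plus)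
  qed
  note law = hinge_law_bounds [OF a(1) b(1) c(1) small tri']
  have "ennreal (arcosh (hinge_law (K / 4) a b c)) \<le> ennreal \<theta>"
    using angle_ge [OF G1 G2 a(1) b(1) c(1) small l] ang(1) by (rule order.trans)
  then have "arcosh (hinge_law (K / 4) a b c) \<le> \<theta>" using ang(2) by (simp add: ennreal_le_iff)
  then have "cosh (arcosh (hinge_law (K / 4) a b c)) \<le> cosh \<theta>"
    using law(1) ang(2) by (subst cosh_real_nonneg_le_iff) auto
  then have "hinge_law (K / 4) a b c - 1 \<le> \<theta>" using law(1) cosh_minus_one_le [OF ang(2,3)] by simp
  then have "4 * (hinge_law (K / 4) a b c - 1) * rlen c \<le> 4 * \<theta> * rlen c" using pos c(3) by (intro mult_right_mono) auto
  then show ?thesis using law(2) unfolding a(3) b(3) c(3) by linarith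
qed

end

section \<open>Inscribed polygons and total curvature\<close>

lemma angle_cong:
  fixes \<alpha> \<alpha>' \<beta> \<beta>' :: "real \<Rightarrow> 'a"
  assumes \<delta>: "0 < \<delta>" and eq: "\<And>r. 0 \<le> r \<Longrightarrow> r < \<delta> \<Longrightarrow> \<alpha> r = \<alpha>' r" "\<And>r. 0 \<le> r \<Longrightarrow> r < \<delta> \<Longrightarrow> \<beta> r = \<beta>' r"
  shows "angle K ll ell \<alpha> \<beta> = angle K ll ell \<alpha>' \<beta>'"
proof -
  define F where "F = at_right (0::real) \<times>\<^sub>F at_right (0::real)"
  define P where "P \<alpha> \<beta> = {(s, t). (ll (\<alpha> s) (\<beta> t) \<or> ll (\<beta> t) (\<alpha> s)) \<and> size_bounds K ell (\<alpha> 0) (\<alpha> s) (\<beta> t)}" for \<alpha> \<beta> :: "real \<Rightarrow> 'a"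
  have e: "eventually (\<lambda>r. 0 < r \<and> r < \<delta>) (at_right 0)"
    unfolding eventually_at_right_field using \<delta> by (intro exI [of _ \<delta>]) simp
  have "eventually (\<lambda>x. (0 < fst x \<and> fst x < \<delta>) \<and> (0 < snd x \<and> snd x < \<delta>)) F"
    unfolding F_def by (rule eventually_prodI [OF e e])
  then have ev: "eventually (\<lambda>(s, t). \<alpha> s = \<alpha>' s \<and> \<beta> t = \<beta>' t) F"
    by (rule eventually_mono) (auto intro!: eq)
  have zero: "\<alpha> 0 = \<alpha>' 0" by (rule eq(1)) (use \<delta> in auto)
  have evP: "eventually (\<lambda>x. x \<in> P \<alpha> \<beta> \<longleftrightarrow> x \<in> P \<alpha>' \<beta>') F"
    using ev by (rule eventually_mono) (auto simp: P_def zero)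
  have "inf F (principal (P \<alpha> \<beta>)) = inf F (principal (P \<alpha>' \<beta>'))"
  proof (rule filter_eqI)
    fix Q
    show "eventually Q (inf F (principal (P \<alpha> \<beta>))) \<longleftrightarrow> eventually Q (inf F (principal (P \<alpha>' \<beta>')))"
      unfolding eventually_inf_principal
      by (rule eventually_subst) (use evP in \<open>rule eventually_mono, auto\<close>)
  qed
  moreover have "Limsup (inf F (principal (P \<alpha>' \<beta>'))) (\<lambda>(s, t). ennreal (comparison_angle K ell (\<alpha> 0) (\<alpha> s) (\<beta> t)))
      = Limsup (inf F (principal (P \<alpha>' \<beta>'))) (\<lambda>(s, t). ennreal (comparison_angle K ell (\<alpha>' 0) (\<alpha>' s) (\<beta>' t)))"
  proof (rule Limsup_eq)
    show "eventually (\<lambda>x. (case x of (s, t) \<Rightarrow> ennreal (comparison_angle K ell (\<alpha> 0) (\<alpha> s) (\<beta> t))) = (case x of (s, t) \<Rightarrow> ennreal (comparison_angle K ell (\<alpha>' 0) (\<alpha>' s) (\<beta>' t)))) (inf F (principal (P \<alpha>' \<beta>')))"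
      unfolding eventually_inf_principal using ev by (rule eventually_mono) (auto simp: zero)
  qed
  ultimately show ?thesis unfolding angle_def F_def [symmetric] P_def [symmetric] by simp
qed

lemma maximising_geodesic_cong:
  assumes "\<And>r. r \<in> {a..b} \<Longrightarrow> f r = g r"
  shows "maximising_geodesic le ell f a b x y \<longleftrightarrow> maximising_geodesic le ell g a b x y"
proof -
  have gen: "maximising_geodesic le ell g a b x y"
    if eq: "\<And>r. r \<in> {a..b} \<Longrightarrow> f r = g r" and f: "maximising_geodesic le ell f a b x y" for f g
  proof -
    have ab: "a < b" and c: "continuous_on {a..b} f" and le: "\<And>s t. s \<in> {a..b} \<Longrightarrow> t \<in> {a..b} \<Longrightarrow> s < t \<Longrightarrow> le (f s) (f t)"
      and ends: "f a = x" "f b = y" "ell_length ell f a b = ell x y"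
      using f by (auto simp: maximising_geodesic_def causal_curve_def)
    have c': "continuous_on {a..b} g" using c by (rule continuous_on_eq) (rule eq)
    have sums: "(\<Sum>i<n. ell (f (t i)) (f (t (Suc i)))) = (\<Sum>i<n. ell (g (t i)) (g (t (Suc i))))" if p: "interval_partition a b n t" for n t
      using interval_partition_range [OF p] eq by (intro sum.cong) auto
    have "ell_length ell f a b = ell_length ell g a b"
      unfolding ell_length_def
    proof (intro arg_cong [of _ _ Inf] Collect_cong ex_cong1)
      fix x n t
      show "(x = (\<Sum>i<n. ell (f (t i)) (f (t (Suc i)))) \<and> interval_partition a b n t)
          \<longleftrightarrow> (x = (\<Sum>i<n. ell (g (t i)) (g (t (Suc i)))) \<and> interval_partition a b n t)"
        using sums [of n t] by auto
    qed
    moreover have "le (g s) (g t)" if "s \<in> {a..b}" "t \<in> {a..b}" "s < t" for s t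
      using le [OF that] eq [OF that(1)] eq [OF that(2)] by simp
    ultimately show ?thesis unfolding maximising_geodesic_def causal_curve_def
      using ab c' ends eq [of a] eq [of b] by auto
  qed
  show ?thesis using gen [of f g] gen [of g f] assms by metis
qed

context comparison_space
begin

lemma timelike_join:
  assumes f: "timelike_curve ll f a b" and g: "timelike_curve ll g b c" and j: "f b = g b"
  shows "timelike_curve ll (\<lambda>r. if r \<le> b then f r else g r) a c"
proof -
  let ?h = "\<lambda>r. if r \<le> b then f r else g r"
  have ab: "a < b" "b < c" "continuous_on {a..b} f" "continuous_on {b..c} g"
    and fl: "\<And>s t. s \<in> {a..b} \<Longrightarrow> t \<in> {a..b} \<Longrightarrow> s < t \<Longrightarrow> ll (f s) (f t)"
    and gl: "\<And>s t. s \<in> {b..c} \<Longrightarrow> t \<in> {b..c} \<Longrightarrow> s < t \<Longrightarrow> ll (g s) (g t)"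
    using f g by (auto simp: timelike_curve_def)
  have "continuous_on ({a..b} \<union> {b..c}) ?h"
    by (intro continuous_on_cases) (use ab j in auto)
  moreover have "{a..b} \<union> {b..c} = {a..c}" using ab by auto
  moreover have "ll (?h s) (?h t)" if s: "s \<in> {a..c}" "t \<in> {a..c}" "s < t" for s t
  proof -
    consider "t \<le> b" | "b < s" | "s = b" "b < t" | "s < b" "b < t" using s by linarith
    then show ?thesis
    proof cases
      case 1 then show ?thesis using fl [of s t] s by simp
    next
      case 2 then show ?thesis using gl [of s t] s by simp
    next
      case 3 then show ?thesis using gl [of b t] s j by simp
    next
      case 4
      then have "ll (f s) (f b)" "ll (g b) (g t)" using fl [of s b] gl [of b t] s by auto
      then show ?thesis using 4 j ll_trans [of "f s" "f b" "g t"] by simp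
    qed
  qed
  ultimately show ?thesis using ab by (simp add: timelike_curve_def)
qed

text \<open>
  The pieces are concatenated one after the other, and chronology across a break point follows by
  transitivity.
\<close>

lemma polygon_exists:
  assumes "\<And>i. i \<le> n \<Longrightarrow> timelike_curve ll (g i) (t i) (t (Suc i))"
    and "\<And>i. i < n \<Longrightarrow> g i (t (Suc i)) = g (Suc i) (t (Suc i))"
  shows "\<exists>\<sigma>. timelike_curve ll \<sigma> (t 0) (t (Suc n)) \<and> (\<forall>i\<le>n. \<forall>r\<in>{t i..t (Suc i)}. \<sigma> r = g i r)"
  using assms
proof (induction n)
  case 0 then show ?case by (intro exI [of _ "g 0"]) auto
next
  case (Suc n)
  from Suc.IH [OF Suc.prems] obtain \<sigma> where \<sigma>: "timelike_curve ll \<sigma> (t 0) (t (Suc n))" "\<forall>i\<le>n. \<forall>r\<in>{t i..t (Suc i)}. \<sigma> r = g i r"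
    by auto
  let ?b = "t (Suc n)"
  have steps: "t i < t (Suc i)" if "i \<le> Suc n" for i using Suc.prems(1) [OF that] by (simp add: timelike_curve_def)
  have tle: "t i \<le> ?b" if "i \<le> Suc n" for i
    using that
  proof (induction rule: inc_induct)
    case (step m) then show ?case using steps [of m] by simp
  qed simp
  have jn: "\<sigma> ?b = g (Suc n) ?b" 
    using \<sigma>(2) [rule_format, of n "t (Suc n)"] steps [of n] Suc.prems(2) [of n] by simp
  let ?h = "\<lambda>r. if r \<le> ?b then \<sigma> r else g (Suc n) r"
  have "timelike_curve ll ?h (t 0) (t (Suc (Suc n)))"
    by (rule timelike_join [OF \<sigma>(1) Suc.prems(1) jn]) simp
  moreover have "?h r = g i r" if i: "i \<le> Suc n" and r: "r \<in> {t i..t (Suc i)}" for i r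
  proof (cases "i \<le> n")
    case True
    then have "r \<le> ?b" using r tle [of "Suc i"] by simp
    then show ?thesis using True \<sigma>(2) r by simp
  next
    case False
    then have "i = Suc n" using i by simp
    then show ?thesis using r jn by (cases "r = ?b") auto
  qed
  ultimately show ?case by blast
qed

text \<open>
  A fixed choice of the geodesic between any two points of the curve. The angle between two
  adjacent sides thus depends on three parameters only, and polygons on adjacent intervals can be
  joined.
\<close>

definition side :: "(real \<Rightarrow> 'a) \<Rightarrow> real \<Rightarrow> real \<Rightarrow> real \<Rightarrow> 'a" where
  "side \<gamma> s t = (SOME G. geo G s t (\<gamma> s) (\<gamma> t))"

definition turn :: "(real \<Rightarrow> 'a) \<Rightarrow> real \<Rightarrow> real \<Rightarrow> real \<Rightarrow> ennreal" where
  "turn \<gamma> s m t = angle K ll ell (\<lambda>r. side \<gamma> s m (m - r)) (\<lambda>r. side \<gamma> m t (m + r))"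

end

locale comparison_curve = comparison_space +
  fixes \<gamma> :: "real \<Rightarrow> 'a" and a b :: real
  assumes curve: "timelike_curve ll \<gamma> a b"
    and inU: "\<gamma> ` {a..b} \<subseteq> U"
    and short: "ell (\<gamma> a) (\<gamma> b) < model_diameter K"
begin

lemma curve_ll: "a \<le> s \<Longrightarrow> s < t \<Longrightarrow> t \<le> b \<Longrightarrow> ll (\<gamma> s) (\<gamma> t)"
  using curve by (auto simp: timelike_curve_def)

lemma curve_le: "a \<le> s \<Longrightarrow> s \<le> t \<Longrightarrow> t \<le> b \<Longrightarrow> le (\<gamma> s) (\<gamma> t)"
  using curve_ll [of s t] ll_imp_le le_refl by (cases "s = t") auto

lemma curve_ell_mono:
  assumes "a \<le> s'" "s' \<le> s" "s \<le> t" "t \<le> t'" "t' \<le> b"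
  shows "ell (\<gamma> s) (\<gamma> t) \<le> ell (\<gamma> s') (\<gamma> t')"
proof -
  have "ell (\<gamma> s) (\<gamma> t) \<le> ell (\<gamma> s') (\<gamma> t)" using assms by (intro ell_mono curve_le) auto
  also have "\<dots> \<le> ell (\<gamma> s') (\<gamma> t')" using assms by (intro ell_mono curve_le) auto
  finally show ?thesis .
qed

lemma curve_short:
  assumes "a \<le> s" "s \<le> t" "t \<le> b"
  shows "ell (\<gamma> s) (\<gamma> t) < model_diameter K" "ell (\<gamma> s) (\<gamma> t) < top"
proof -
  show "ell (\<gamma> s) (\<gamma> t) < model_diameter K"
    using curve_ell_mono [of a s t b] assms short by (auto intro: le_less_trans)
  then show "ell (\<gamma> s) (\<gamma> t) < top" by (rule diameter_le_top)
qed

lemma curve_self: "s \<in> {a..b} \<Longrightarrow> ell (\<gamma> s) (\<gamma> s) = 0"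
proof -
  assume s: "s \<in> {a..b}"
  have ab: "a < b" using curve by (simp add: timelike_curve_def)
  show ?thesis
  proof (cases "s < b")
    case True then show ?thesis using ell_self(1) [OF curve_ll [of s b] curve_short(2) [of s b]] s by auto
  next
    case False then show ?thesis using ell_self(2) [OF curve_ll [of a s] curve_short(2) [of a s]] s ab by auto
  qed
qed

lemma side_geo:
  assumes "a \<le> s" "s < t" "t \<le> b"
  shows "geo (side \<gamma> s t) s t (\<gamma> s) (\<gamma> t)"
proof -
  have "\<gamma> s \<in> U" "\<gamma> t \<in> U" using inU assms by auto
  then obtain G where "geo G s t (\<gamma> s) (\<gamma> t)"
    using geo_exists [OF _ _ curve_ll [OF assms] curve_short(1) [of s t] assms(2)] assms by auto
  then show ?thesis unfolding side_def by (rule someI [where P = "\<lambda>G. geo G s t (\<gamma> s) (\<gamma> t)"])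
qed

text \<open>
  The polygon consists of the chosen sides. Its angles are those of the sides, since the angle
  depends only on the germs of the two curves.
\<close>

lemma inscribed_polygon:
  assumes p: "interval_partition a b n t"
  obtains \<sigma> where "timelike_poly_segment ll le ell \<sigma> a b n t" "inscribed \<sigma> n t \<gamma>"
    "total_rotation K ll ell \<sigma> n t = rotation_sum (turn \<gamma>) n t"
proof -
  have ab: "a < b" using curve by (simp add: timelike_curve_def)
  have "n \<noteq> 0" using p ab unfolding interval_partition_def by (metis less_irrefl)
  then obtain k where n: "n = Suc k" by (cases n) auto
  have t: "t 0 = a" "t n = b" "\<And>i. i < n \<Longrightarrow> t i < t (Suc i)" "\<And>i. i \<le> n \<Longrightarrow> a \<le> t i \<and> t i \<le> b"
    using p interval_partition_range [OF p] by (auto simp: interval_partition_def)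
  define g where "g i = side \<gamma> (t i) (t (Suc i))" for i
  have g: "geo (g i) (t i) (t (Suc i)) (\<gamma> (t i)) (\<gamma> (t (Suc i)))" if "i < n" for i
    unfolding g_def using t(3) [OF that] t(4) [of i] t(4) [of "Suc i"] that by (intro side_geo) auto
  have "\<exists>\<sigma>. timelike_curve ll \<sigma> (t 0) (t (Suc k)) \<and> (\<forall>i\<le>k. \<forall>r\<in>{t i..t (Suc i)}. \<sigma> r = g i r)"
  proof (rule polygon_exists)
    show "timelike_curve ll (g i) (t i) (t (Suc i))" if "i \<le> k" for i using g [of i] that n by (auto simp: geo_def)
    show "g i (t (Suc i)) = g (Suc i) (t (Suc i))" if "i < k" for i
      using geo_ends(2) [OF g [of i]] geo_ends(1) [OF g [of "Suc i"]] that n by simp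
  qed
  then obtain \<sigma> where \<sigma>: "timelike_curve ll \<sigma> a b" "\<And>i r. i < n \<Longrightarrow> r \<in> {t i..t (Suc i)} \<Longrightarrow> \<sigma> r = g i r"
    using t n by (auto simp: less_Suc_eq_le)
  have ends: "\<sigma> (t i) = \<gamma> (t i)" "\<sigma> (t (Suc i)) = \<gamma> (t (Suc i))" if "i < n" for i
    using \<sigma>(2) [OF that, of "t i"] \<sigma>(2) [OF that, of "t (Suc i)"] t(3) [OF that] geo_ends(1,2) [OF g [OF that]] by auto
  have "maximising_geodesic le ell \<sigma> (t i) (t (Suc i)) (\<sigma> (t i)) (\<sigma> (t (Suc i)))" if "i < n" for i
    using maximising_geodesic_cong [of "t i" "t (Suc i)" \<sigma> "g i"] \<sigma>(2) [OF that] geo_ends(5) [OF g [OF that]] ends [OF that] by simp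
  moreover have "\<not> \<sigma> constant_on {t i..t (Suc i)}" if i: "i < n" for i
  proof
    assume "\<sigma> constant_on {t i..t (Suc i)}"
    then have "\<sigma> (t i) = \<sigma> (t (Suc i))" using t(3) [OF i] unfolding constant_on_def by force
    then have "ll (\<gamma> (t i)) (\<gamma> (t i))" using geo_ends(4) [OF g [OF i]] ends [OF i] by simp
    then show False using curve_self [of "t i"] t(4) [of i] i by (simp add: ell_pos_iff [symmetric])
  qed
  ultimately have "timelike_poly_segment ll le ell \<sigma> a b n t"
    unfolding timelike_poly_segment_def using \<sigma>(1) p by blast
  moreover have "inscribed \<sigma> n t \<gamma>" unfolding inscribed_def
  proof (intro allI impI)
    fix i assume "i \<le> n"
    then show "\<sigma> (t i) = \<gamma> (t i)" using ends(1) [of i] ends(2) [of k] n by (cases "i < n") auto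
  qed
  moreover have "total_rotation K ll ell \<sigma> n t = rotation_sum (turn \<gamma>) n t"
    unfolding total_rotation_def rotation_sum_def
  proof (rule sum.cong [OF refl])
    fix i assume i: "i \<in> {1..<n}"
    then obtain j where j: "i = Suc j" "j < n" "i < n" by (cases i) auto
    show "angle K ll ell (\<lambda>s. \<sigma> (t i - s)) (\<lambda>s. \<sigma> (t i + s)) = turn \<gamma> (t (i - 1)) (t i) (t (Suc i))"
      unfolding turn_def
    proof (rule angle_cong [of "min (t i - t j) (t (Suc i) - t i)"])
      show "0 < min (t i - t j) (t (Suc i) - t i)" using t(3) [OF j(2)] t(3) [OF j(3)] j(1) by simp
      fix r assume r: "0 \<le> r" "r < min (t i - t j) (t (Suc i) - t i)"
      show "\<sigma> (t i - r) = side \<gamma> (t (i - 1)) (t i) (t i - r)"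
        using \<sigma>(2) [OF j(2), of "t i - r"] r j(1) by (simp add: g_def)
      show "\<sigma> (t i + r) = side \<gamma> (t i) (t (Suc i)) (t i + r)"
        using \<sigma>(2) [OF j(3), of "t i + r"] r by (simp add: g_def)
    qed
  qed
  ultimately show ?thesis by (rule that)
qed

text \<open>
  The suprema over polygons of mesh size below \<open>\<epsilon>\<close> decrease with \<open>\<epsilon>\<close>, so their limit is their
  infimum; if it is finite, one of them is finite.
\<close>

lemma finite_total_curvature:
  assumes "total_curvature K ll le ell \<gamma> a b < \<infinity>"
  obtains \<epsilon> C where "0 < \<epsilon>" "0 \<le> C"
    "\<And>n t. interval_partition a b n t \<Longrightarrow> (\<And>i. i < n \<Longrightarrow> t (Suc i) - t i < \<epsilon>) \<Longrightarrow> rotation_sum (turn \<gamma>) n t \<le> ennreal C"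
proof -
  define T where "T \<epsilon> = Sup {total_rotation K ll ell \<sigma> n t | \<sigma> n t.
       timelike_poly_segment ll le ell \<sigma> a b n t \<and> inscribed \<sigma> n t \<gamma> \<and> mesh_size n t < \<epsilon>}" for \<epsilon>
  have mono: "T \<epsilon> \<le> T \<epsilon>'" if "\<epsilon> \<le> \<epsilon>'" for \<epsilon> \<epsilon>' :: real
    unfolding T_def using that by (intro Sup_subset_mono) (auto intro: less_le_trans)
  define I where "I = (INF \<epsilon>\<in>{0<..}. T \<epsilon>)"
  have "(T \<longlongrightarrow> I) (at_right 0)"
  proof (rule order_tendstoI)
    fix y assume "y < I"
    moreover have "eventually (\<lambda>\<epsilon>::real. 0 < \<epsilon>) (at_right 0)" by (rule eventually_at_right_less)
    ultimately show "eventually (\<lambda>\<epsilon>. y < T \<epsilon>) (at_right 0)"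
      by (elim eventually_mono) (auto simp: I_def intro: less_le_trans INF_lower)
  next
    fix y assume "I < y"
    then obtain \<epsilon>0 where "0 < \<epsilon>0" "T \<epsilon>0 < y" unfolding I_def by (auto simp: INF_less_iff)
    then show "eventually (\<lambda>\<epsilon>. T \<epsilon> < y) (at_right 0)"
      unfolding eventually_at_right_field using mono by (meson le_less_trans less_imp_le)
  qed
  then have "Lim (at_right 0) T = I" by (intro tendsto_Lim) auto
  then have "I < \<infinity>" using assms unfolding total_curvature_def T_def [symmetric, abs_def] by simp
  then obtain \<epsilon> where \<epsilon>: "0 < \<epsilon>" "T \<epsilon> < \<infinity>" unfolding I_def by (auto simp: INF_less_iff)
  show ?thesis
  proof (rule that [OF \<epsilon>(1), of "enn2real (T \<epsilon>)"])
    fix n t assume p: "interval_partition a b n t" and m: "\<And>i. i < n \<Longrightarrow> t (Suc i) - t i < \<epsilon>"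
    have "a < b" using curve by (simp add: timelike_curve_def)
    then have "n \<noteq> 0" using p unfolding interval_partition_def by (metis less_irrefl)
    then have mesh: "mesh_size n t < \<epsilon>" unfolding mesh_size_def using m by (subst Max_less_iff) auto
    obtain \<sigma> where \<sigma>: "timelike_poly_segment ll le ell \<sigma> a b n t" "inscribed \<sigma> n t \<gamma>"
      "total_rotation K ll ell \<sigma> n t = rotation_sum (turn \<gamma>) n t" by (rule inscribed_polygon [OF p])
    have "rotation_sum (turn \<gamma>) n t \<le> T \<epsilon>"
      unfolding T_def \<sigma>(3) [symmetric] using \<sigma>(1,2) mesh by (intro Sup_upper) blast
    also have "T \<epsilon> = ennreal (enn2real (T \<epsilon>))" using \<epsilon>(2) by simp
    finally show "rotation_sum (turn \<gamma>) n t \<le> ennreal (enn2real (T \<epsilon>))" .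
  qed simp
qed

text \<open>
  On an interval shorter than \<open>\<epsilon>\<close> every partition is fine. Completing it by fine partitions of the
  two remaining intervals yields a fine partition of the whole interval, whose rotation is at
  least as large.
\<close>

lemma rotation_bounded:
  assumes \<epsilon>: "0 < \<epsilon>" and C: "\<And>n t. interval_partition a b n t \<Longrightarrow> (\<And>i. i < n \<Longrightarrow> t (Suc i) - t i < \<epsilon>) \<Longrightarrow> rotation_sum (turn \<gamma>) n t \<le> ennreal C"
    and st: "a < s" "s < t" "t < b" "t - s < \<epsilon>"
  shows "rotation (turn \<gamma>) s t \<le> ennreal C"
  unfolding rotation_def
proof (rule SUP_least, clarify)
  fix n \<tau> assume p: "interval_partition s t n \<tau>"
  obtain n1 t1 where 1: "interval_partition a s n1 t1" "\<And>i. i < n1 \<Longrightarrow> t1 (Suc i) - t1 i < \<epsilon>"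
    by (rule fine_partition_exists [OF st(1) \<epsilon>]) blast
  obtain n2 t2 where 2: "interval_partition t b n2 t2" "\<And>i. i < n2 \<Longrightarrow> t2 (Suc i) - t2 i < \<epsilon>"
    by (rule fine_partition_exists [OF st(3) \<epsilon>]) blast
  have m: "\<tau> (Suc i) - \<tau> i < \<epsilon>" if "i < n" for i
    using interval_partition_range [OF p, of i] interval_partition_range [OF p, of "Suc i"] that st by auto
  note p2 = interval_partition_join [OF p 2(1)]
  note p1 = interval_partition_join [OF 1(1) p2]
  have s2: "join_partition n \<tau> t2 (Suc i) - join_partition n \<tau> t2 i < \<epsilon>" if "i < n + n2" for i
    by (rule join_partition_steps [OF p 2(1), of "\<lambda>x y. y - x < \<epsilon>"]) (use m 2(2) that in auto)
  have s1: "join_partition n1 t1 (join_partition n \<tau> t2) (Suc i) - join_partition n1 t1 (join_partition n \<tau> t2) i < \<epsilon>" if "i < n1 + (n + n2)" for i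
    by (rule join_partition_steps [OF 1(1) p2, of "\<lambda>x y. y - x < \<epsilon>"]) (use s2 1(2) that in auto)
  have "rotation_sum (turn \<gamma>) n \<tau> \<le> rotation_sum (turn \<gamma>) n \<tau> + rotation_sum (turn \<gamma>) n2 t2" by simp
  also have "\<dots> \<le> rotation_sum (turn \<gamma>) (n + n2) (join_partition n \<tau> t2)" by (rule rotation_sum_join [OF p 2(1)])
  also have "\<dots> \<le> rotation_sum (turn \<gamma>) n1 t1 + rotation_sum (turn \<gamma>) (n + n2) (join_partition n \<tau> t2)" by simp
  also have "\<dots> \<le> rotation_sum (turn \<gamma>) (n1 + (n + n2)) (join_partition n1 t1 (join_partition n \<tau> t2))" by (rule rotation_sum_join [OF 1(1) p2])
  also have "\<dots> \<le> ennreal C" by (rule C [OF p1 s1])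
  finally show "rotation_sum (turn \<gamma>) n \<tau> \<le> ennreal C" .
qed

text \<open>
  With \<open>c = 4\<close> and rotation at most \<open>1 / 32\<close>, the loss factor \<open>1 - 4 c R\<close> of the halving estimate
  is at least \<open>1 / 2\<close>.
\<close>

lemma local_length_pos:
  assumes st: "a \<le> s" "s < t" "t \<le> b"
    and r0: "0 < r0" "\<bar>K / 4\<bar> * r0\<^sup>2 \<le> 1/4" and small: "ell (\<gamma> s) (\<gamma> t) \<le> ennreal (rlen r0)"
    and rot: "rotation (turn \<gamma>) s t \<le> ennreal (1/32)"
    and w: "mono w" "\<And>i. w i \<in> {s..t}" "w 0 = s" "w n = t"
  shows "enn2real (ell (\<gamma> s) (\<gamma> t)) / 2 \<le> (\<Sum>i<n. enn2real (ell (\<gamma> (w i)) (\<gamma> (w (Suc i)))))"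
proof -
  define d where "d x y = enn2real (ell (\<gamma> x) (\<gamma> y))" for x y
  define R where "R x y = enn2real (rotation (turn \<gamma>) x y)" for x y
  have in': "a \<le> x" "x \<le> b" if "x \<in> {s..t}" for x using that st by auto
  have rot_mono: "rotation (turn \<gamma>) x y \<le> ennreal (1/32)" if "x \<in> {s..t}" "y \<in> {s..t}" "x \<le> y" for x y
  proof -
    have "rotation (turn \<gamma>) s x + rotation (turn \<gamma>) x y \<le> rotation (turn \<gamma>) s y"
      "rotation (turn \<gamma>) s y + rotation (turn \<gamma>) y t \<le> rotation (turn \<gamma>) s t"
      using that by (auto intro!: rotation_superadditive)
    moreover have "rotation (turn \<gamma>) x y \<le> rotation (turn \<gamma>) s x + rotation (turn \<gamma>) x y"
      "rotation (turn \<gamma>) s y \<le> rotation (turn \<gamma>) s y + rotation (turn \<gamma>) y t" by simp_all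
    ultimately show ?thesis using rot by (meson order.trans)
  qed
  have Rr: "rotation (turn \<gamma>) x y = ennreal (R x y)" if "x \<in> {s..t}" "y \<in> {s..t}" "x \<le> y" for x y
    using le_less_trans [OF rot_mono [OF that], of top] by (simp add: R_def)
  have dr: "ell (\<gamma> x) (\<gamma> y) = ennreal (d x y)" if "x \<in> {s..t}" "y \<in> {s..t}" "x \<le> y" for x y
    using curve_short(2) [of x y] in' that by (simp add: d_def)
  have nn: "0 \<le> d x y" "0 \<le> R x y" for x y by (simp_all add: d_def R_def)
  have R32: "R x y \<le> 1/32" if "x \<in> {s..t}" "y \<in> {s..t}" "x \<le> y" for x y
    using rot_mono [OF that] by (simp add: Rr [OF that])
  have "d (w 0) (w n) * (1 - 4 * 4 * R (w 0) (w n)) \<le> (\<Sum>l=0..<n. d (w l) (w (Suc l)))"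
  proof (rule halving_bound [where S = "{s..t}" and d = d and R = R and c = 4])
    show "d x x = 0" if "x \<in> {s..t}" for x using curve_self [of x] that st by (simp add: d_def)
    show "d x m + d m y \<le> d x y" if "x \<in> {s..t}" "m \<in> {s..t}" "y \<in> {s..t}" "x \<le> m" "m \<le> y" for x m y
    proof -
      have "ell (\<gamma> x) (\<gamma> m) + ell (\<gamma> m) (\<gamma> y) \<le> ell (\<gamma> x) (\<gamma> y)"
        using that in' by (intro reverse_triangle curve_le) auto
      then show ?thesis using dr [of x m] dr [of m y] dr [of x y] that nn by (simp add: ennreal_plus [symmetric] del: ennreal_plus)
    qed
    show "R x m + R m y \<le> R x y" if "x \<in> {s..t}" "m \<in> {s..t}" "y \<in> {s..t}" "x \<le> m" "m \<le> y" for x m y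
      using rotation_superadditive [of x m y "turn \<gamma>"] Rr [of x m] Rr [of m y] Rr [of x y] that nn
      by (simp add: ennreal_plus [symmetric] del: ennreal_plus)
    show "d x y \<le> d x m + d m y + 4 * R x y * d x y" if "x \<in> {s..t}" "m \<in> {s..t}" "y \<in> {s..t}" "x < m" "m < y" for x m y
      unfolding d_def
    proof (rule almost_additive [OF side_geo side_geo r0])
      show "a \<le> x" "x < m" "m \<le> b" "a \<le> m" "m < y" "y \<le> b" using that in' by auto
      have "ell (\<gamma> x) (\<gamma> y) \<le> ell (\<gamma> s) (\<gamma> t)" using that st by (intro curve_ell_mono) auto
      then show "ell (\<gamma> x) (\<gamma> y) \<le> ennreal (rlen r0)" using small by (rule order.trans)
      show "angle K ll ell (\<lambda>r. side \<gamma> x m (m - r)) (\<lambda>r. side \<gamma> m y (m + r)) \<le> ennreal (R x y)"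
        using rotation_triple [of x m y "turn \<gamma>"] that Rr [of x y] by (simp add: turn_def)
      show "R x y \<le> 1" using R32 [of x y] that by simp
    qed (rule nn)
  qed (use w nn in auto)
  moreover have "d s t * (1/2) \<le> d s t * (1 - 4 * 4 * R s t)"
    using R32 [of s t] st nn by (intro mult_left_mono) auto
  ultimately show ?thesis using w by (simp add: d_def atLeast0LessThan)
qed

text \<open>
  A partition of the large interval is clamped to \<open>[s, t]\<close>, which decreases the separation over
  every step by monotonicity. Steps outside \<open>[s, t]\<close> become trivial, so the clamped sequence is
  monotone but not strictly.
\<close>

lemma ell_length_pos:
  assumes st: "a \<le> t1" "t1 \<le> s" "s < t" "t \<le> t2" "t2 \<le> b"
    and r0: "0 < r0" "\<bar>K / 4\<bar> * r0\<^sup>2 \<le> 1/4" and small: "ell (\<gamma> s) (\<gamma> t) \<le> ennreal (rlen r0)"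
    and rot: "rotation (turn \<gamma>) s t \<le> ennreal (1/32)"
  shows "0 < ell_length ell \<gamma> t1 t2"
proof -
  define D where "D = enn2real (ell (\<gamma> s) (\<gamma> t)) / 2"
  have "0 < D"
    using curve_ll [of s t] curve_short(2) [of s t] st by (simp add: D_def enn2real_positive_iff ell_pos_iff)
  have "ennreal D \<le> ell_length ell \<gamma> t1 t2"
    unfolding ell_length_def
  proof (rule Inf_greatest, clarify)
    fix n \<tau> assume p: "interval_partition t1 t2 n \<tau>"
    define w where "w i = max s (min t (\<tau> (min i n)))" for i
    have \<tau>: "\<tau> i \<le> \<tau> j" if "i \<le> j" "j \<le> n" for i j by (rule interval_partition_mono [OF p that])
    have "mono w" unfolding w_def by (intro monoI max.mono min.mono order_refl \<tau>) auto
    moreover have "w i \<in> {s..t}" for i using st by (auto simp: w_def)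
    moreover have "w 0 = s" "w n = t" using p st by (auto simp: w_def interval_partition_def)
    ultimately have "D \<le> (\<Sum>i<n. enn2real (ell (\<gamma> (w i)) (\<gamma> (w (Suc i)))))"
      unfolding D_def using st by (intro local_length_pos [OF _ st(3) _ r0 small rot]) auto
    then have "ennreal D \<le> ennreal (\<Sum>i<n. enn2real (ell (\<gamma> (w i)) (\<gamma> (w (Suc i)))))" by (rule ennreal_leI)
    also have "\<dots> = (\<Sum>i<n. ennreal (enn2real (ell (\<gamma> (w i)) (\<gamma> (w (Suc i))))))" by (simp add: sum_ennreal)
    also have "\<dots> \<le> (\<Sum>i<n. ell (\<gamma> (\<tau> i)) (\<gamma> (\<tau> (Suc i))))"
    proof (rule sum_mono)
      fix i assume "i \<in> {..<n}"
      then have i: "i < n" by simp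
      have lt: "\<tau> i < \<tau> (Suc i)" using p i by (simp add: interval_partition_def)
      have rng: "t1 \<le> \<tau> i" "\<tau> (Suc i) \<le> t2" using interval_partition_range [OF p, of i] interval_partition_range [OF p, of "Suc i"] i by auto
      have wi: "w i = max s (min t (\<tau> i))" "w (Suc i) = max s (min t (\<tau> (Suc i)))" using i by (auto simp: w_def min_def)
      show "ennreal (enn2real (ell (\<gamma> (w i)) (\<gamma> (w (Suc i))))) \<le> ell (\<gamma> (\<tau> i)) (\<gamma> (\<tau> (Suc i)))"
      proof (cases "w i = w (Suc i)")
        case True
        have "w i \<in> {a..b}" using st unfolding wi by auto
        then show ?thesis using True curve_self [of "w i"] by simp
      next
        case False
        then have "w i < w (Suc i)" "\<tau> i \<le> w i" "w (Suc i) \<le> \<tau> (Suc i)" "a \<le> w i" "w (Suc i) \<le> b"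
          using lt st unfolding wi by (auto simp: max_def min_def split: if_splits)
        then show ?thesis using curve_ell_mono [of "\<tau> i" "w i" "w (Suc i)" "\<tau> (Suc i)"] curve_short(2) [of "w i" "w (Suc i)"] st rng by simp
      qed
    qed
    finally show "ennreal D \<le> (\<Sum>i<n. ell (\<gamma> (\<tau> i)) (\<gamma> (\<tau> (Suc i))))" .
  qed
  then show ?thesis using \<open>0 < D\<close> by (meson ennreal_less_zero_iff less_le_trans)
qed

text \<open>
  The separation from a fixed point of the curve is continuous and vanishes at that point.
\<close>

lemma short_interval:
  assumes "a \<le> t1" "t1 < t2" "t2 \<le> b" "0 < \<epsilon>" "0 < \<rho>"
  obtains s t where "t1 < s" "s < t" "t < t2" "t - s < \<epsilon>" "ell (\<gamma> s) (\<gamma> t) \<le> ennreal \<rho>"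
proof -
  define s where "s = (t1 + t2) / 2"
  have s: "t1 < s" "s < t2" using assms by (auto simp: s_def)
  have cont: "continuous_on {s..t2} \<gamma>"
    using curve assms s by (auto simp: timelike_curve_def intro: continuous_on_subset)
  have "continuous_on {s..t2} (\<lambda>r. enn2real (ell (\<gamma> s) (\<gamma> r)))"
    by (rule ell_continuous_from [OF _ cont]) (use inU assms s curve_short(1) [of s] in auto)
  then have "((\<lambda>r. enn2real (ell (\<gamma> s) (\<gamma> r))) \<longlongrightarrow> enn2real (ell (\<gamma> s) (\<gamma> s))) (at s within {s..t2})"
    using s unfolding continuous_on_def by simp
  then have "((\<lambda>r. enn2real (ell (\<gamma> s) (\<gamma> r))) \<longlongrightarrow> 0) (at s within {s..t2})"
    using curve_self [of s] s assms by simp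
  then have "eventually (\<lambda>r. enn2real (ell (\<gamma> s) (\<gamma> r)) < \<rho>) (at s within {s..t2})"
    using assms(5) by (rule order_tendstoD)
  then obtain \<delta> where \<delta>: "0 < \<delta>"
    "\<And>r. r \<in> {s..t2} \<Longrightarrow> r \<noteq> s \<Longrightarrow> dist r s < \<delta> \<Longrightarrow> enn2real (ell (\<gamma> s) (\<gamma> r)) < \<rho>"
    unfolding eventually_at by blast
  define h where "h = min (min \<delta> \<epsilon>) (t2 - s) / 2"
  have "0 < min (min \<delta> \<epsilon>) (t2 - s)" using \<delta>(1) assms(4) s by simp
  then have "0 < h" "h < min (min \<delta> \<epsilon>) (t2 - s)" unfolding h_def by (simp_all del: min_less_iff_conj)
  then have h: "0 < h" "h < \<delta>" "h < \<epsilon>" "h < t2 - s" by simp_all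
  have less: "enn2real (ell (\<gamma> s) (\<gamma> (s + h))) < \<rho>"
    using h by (intro \<delta>(2)) (simp_all add: dist_real_def)
  have "ell (\<gamma> s) (\<gamma> (s + h)) < top" using h s assms by (intro curve_short(2)) linarith+
  then have "ell (\<gamma> s) (\<gamma> (s + h)) = ennreal (enn2real (ell (\<gamma> s) (\<gamma> (s + h))))" by simp
  also have "\<dots> \<le> ennreal \<rho>" by (rule ennreal_leI [OF less_imp_le [OF less]])
  finally have "ell (\<gamma> s) (\<gamma> (s + h)) \<le> ennreal \<rho>" .
  then show ?thesis using that [of s "s + h"] s h by simp
qed

end

theorem proposition4p5:
  fixes ll le :: "'a::metric_space \<Rightarrow> 'a \<Rightarrow> bool"
    and ell :: "'a \<Rightarrow> 'a \<Rightarrow> ennreal"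
    and K a b :: real
    and \<gamma> :: "real \<Rightarrow> 'a"
    and U :: "'a set"
  assumes "lorentzian_pre_length_space ll le ell"
    and "strongly_causal ll"
    and "regular_lorentzian ll le ell"
    and "le_comparison_neighbourhood K ll le ell U"
    and "timelike_curve ll \<gamma> a b"
    and "\<gamma> ` {a..b} \<subseteq> U"
    and "ell (\<gamma> a) (\<gamma> b) < model_diameter K"
    and "total_curvature K ll le ell \<gamma> a b < \<infinity>"
  shows "\<forall>t1 t2. a \<le> t1 \<and> t1 < t2 \<and> t2 \<le> b \<longrightarrow> ell_length ell \<gamma> t1 t2 > 0"
proof (intro allI impI, elim conjE)
  fix t1 t2 assume t: "a \<le> t1" "t1 < t2" "t2 \<le> b"
  interpret comparison_curve ll le ell K U \<gamma> a b
    by (intro comparison_curve.intro comparison_space.intro comparison_space_axioms.intro comparison_curve_axioms.intro assms)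
  \<comment> \<open>On triangles of radial parameter at most \<open>r0\<close> all conformal factors lie between \<open>3/4\<close> and \<open>5/4\<close>.\<close>
  define r0 where "r0 = 1 / (1 + \<bar>K\<bar>)"
  have r0: "0 < r0" "r0 \<le> 1" "\<bar>K\<bar> * r0 \<le> 1" by (auto simp: r0_def field_simps)
  have "\<bar>K\<bar> * r0 * r0 \<le> 1 * 1" using r0 by (intro mult_mono) auto
  then have small: "\<bar>K / 4\<bar> * r0\<^sup>2 \<le> 1/4" by (simp add: power2_eq_square mult.assoc)
  then have "0 < 1 + K / 4 * r0\<^sup>2" using small_conformal_factor(1) [OF small] by linarith
  then have rl0: "0 < rlen r0" using radial_length_strict_mono [of 0 r0 "K / 4"] r0 by simp
  obtain \<epsilon> C where C: "0 < \<epsilon>" "0 \<le> C"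
    "\<And>n t. interval_partition a b n t \<Longrightarrow> (\<And>i. i < n \<Longrightarrow> t (Suc i) - t i < \<epsilon>) \<Longrightarrow> rotation_sum (turn \<gamma>) n t \<le> ennreal C"
    by (rule finite_total_curvature [OF assms(8)]) blast
  obtain s t where st: "t1 < s" "s < t" "t < t2" "t - s < \<epsilon>" "ell (\<gamma> s) (\<gamma> t) \<le> ennreal (rlen r0)"
    by (rule short_interval [OF t C(1) rl0])
  have "rotation (turn \<gamma>) s t \<le> ennreal C"
    by (rule rotation_bounded [OF C(1) C(3)]) (use st t in auto)
  then obtain s' t' where st': "s \<le> s'" "s' < t'" "t' \<le> t" "rotation (turn \<gamma>) s' t' \<le> ennreal (1/32)"
    using rotation_small_interval [OF st(2) _ C(2), of "turn \<gamma>" "1/32"] by auto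
  have "ell (\<gamma> s') (\<gamma> t') \<le> ell (\<gamma> s) (\<gamma> t)" using st' st t by (intro curve_ell_mono) auto
  then have "ell (\<gamma> s') (\<gamma> t') \<le> ennreal (rlen r0)" using st(5) by (rule order.trans)
  then show "0 < ell_length ell \<gamma> t1 t2"
    using st st' t by (intro ell_length_pos [OF t(1) _ st'(2) _ t(3) r0(1) small _ st'(4)]) auto
qed

end
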